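(* Let $d>1$ and let $\Pi^d_{\chi,3}$ be the proper vertex $3$-coloring problem on $\mathbb{Z}^d$. Every uniform local algorithm that solves $\Pi^d_{\chi,3}$ has infinite $1$-moment of the coding radius, but there is a uniform local algorithm solving $\Pi^d_{\chi,3}$ all of whose $(1-\varepsilon)$-moments, $0<\varepsilon\le 1$, are finite. In particular, $\mathbf M(\Pi^d_{\chi,3})=1$.
   Context: $\mathbb{Z}^d$ denotes the infinite grid: the Cayley graph of the group $\mathbb{Z}^d$ with respect to the standard generators, each edge being oriented and labelled by its generator (isomorphisms preserve this structure). A uniform local algorithm (for a problem without inputs, with finite output label set $\Sigma_{out}$) is a pair $\mathcal A=(\mathcal C,f)$, where $\mathcal C$ is a collection of rooted finite-radius neighborhoods in $\mathbb{Z}^d$ with vertices labelled by reals in $[0,1]$, and $f:\mathcal C\to\Sigma_{out}$ is measurable. It is run on $\mathbb{Z}^d$ whose vertices carry independent uniform labels from $[0,1]$: each vertex explores balls of radius $0,1,2,\dots$ around itself until the labelled ball lies in $\mathcal C$, and then outputs the value of $f$. It solves a problem if with probability $1$ every vertex outputs a label and the resulting labelling is a valid solution. The coding radius $R_{\mathcal A}$ is the (random) minimal radius a vertex needs to explore. For $\alpha\in[0,\infty)$ the $\alpha$-moment of $R_{\mathcal A}$ is $\mathbf E(R_{\mathcal A}^\alpha)=\sum_{r\in\mathbb N}r^\alpha\,\mathrm P(R_{\mathcal A}=r)$. $\mathbf M(\Pi)\in[0,+\infty]$ is the supremum of all $\alpha\in[0,\infty)$ such that some uniform local algorithm solving $\Pi$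 has finite $\alpha$-moment of its coding radius. *)

theory Defs
  imports "HOL-Probability.Probability"
begin

definition grid_edges :: "'d::finite \<Rightarrow> (int ^ 'd) rel" where
  "grid_edges i = {(u, u + axis i 1) | u. True}"

definition grid_adj :: "(int ^ 'd::finite) rel" where
  "grid_adj = (\<Union>i. grid_edges i \<union> (grid_edges i)\<inverse>)"

definition grid_ball :: "int ^ 'd::finite \<Rightarrow> nat \<Rightarrow> (int ^ 'd) set" where
  "grid_ball v r = {w. \<exists>n\<le>r. (v, w) \<in> grid_adj ^^ n}"

definition unif01 :: "real measure" where
  "unif01 = restrict_space lborel {0..1}"

definition random_labels :: "(int ^ 'd::finite \<Rightarrow> real) measure" where
  "random_labels = PiM UNIV (\<lambda>_. unif01)"

text \<open>
  Isomorphisms of rooted neighborhoods preserve the orientation and the generator of every edge,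
  so the only one between two balls of the grid is a translation. Hence every isomorphism class of
  labelled neighborhoods of radius \<open>r\<close> has exactly one representative rooted at the origin, and it
  is stored as the pair of \<open>r\<close> and an extensional function on \<open>grid_ball 0 r\<close>.
\<close>

type_synonym 'd nbhd = "nat \<times> (int ^ 'd \<Rightarrow> real)"

definition view :: "(int ^ 'd::finite \<Rightarrow> real) \<Rightarrow> int ^ 'd \<Rightarrow> nat \<Rightarrow> 'd nbhd" where
  "view x v r = (r, restrict (\<lambda>w. x (v + w)) (grid_ball 0 r))"

record ('d, 'c) local_alg =
  nbhds :: "'d nbhd set"
  rule :: "'d nbhd \<Rightarrow> 'c"

text \<open>
  Measurability is with respect to the disjoint union over \<open>r\<close> of the spaces of \<open>[0,1]\<close>-labellings
  of \<open>grid_ball 0 r\<close>. As usual for a measurable partial function, the domain has to be measurable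
  too. Membership in the sigma-algebra also forces the labels to lie in \<open>[0,1]\<close>.
\<close>

definition uniform_local_alg :: "'c set \<Rightarrow> ('d::finite, 'c) local_alg \<Rightarrow> bool" where
  "uniform_local_alg \<Sigma> A \<longleftrightarrow>
     finite \<Sigma> \<and>
     (\<forall>r. {y. (r, y) \<in> nbhds A} \<in> sets (PiM (grid_ball 0 r) (\<lambda>_. unif01)) \<and>
          (\<lambda>y. rule A (r, y)) \<in>
            restrict_space (PiM (grid_ball 0 r) (\<lambda>_. unif01)) {y. (r, y) \<in> nbhds A}
              \<rightarrow>\<^sub>M count_space \<Sigma>)"

definition halts :: "('d::finite, 'c) local_alg \<Rightarrow> (int ^ 'd \<Rightarrow> real) \<Rightarrow> int ^ 'd \<Rightarrow> bool" where
  "halts A x v \<longleftrightarrow> (\<exists>r. view x v r \<in> nbhds A)"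

definition coding_radius ::
  "('d::finite, 'c) local_alg \<Rightarrow> (int ^ 'd \<Rightarrow> real) \<Rightarrow> int ^ 'd \<Rightarrow> enat" where
  "coding_radius A x v =
     (if halts A x v then enat (LEAST r. view x v r \<in> nbhds A) else \<infinity>)"

text \<open>Only meaningful at vertices where the algorithm halts.\<close>

definition alg_output :: "('d::finite, 'c) local_alg \<Rightarrow> (int ^ 'd \<Rightarrow> real) \<Rightarrow> int ^ 'd \<Rightarrow> 'c" where
  "alg_output A x v = rule A (view x v (LEAST r. view x v r \<in> nbhds A))"

record ('d, 'c) grid_problem =
  out_labels :: "'c set"
  valid :: "(int ^ 'd \<Rightarrow> 'c) \<Rightarrow> bool"

definition solves :: "('d::finite, 'c) local_alg \<Rightarrow> ('d, 'c) grid_problem \<Rightarrow> bool" where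
  "solves A P \<longleftrightarrow>
     uniform_local_alg (out_labels P) A \<and>
     (AE x in random_labels. (\<forall>v. halts A x v) \<and> valid P (alg_output A x))"

text \<open>
  The law of the coding radius does not depend on the vertex, so it is taken at the origin.
  Since \<open>0 powr 0 = 0\<close>, the term for \<open>r = 0\<close> is dropped when \<open>\<alpha> = 0\<close>; it would contribute at
  most 1, so finiteness is not affected.
\<close>

definition moment :: "('d::finite, 'c) local_alg \<Rightarrow> real \<Rightarrow> ennreal" where
  "moment A \<alpha> =
     (\<Sum>r. ennreal (real r powr \<alpha>) *
        emeasure random_labels {x \<in> space random_labels. coding_radius A x 0 = enat r})"

definition sup_moment :: "('d::finite, 'c) grid_problem \<Rightarrow> ennreal" where
  "sup_moment P = Sup {ennreal \<alpha> | \<alpha>. 0 \<le> \<alpha> \<and> (\<exists>A. solves A P \<and> moment A \<alpha> < \<infinity>)}"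

definition proper_coloring :: "nat \<Rightarrow> ('d::finite, nat) grid_problem" where
  "proper_coloring k =
     \<lparr>out_labels = {..<k}, valid = (\<lambda>c. \<forall>(u, v) \<in> grid_adj. c u \<noteq> c v)\<rparr>"

end

theory Submission
  imports Defs "HOL-Real_Asymp.Real_Asymp"
begin

text \<open>
  Lower bound. A proper 3-colouring of the grid lifts to a height function: adjacent heights differ
  by \<open>\<plusminus>1\<close>, and the change of height around every 4-cycle, hence around every rectangle, is 0. If the
  coding radius has finite mean, then at a large scale \<open>r\<close> all vertices on the boundary of a rectangle
  of side \<open>O(r)\<close> have coding radius below \<open>r\<close> with high probability. So the colouring along a loop
  around a cylinder of circumference \<open>n = O(r)\<close> makes sense, and its height change is nearly a constant
  \<open>t n\<close>, because two distant loops see independent labels and have the same height change. Exchanging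
  halves of such loops shows that \<open>t\<close> is affine; its slope is odd by parity and, since \<open>\<bar>t n\<bar> \<le> n\<close>, is
  \<open>\<plusminus>1\<close>. Hence almost surely all steps in one direction have the same sign, so the colouring has
  period 3 in that direction, which contradicts the independence of the colours of distant vertices.

  Upper bound. At level \<open>k\<close>, random cubes of side about \<open>b k = 2 ^ (k + 6)^2\<close> are separated by walls
  of width \<open>O(b (k - 1))\<close>, the diameter of the islands of lower level. An island of level \<open>k\<close> is a
  cube cluster together with the lower islands touching it, thickened by 3, so that every lower island
  is either well inside or well outside. In each island one of the two checkerboard phases of the colours
  0 and 1 is chosen, and in a collar of width 3 along its boundary the height passes to the phase of
  the next larger island. A vertex stops as soon as it is in some cube cluster. The levels are
  independent, so a vertex is undecided after \<open>k\<close> levels with probability at most the product of the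
  wall densities, and this product telescopes to \<open>b k\<close> to the power \<open>- 1 + o(1)\<close>.
\<close>

section \<open>Functions of independent uniform labels\<close>

text \<open>The exponent 1 comes from one comparison. A loop at scale \<open>r\<close> has length of
  order \<open>r\<close>, so it is decided with high probability once \<open>r * tau r\<close> is
  small, where \<open>tau r\<close> is the probability that the coding radius exceeds
  \<open>r\<close>; a finite mean makes \<open>r * tau r\<close> tend to 0. The hypothesis speaks of
  the grid only, not of cylinders or glued loops. These are truncated runs on relabelled grids:
  where the relabelling is injective on the window that is read, the law is that of the grid. The
  exponent \<open>(k + 6)^2\<close> balances two demands. The ratio \<open>b (k + 1) / b k\<close>
  has to beat the constants and powers of \<open>k\<close> lost at each level, but
  \<open>b k\<close> must be \<open>b (k - 1)\<close> to the power \<open>1 + o(1)\<close>: a vertex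
  missed by all levels below \<open>k\<close>, which has probability about
  \<open>1 / b (k - 1)\<close>, may have to look as far as \<open>b k\<close>. The 6 makes crude
  estimates valid from level 0 on. The collar has width 3 because adding 3 to the height keeps the
  colour and changes the parity.\<close>

definition lab :: "('k \<Rightarrow> real) measure" where
  "lab = PiM UNIV (\<lambda>_. unif01)"

lemma random_labels_eq: "random_labels = lab"
  by (simp add: random_labels_def lab_def)

lemma space_unif01: "space unif01 = {0..1}"
  by (simp add: unif01_def space_restrict_space)

lemma prob_space_unif01: "prob_space unif01"
proof
  show "emeasure unif01 (space unif01) = 1"
    unfolding space_unif01 by (simp add: unif01_def emeasure_restrict_space)
qed

interpretation U: prob_space unif01 by (rule prob_space_unif01)

lemma prob_space_lab: "prob_space lab"
  unfolding lab_def by (intro prob_space_PiM prob_space_unif01)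

interpretation L: prob_space "lab :: ('k \<Rightarrow> real) measure" by (rule prob_space_lab)

lemma space_lab: "space lab = {x. \<forall>k. x k \<in> {0..1}}"
  by (auto simp: lab_def space_PiM space_unif01)

lemma sets_unif01 [measurable_cong]: "sets unif01 = sets (restrict_space borel {0..1})"
  by (simp add: unif01_def sets_restrict_space)

lemma lab_component [measurable]: "(\<lambda>x. x k) \<in> lab \<rightarrow>\<^sub>M unif01"
  unfolding lab_def by simp

definition depends_on :: "(('k \<Rightarrow> real) \<Rightarrow> 'b) \<Rightarrow> 'k set \<Rightarrow> bool" where
  "depends_on f V \<longleftrightarrow> (\<forall>x y. (\<forall>w\<in>V. x w = y w) \<longrightarrow> f x = f y)"

lemma depends_onI: "(\<And>x y. (\<And>w. w \<in> V \<Longrightarrow> x w = y w) \<Longrightarrow> f x = f y) \<Longrightarrow> depends_on f V"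
  unfolding depends_on_def by blast

lemma depends_onD: "depends_on f V \<Longrightarrow> (\<And>w. w \<in> V \<Longrightarrow> x w = y w) \<Longrightarrow> f x = f y"
  unfolding depends_on_def by blast

text \<open>The default 1 lies in \<open>{0..1}\<close>, so the extension is again a labelling; and
  it is never strictly below a density of at most 1, so a vertex outside \<open>V\<close> never
  becomes a cluster centre.\<close>

definition ext_lab :: "'k set \<Rightarrow> ('k \<Rightarrow> real) \<Rightarrow> 'k \<Rightarrow> real" where
  "ext_lab V x = (\<lambda>w. if w \<in> V then x w else 1)"

lemma ext_lab_measurable [measurable]: "ext_lab V \<in> PiM V (\<lambda>_. unif01) \<rightarrow>\<^sub>M lab"
  unfolding lab_def ext_lab_def
proof (rule measurable_PiM_single')
  fix k
  show "(\<lambda>x. if k \<in> V then x k else 1) \<in> PiM V (\<lambda>_. unif01) \<rightarrow>\<^sub>M unif01"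
    by (cases "k \<in> V") (auto simp: space_unif01)
qed (auto simp: space_PiM space_unif01 PiE_iff)

lemma depends_on_ext_lab: "depends_on f V \<Longrightarrow> f (ext_lab V (restrict x V)) = f x"
  by (erule depends_onD) (simp add: ext_lab_def)

lemma pred_ext_lab:
  assumes "Measurable.pred lab Q"
  shows "Measurable.pred (PiM V (\<lambda>_. unif01)) (\<lambda>z. Q (ext_lab V z))"
  using measurable_compose[OF ext_lab_measurable assms] by simp

text \<open>An injective selection of i.i.d. labels is again i.i.d. Injectivity is asked only on the
  coordinates that \<open>Q\<close> reads, and the two index types may differ. This is how a
  periodic or glued labelling is compared with the grid through a bounded window.\<close>

lemma reindex_law:
  fixes Q :: "('a \<Rightarrow> real) \<Rightarrow> bool" and \<rho> :: "'a \<Rightarrow> 'k"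
  assumes Q: "Measurable.pred lab Q" and dep: "depends_on Q V" and inj: "inj_on \<rho> V"
  shows "measure lab {\<omega> \<in> space lab. Q (\<lambda>w. \<omega> (\<rho> w))} = measure lab {x \<in> space lab. Q x}"
proof -
  let ?PV = "PiM V (\<lambda>_. unif01) :: ('a \<Rightarrow> real) measure"
  let ?Q = "\<lambda>z. Q (ext_lab V z)"
  have Qm: "Measurable.pred ?PV ?Q" by (rule pred_ext_lab[OF Q])
  \<comment> \<open>Both laws are reduced to the product over \<open>V\<close>: once along
    \<open>\<rho>\<close>, once along the identity.\<close>
  have 1: "measure lab {\<omega> \<in> space lab. Q (\<lambda>w. \<omega> (\<sigma> w))} = measure ?PV {z \<in> space ?PV. ?Q z}"
    if inj: "inj_on \<sigma> V" for \<sigma> :: "'a \<Rightarrow> 'l"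
  proof -
    have d: "distr lab ?PV (\<lambda>\<omega>. \<lambda>n\<in>V. \<omega> (\<sigma> n)) = ?PV"
      unfolding lab_def by (rule distr_PiM_reindex) (use inj prob_space_unif01 in auto)
    have m: "(\<lambda>\<omega>. \<lambda>n\<in>V. \<omega> (\<sigma> n)) \<in> lab \<rightarrow>\<^sub>M ?PV" by measurable
    have "measure ?PV {z \<in> space ?PV. ?Q z} = measure (distr lab ?PV (\<lambda>\<omega>. \<lambda>n\<in>V. \<omega> (\<sigma> n))) {z \<in> space ?PV. ?Q z}"
      by (simp only: d)
    also have "\<dots> = measure lab ((\<lambda>\<omega>. \<lambda>n\<in>V. \<omega> (\<sigma> n)) -` {z \<in> space ?PV. ?Q z} \<inter> space lab)"
      by (rule measure_distr[OF m]) (use Qm in simp)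
    also have "(\<lambda>\<omega>. \<lambda>n\<in>V. \<omega> (\<sigma> n)) -` {z \<in> space ?PV. ?Q z} \<inter> space lab
        = {\<omega> \<in> space lab. Q (\<lambda>w. \<omega> (\<sigma> w))}"
    proof -
      have "?Q (\<lambda>n\<in>V. \<omega> (\<sigma> n)) = Q (\<lambda>w. \<omega> (\<sigma> w))" for \<omega> :: "'l \<Rightarrow> real"
        by (rule depends_on_ext_lab[OF dep])
      then show ?thesis using measurable_space[OF m] by auto
    qed
    finally show ?thesis by simp
  qed
  from 1[OF inj] 1[of "\<lambda>w. w"] show ?thesis by simp
qed

lemma indep_vars_lab: "L.indep_vars (\<lambda>_. unif01) (\<lambda>k x. x k) (UNIV :: 'k set)"
proof -
  have "(\<lambda>x. restrict (\<lambda>i. x i) UNIV) = (\<lambda>x. x :: 'k \<Rightarrow> real)" by (simp add: fun_eq_iff)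
  moreover have "distr (lab :: ('k \<Rightarrow> real) measure) unif01 (\<lambda>x. x i) = unif01" for i :: 'k
    unfolding lab_def by (rule distr_PiM_component) (auto intro: prob_space_unif01)
  ultimately show ?thesis
    by (subst L.indep_vars_iff_distr_eq_PiM) (simp_all add: lab_def[symmetric] distr_id2)
qed

lemma indep_disjoint:
  fixes Q1 Q2 :: "('k \<Rightarrow> real) \<Rightarrow> bool"
  assumes Q1: "Measurable.pred lab Q1" and d1: "depends_on Q1 V1"
    and Q2: "Measurable.pred lab Q2" and d2: "depends_on Q2 V2" and disj: "V1 \<inter> V2 = {}"
  shows "measure lab {x \<in> space lab. Q1 x \<and> Q2 x}
    = measure lab {x \<in> space lab. Q1 x} * measure lab {x \<in> space lab. Q2 x}"
proof -
  have iv: "L.indep_var (PiM V1 (\<lambda>_. unif01)) (\<lambda>x. restrict (\<lambda>i. x i) V1) (PiM V2 (\<lambda>_. unif01)) (\<lambda>x. restrict (\<lambda>i. x i) V2)"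
    by (rule L.indep_var_restrict[OF indep_vars_lab]) (use disj in auto)
  have "L.indep_var (count_space UNIV) ((\<lambda>z. Q1 (ext_lab V1 z)) \<circ> (\<lambda>x. restrict (\<lambda>i. x i) V1))
     (count_space UNIV) ((\<lambda>z. Q2 (ext_lab V2 z)) \<circ> (\<lambda>x. restrict (\<lambda>i. x i) V2))"
    by (rule L.indep_var_compose[OF iv pred_ext_lab[OF Q1] pred_ext_lab[OF Q2]])
  then have "L.indep_var (count_space UNIV) Q1 (count_space UNIV) Q2"
    by (simp add: o_def depends_on_ext_lab[OF d1] depends_on_ext_lab[OF d2])
  from L.indep_varD[OF this, of "{True}" "{True}"]
  have "measure lab ((\<lambda>x. (Q1 x, Q2 x)) -` ({True} \<times> {True}) \<inter> space lab)
    = measure lab (Q1 -` {True} \<inter> space lab) * measure lab (Q2 -` {True} \<inter> space lab)"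
    by simp
  moreover have "(\<lambda>x. (Q1 x, Q2 x)) -` ({True} \<times> {True}) \<inter> space lab = {x \<in> space lab. Q1 x \<and> Q2 x}"
    "Q1 -` {True} \<inter> space lab = {x \<in> space lab. Q1 x}" "Q2 -` {True} \<inter> space lab = {x \<in> space lab. Q2 x}" by auto
  ultimately show ?thesis by simp
qed

lemma indep_disjoint_family:
  fixes Q :: "'i \<Rightarrow> ('k \<Rightarrow> real) \<Rightarrow> bool"
  assumes fin: "finite I" and Q: "\<And>i. i \<in> I \<Longrightarrow> Measurable.pred lab (Q i)"
    and d: "\<And>i. i \<in> I \<Longrightarrow> depends_on (Q i) (V i)" and disj: "disjoint_family_on V I"
  shows "measure lab {x \<in> space lab. \<forall>i\<in>I. Q i x} = (\<Prod>i\<in>I. measure lab {x \<in> space lab. Q i x})"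
  using assms
proof (induction I)
  case empty
  then show ?case by (simp add: L.prob_space)
next
  case (insert j I)
  have IH: "measure lab {x \<in> space lab. \<forall>i\<in>I. Q i x} = (\<Prod>i\<in>I. measure lab {x \<in> space lab. Q i x})"
    by (rule insert.IH) (use insert.prems in \<open>auto simp: disjoint_family_on_def\<close>)
  have [measurable]: "Measurable.pred lab (\<lambda>x. \<forall>i\<in>I. Q i x)"
    using insert by (intro pred_intros_finite) auto
  have "depends_on (\<lambda>x. \<forall>i\<in>I. Q i x) (\<Union>i\<in>I. V i)"
    by (intro depends_onI ball_cong refl depends_onD[OF insert.prems(2)]) auto
  then have "measure lab {x \<in> space lab. Q j x \<and> (\<forall>i\<in>I. Q i x)}
     = measure lab {x \<in> space lab. Q j x} * measure lab {x \<in> space lab. \<forall>i\<in>I. Q i x}"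
    using insert by (intro indep_disjoint[where ?V1.0 = "V j" and ?V2.0 = "\<Union>i\<in>I. V i"])
       (auto simp: disjoint_family_on_def)
  then show ?case unfolding IH using insert.hyps by simp
qed

text \<open>\<open>P (f = g)\<close> is the sum of \<open>(P (f = t))\<^sup>2\<close> over all \<open>t\<close>, hence at most the largest \<open>P (f = t)\<close>.\<close>

lemma iid_agree_const:
  fixes f g :: "('k \<Rightarrow> real) \<Rightarrow> 'b"
  assumes f: "f \<in> lab \<rightarrow>\<^sub>M count_space UNIV" and df: "depends_on f V1"
    and g: "g \<in> lab \<rightarrow>\<^sub>M count_space UNIV" and dg: "depends_on g V2" and disj: "V1 \<inter> V2 = {}"
    and law: "\<And>t. measure lab {x \<in> space lab. g x = t} = measure lab {x \<in> space lab. f x = t}"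
    and fin: "finite T" and fT: "\<And>x. x \<in> space lab \<Longrightarrow> f x \<in> T"
    and agree: "measure lab {x \<in> space lab. f x = g x} \<ge> 1 - \<eta>"
  shows "\<exists>t\<in>T. measure lab {x \<in> space lab. f x = t} \<ge> 1 - \<eta>"
proof -
  let ?p = "\<lambda>t. measure lab {x \<in> space lab. f x = t}"
  obtain x0 where "x0 \<in> space (lab :: ('k \<Rightarrow> real) measure)" using L.not_empty by blast
  then have Tne: "T \<noteq> {}" using fT by blast
  define m where "m = Max (?p ` T)"
  have pm: "?p t \<le> m" if "t \<in> T" for t using that fin by (auto simp: m_def)
  have predf: "Measurable.pred lab (\<lambda>x. f x = t)" and predg: "Measurable.pred lab (\<lambda>x. g x = t)" for t
    using measurable_compose[OF f, of "\<lambda>y. y = t"] measurable_compose[OF g, of "\<lambda>y. y = t"] by simp_all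
  have eq: "{x \<in> space lab. f x = g x} = (\<Union>t\<in>T. {x \<in> space lab. f x = t \<and> g x = t})"
  proof -
    have "f x = g x \<longleftrightarrow> (\<exists>t\<in>T. f x = t \<and> g x = t)" if "x \<in> space lab" for x
      using fT[OF that] by metis
    then show ?thesis by blast
  qed
  have "measure lab {x \<in> space lab. f x = g x} = (\<Sum>t\<in>T. measure lab {x \<in> space lab. f x = t \<and> g x = t})"
    unfolding eq using fin predf predg
    by (intro L.finite_measure_finite_Union) (auto simp: disjoint_family_on_def)
  also have "\<dots> = (\<Sum>t\<in>T. ?p t * ?p t)"
  proof (rule sum.cong[OF refl])
    fix t
    have "depends_on (\<lambda>x. f x = t) V1" "depends_on (\<lambda>x. g x = t) V2"
      using df dg unfolding depends_on_def by metis+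
    from indep_disjoint[OF predf this(1) predg this(2) disj]
    show "measure lab {x \<in> space lab. f x = t \<and> g x = t} = ?p t * ?p t" by (simp add: law)
  qed
  also have "\<dots> \<le> (\<Sum>t\<in>T. m * ?p t)"
    by (intro sum_mono mult_right_mono pm) auto
  also have "\<dots> = m * measure lab (\<Union>t\<in>T. {x \<in> space lab. f x = t})"
    unfolding sum_distrib_left[symmetric] using fin predf
    by (subst L.finite_measure_finite_Union) (auto simp: disjoint_family_on_def)
  also have "(\<Union>t\<in>T. {x \<in> space lab. f x = t}) = space lab" using fT by auto
  finally have "1 - \<eta> \<le> m" using agree by (simp add: L.prob_space)
  moreover have "m \<in> ?p ` T" unfolding m_def using fin Tne by (intro Max_in) auto
  ultimately show ?thesis by auto
qed

section \<open>Truncated runs of a local algorithm\<close>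

text \<open>Distance in the supremum norm: balls are cubes, so each coordinate can be estimated
  separately. A graph ball lies in the cube of the same radius.\<close>

definition near :: "int \<Rightarrow> int ^ 'd \<Rightarrow> int ^ 'd \<Rightarrow> bool" where
  "near s u v \<longleftrightarrow> (\<forall>i. \<bar>u $ i - v $ i\<bar> \<le> s)"

lemma near_refl [simp]: "0 \<le> s \<Longrightarrow> near s u u"
  by (simp add: near_def)

lemma near_sym: "near s u v \<longleftrightarrow> near s v u"
  by (simp add: near_def abs_minus_commute)

lemma near_mono: "near s u v \<Longrightarrow> s \<le> t \<Longrightarrow> near t u v"
  unfolding near_def by (meson order_trans)

lemma near_trans:
  assumes "near s u v" "near t v w"
  shows "near (s + t) u w"
  unfolding near_def
proof
  fix i
  have "\<bar>u $ i - v $ i\<bar> \<le> s" "\<bar>v $ i - w $ i\<bar> \<le> t" using assms by (auto simp: near_def)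
  then show "\<bar>u $ i - w $ i\<bar> \<le> s + t" by linarith
qed

lemma near_translate [simp]: "near s (t + u) (t + v) \<longleftrightarrow> near s u v"
  by (simp add: near_def)

lemma grid_adj_iff: "(u, v) \<in> grid_adj \<longleftrightarrow> (\<exists>i. v = u + axis i 1 \<or> u = v + axis i 1)"
  by (auto simp: grid_adj_def grid_edges_def)

lemma grid_adj_near: "(u, v) \<in> grid_adj \<Longrightarrow> near 1 u v"
  by (auto simp: grid_adj_iff near_def axis_def)

lemma grid_adj_pow_near: "(u, v) \<in> grid_adj ^^ n \<Longrightarrow> near (int n) u v"
proof (induction n arbitrary: v)
  case (Suc n)
  then obtain w where "(u, w) \<in> grid_adj ^^ n" "(w, v) \<in> grid_adj" by auto
  then have "near (int n + 1) u v" using Suc.IH grid_adj_near near_trans by blast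
  then show ?case by (simp add: add.commute)
qed simp

lemma grid_ball_near: "w \<in> grid_ball v r \<Longrightarrow> near (int r) v w"
  by (auto simp: grid_ball_def intro: near_mono[OF grid_adj_pow_near])

definition good :: "('d::finite, 'c) local_alg \<Rightarrow> nat \<Rightarrow> (int ^ 'd \<Rightarrow> real) \<Rightarrow> int ^ 'd \<Rightarrow> bool" where
  "good A r y v \<longleftrightarrow> (\<exists>s\<le>r. view y v s \<in> nbhds A)"

text \<open>The run truncated at radius \<open>r\<close>: a total function that reads only the
  labels within distance \<open>r\<close>. The default 0 is itself a colour, so the values stay
  below 3 where the run is cut off.\<close>

definition col :: "('d::finite, nat) local_alg \<Rightarrow> nat \<Rightarrow> (int ^ 'd \<Rightarrow> real) \<Rightarrow> int ^ 'd \<Rightarrow> nat" where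
  "col A r y v = (if good A r y v then alg_output A y v else 0)"

lemma view_cong:
  assumes "\<And>w. near (int r) v w \<Longrightarrow> y w = y' w" "s \<le> r"
  shows "view y v s = view y' v s"
proof -
  have "y (v + w) = y' (v + w)" if "w \<in> grid_ball 0 s" for w
  proof -
    have "near (int r) 0 w" using grid_ball_near[OF that] near_mono assms(2) by fastforce
    then have "near (int r) v (v + w)" using near_translate[of "int r" v 0 w] by simp
    then show ?thesis by (rule assms(1))
  qed
  then show ?thesis by (auto simp: view_def restrict_def)
qed

lemma good_cong:
  assumes "\<And>w. near (int r) v w \<Longrightarrow> y w = y' w"
  shows "good A r y v = good A r y' v"
proof -
  have "view y v s = view y' v s" if "s \<le> r" for s using assms that by (rule view_cong)
  then show ?thesis unfolding good_def by metis
qed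

lemma good_least:
  assumes "good A r y v"
  obtains s where "s \<le> r" "view y v s \<in> nbhds A" "\<And>s'. s' < s \<Longrightarrow> view y v s' \<notin> nbhds A"
    "alg_output A y v = rule A (view y v s)"
proof -
  let ?s = "LEAST s. view y v s \<in> nbhds A"
  obtain s0 where s0: "s0 \<le> r" "view y v s0 \<in> nbhds A" using assms by (auto simp: good_def)
  show thesis
  proof (rule that[of ?s])
    show "?s \<le> r" using Least_le[of "\<lambda>s. view y v s \<in> nbhds A", OF s0(2)] s0(1) by simp
    show "view y v ?s \<in> nbhds A" using s0(2) by (rule LeastI)
    show "\<And>s'. s' < ?s \<Longrightarrow> view y v s' \<notin> nbhds A" by (rule not_less_Least)
  qed (simp add: alg_output_def)
qed

lemma alg_output_eqI:
  assumes "view y v s \<in> nbhds A" "\<And>s'. s' < s \<Longrightarrow> view y v s' \<notin> nbhds A"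
  shows "alg_output A y v = rule A (view y v s)"
proof -
  have "(LEAST s. view y v s \<in> nbhds A) = s"
    using assms by (intro Least_equality) (auto simp: not_le[symmetric])
  then show ?thesis by (simp add: alg_output_def)
qed

lemma coding_radius_eq_enat:
  "coding_radius A x v = enat s \<longleftrightarrow> view x v s \<in> nbhds A \<and> (\<forall>s'<s. view x v s' \<notin> nbhds A)"
proof
  assume *: "coding_radius A x v = enat s"
  then obtain s0 where s0: "view x v s0 \<in> nbhds A" by (auto simp: coding_radius_def halts_def split: if_splits)
  from * have s: "s = (LEAST s. view x v s \<in> nbhds A)" by (simp add: coding_radius_def split: if_splits)
  have "view x v s \<in> nbhds A" unfolding s using s0 by (rule LeastI)
  moreover have "view x v s' \<notin> nbhds A" if "s' < s" for s' using that unfolding s by (rule not_less_Least)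
  ultimately show "view x v s \<in> nbhds A \<and> (\<forall>s'<s. view x v s' \<notin> nbhds A)" by blast
next
  assume *: "view x v s \<in> nbhds A \<and> (\<forall>s'<s. view x v s' \<notin> nbhds A)"
  then have "(LEAST s. view x v s \<in> nbhds A) = s"
    by (intro Least_equality) (auto simp: not_le[symmetric])
  then show "coding_radius A x v = enat s" using * by (auto simp: coding_radius_def halts_def)
qed

lemma col_cong:
  assumes "\<And>w. near (int r) v w \<Longrightarrow> y w = y' w"
  shows "col A r y v = col A r y' v"
proof (cases "good A r y v")
  case True
  then obtain s where s: "s \<le> r" "view y v s \<in> nbhds A" "\<And>s'. s' < s \<Longrightarrow> view y v s' \<notin> nbhds A"
    "alg_output A y v = rule A (view y v s)" by (rule good_least) blast
  have eq: "view y' v s' = view y v s'" if "s' \<le> s" for s'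
    by (rule sym, rule view_cong[of r]) (use assms s(1) that in auto)
  have "alg_output A y' v = rule A (view y' v s)"
    by (rule alg_output_eqI) (use s eq in auto)
  then show ?thesis using True good_cong[OF assms, where A = A] s eq by (simp add: col_def)
qed (use good_cong[OF assms, where A = A] in \<open>simp add: col_def\<close>)

lemma view_shift: "view (\<lambda>w. x (t + w)) v s = view x (t + v) s"
  by (simp add: view_def add.assoc)

lemma good_shift: "good A r (\<lambda>w. x (t + w)) v = good A r x (t + v)"
  by (simp add: good_def view_shift)

lemma alg_output_shift: "alg_output A (\<lambda>w. x (t + w)) v = alg_output A x (t + v)"
  by (simp add: alg_output_def view_shift)

lemma col_shift: "col A r (\<lambda>w. x (t + w)) v = col A r x (t + v)"
  by (simp add: col_def good_shift alg_output_shift)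

lemma good_mono: "good A r x v \<Longrightarrow> r \<le> r' \<Longrightarrow> good A r' x v"
  unfolding good_def by (meson order_trans)

lemma view_measurable: "(\<lambda>x. restrict (\<lambda>w. x (v + w)) (grid_ball 0 s)) \<in> lab \<rightarrow>\<^sub>M PiM (grid_ball 0 s) (\<lambda>_. unif01)"
  by measurable

lemma pred_view_nbhds:
  assumes "uniform_local_alg \<Sigma> A"
  shows "Measurable.pred lab (\<lambda>x. view x v s \<in> nbhds A)"
proof -
  have "{y. (s, y) \<in> nbhds A} \<in> sets (PiM (grid_ball 0 s) (\<lambda>_. unif01))"
    using assms by (auto simp: uniform_local_alg_def)
  from measurable_sets[OF view_measurable this, of v]
  show ?thesis
    by (simp add: view_def pred_def Int_def vimage_def conj_commute)
qed

lemma rule_range: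
  assumes A: "uniform_local_alg \<Sigma> A" and x: "x \<in> space lab" and v: "view x v s \<in> nbhds A"
  shows "rule A (view x v s) \<in> \<Sigma>"
proof -
  let ?z = "restrict (\<lambda>w. x (v + w)) (grid_ball 0 s)"
  have "?z \<in> space (PiM (grid_ball 0 s) (\<lambda>_. unif01))"
    using measurable_space[OF view_measurable x] .
  moreover have "(\<lambda>y. rule A (s, y)) \<in>
      restrict_space (PiM (grid_ball 0 s) (\<lambda>_. unif01)) {y. (s, y) \<in> nbhds A} \<rightarrow>\<^sub>M count_space \<Sigma>"
    using A by (auto simp: uniform_local_alg_def)
  ultimately show ?thesis
    using v measurable_space[of "\<lambda>y. rule A (s, y)" _ "count_space \<Sigma>" ?z]
    by (auto simp: view_def space_restrict_space)
qed

lemma pred_rule: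
  assumes A: "uniform_local_alg \<Sigma> A"
  shows "Measurable.pred lab (\<lambda>x. view x v s \<in> nbhds A \<and> rule A (view x v s) = c)"
proof (cases "c \<in> \<Sigma>")
  case True
  let ?M = "PiM (grid_ball 0 s) (\<lambda>_. unif01)" and ?N = "{y. (s, y) \<in> nbhds A}"
  have N: "?N \<in> sets ?M" and r: "(\<lambda>y. rule A (s, y)) \<in> restrict_space ?M ?N \<rightarrow>\<^sub>M count_space \<Sigma>"
    using A by (auto simp: uniform_local_alg_def)
  have "(\<lambda>y. rule A (s, y)) -` {c} \<inter> space (restrict_space ?M ?N) \<in> sets (restrict_space ?M ?N)"
    using True by (intro measurable_sets[OF r]) auto
  then have "(\<lambda>y. rule A (s, y)) -` {c} \<inter> space (restrict_space ?M ?N) \<in> sets ?M"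
    using N by (subst (asm) sets_restrict_space_iff) auto
  from measurable_sets[OF view_measurable this, of v]
  have "(\<lambda>x. \<lambda>w\<in>grid_ball 0 s. x (v + w)) -`
      ((\<lambda>y. rule A (s, y)) -` {c} \<inter> space (restrict_space ?M ?N)) \<inter> space lab \<in> sets lab" .
  also have "(\<lambda>x. \<lambda>w\<in>grid_ball 0 s. x (v + w)) -`
      ((\<lambda>y. rule A (s, y)) -` {c} \<inter> space (restrict_space ?M ?N)) \<inter> space lab
    = {x \<in> space lab. view x v s \<in> nbhds A \<and> rule A (view x v s) = c}"
    using measurable_space[OF view_measurable, of _ v s]
    by (auto simp: view_def space_restrict_space)
  finally show ?thesis by (simp add: pred_def)
next
  case False
  then have "{x \<in> space lab. view x v s \<in> nbhds A \<and> rule A (view x v s) = c} = {}"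
    using rule_range[OF A] by auto
  then show ?thesis by (simp only: pred_def sets.empty_sets)
qed

lemma pred_good:
  assumes "uniform_local_alg \<Sigma> A"
  shows "Measurable.pred lab (\<lambda>x. good A r x v)"
  unfolding good_def using pred_view_nbhds[OF assms] by measurable

lemma pred_good_output:
  assumes "uniform_local_alg \<Sigma> A"
  shows "Measurable.pred lab (\<lambda>x. good A r x v \<and> alg_output A x v = c)"
proof -
  have eq: "(good A r x v \<and> alg_output A x v = c) \<longleftrightarrow>
     (\<exists>s\<le>r. (view x v s \<in> nbhds A \<and> rule A (view x v s) = c) \<and> (\<forall>s'<s. view x v s' \<notin> nbhds A))" for x
  proof
    assume "good A r x v \<and> alg_output A x v = c"
    then show "\<exists>s\<le>r. (view x v s \<in> nbhds A \<and> rule A (view x v s) = c) \<and> (\<forall>s'<s. view x v s' \<notin> nbhds A)"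
      by (metis good_least)
  next
    assume "\<exists>s\<le>r. (view x v s \<in> nbhds A \<and> rule A (view x v s) = c) \<and> (\<forall>s'<s. view x v s' \<notin> nbhds A)"
    then show "good A r x v \<and> alg_output A x v = c"
      using alg_output_eqI[of x v _ A] by (auto simp: good_def)
  qed
  show ?thesis unfolding eq
    using pred_view_nbhds[OF assms] pred_rule[OF assms] by measurable
qed

lemma col_measurable:
  assumes "uniform_local_alg \<Sigma> A"
  shows "(\<lambda>x. col A r x v) \<in> lab \<rightarrow>\<^sub>M count_space UNIV"
proof (subst measurable_count_space_eq2_countable, simp, safe)
  fix c
  have eq: "(\<lambda>x. col A r x v) -` {c} \<inter> space lab
     = {x \<in> space lab. (good A r x v \<and> alg_output A x v = c) \<or> (\<not> good A r x v \<and> c = 0)}"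
    by (auto simp: col_def split: if_splits)
  define P where "P = (\<lambda>x. good A r x v \<and> alg_output A x v = c)"
  have [measurable]: "Measurable.pred lab P" "Measurable.pred lab (\<lambda>x. good A r x v)"
    unfolding P_def by (rule pred_good_output[OF assms] pred_good[OF assms])+
  have "Measurable.pred lab (\<lambda>x. P x \<or> (\<not> good A r x v \<and> c = 0))" by measurable
  then show "(\<lambda>x. col A r x v) -` {c} \<inter> space lab \<in> sets lab"
    unfolding eq by (simp add: pred_def P_def)
qed

lemma col_range:
  assumes "uniform_local_alg {..<3} A" "x \<in> space lab"
  shows "col A r x v < 3"
proof (cases "good A r x v")
  case True
  then obtain s where "view x v s \<in> nbhds A" "alg_output A x v = rule A (view x v s)"
    by (rule good_least) blast
  then show ?thesis using rule_range[OF assms, of v s] True by (auto simp: col_def)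
qed (simp add: col_def)

section \<open>Lower bound: height functions of 3-colourings\<close>

section \<open>Height changes along paths\<close>

text \<open>The value is \<plusminus>1 even for equal colours, so parity and length bounds for
  height changes hold for truncated, possibly improper colourings too.\<close>

definition inc :: "nat \<Rightarrow> nat \<Rightarrow> int" where
  "inc a b = (if b mod 3 = Suc a mod 3 then 1 else -1)"

lemma inc_cases: "inc a b = 1 \<or> inc a b = -1"
  by (simp add: inc_def)

text \<open>Each increment is the difference of the colours modulo 3, so the total around the
  4-cycle is a multiple of 3; it is even and at most 4 in absolute value, hence 0.\<close>

lemma inc_square:
  assumes "a < 3" "b < 3" "c < 3" "d < 3" "a \<noteq> b" "b \<noteq> d" "a \<noteq> c" "c \<noteq> d"
  shows "inc a b + inc b d = inc a c + inc c d"
proof -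
  have n: "n = 0 \<or> n = 1 \<or> n = 2" if "n < 3" for n :: nat using that by auto
  show ?thesis using n[OF assms(1)] n[OF assms(2)] n[OF assms(3)] n[OF assms(4)] assms(5-)
    by (elim disjE) (simp_all add: inc_def)
qed

text \<open>Column by column: a strip of width one is a stack of 4-cycles.\<close>

lemma inc_rectangle:
  fixes f :: "nat \<Rightarrow> nat \<Rightarrow> nat"
  assumes lt: "\<And>i j. f i j < 3" and h: "\<And>i j. f i j \<noteq> f (Suc i) j" and v: "\<And>i j. f i j \<noteq> f i (Suc j)"
  shows "(\<Sum>i<n. inc (f i 0) (f (Suc i) 0)) + (\<Sum>j<N. inc (f n j) (f n (Suc j)))
       = (\<Sum>j<N. inc (f 0 j) (f 0 (Suc j))) + (\<Sum>i<n. inc (f i N) (f (Suc i) N))"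
proof (induction n)
  case (Suc n)
  have "inc (f n 0) (f (Suc n) 0) + (\<Sum>j<N. inc (f (Suc n) j) (f (Suc n) (Suc j)))
     = (\<Sum>j<N. inc (f n j) (f n (Suc j))) + inc (f n N) (f (Suc n) N)"
  proof (induction N)
    case (Suc N)
    have "inc (f n N) (f (Suc n) N) + inc (f (Suc n) N) (f (Suc n) (Suc N))
      = inc (f n N) (f n (Suc N)) + inc (f n (Suc N)) (f (Suc n) (Suc N))"
      by (rule inc_square) (use lt h v in auto)
    with Suc.IH show ?case by simp
  qed simp
  with Suc.IH show ?case by simp
qed simp

text \<open>The third claim turns a nearly extremal sum into a bound on the number of exceptional
  terms, each of which costs 2.\<close>

lemma sum_pm_one:
  fixes f :: "nat \<Rightarrow> int"
  assumes "\<And>i. f i = 1 \<or> f i = -1"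
  shows "\<bar>\<Sum>i<n. f i\<bar> \<le> int n" "even ((\<Sum>i<n. f i) - int n)"
    "\<sigma> = 1 \<or> \<sigma> = -1 \<Longrightarrow> \<sigma> * (\<Sum>i<n. f i) = int n - 2 * (\<Sum>i<n. if f i = \<sigma> then 0 else 1)"
proof (induction n)
  case (Suc n)
  { case 1 then show ?case using Suc(1) assms[of n] by auto }
  { case 2 then show ?case using Suc(2) assms[of n] by auto }
  { case 3 then show ?case using Suc(3) assms[of n] by (auto simp: algebra_simps) }
qed auto

lemma binop_count_space:
  fixes f :: "'a \<Rightarrow> 'b::countable" and g :: "'a \<Rightarrow> 'c::countable"
  assumes "f \<in> M \<rightarrow>\<^sub>M count_space UNIV" "g \<in> M \<rightarrow>\<^sub>M count_space UNIV"
  shows "(\<lambda>x. h (f x) (g x)) \<in> M \<rightarrow>\<^sub>M count_space UNIV"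
proof -
  have "(\<lambda>x. (f x, g x)) \<in> M \<rightarrow>\<^sub>M count_space UNIV \<Otimes>\<^sub>M count_space UNIV"
    using assms by measurable
  then have "(\<lambda>x. (f x, g x)) \<in> M \<rightarrow>\<^sub>M count_space UNIV"
    by (subst (asm) pair_measure_countable) auto
  from measurable_compose[OF this, of "case_prod h"] show ?thesis by simp
qed

lemma sum_count_space:
  fixes f :: "nat \<Rightarrow> 'a \<Rightarrow> int"
  assumes "\<And>i. f i \<in> M \<rightarrow>\<^sub>M count_space UNIV"
  shows "(\<lambda>x. \<Sum>i<n. f i x) \<in> M \<rightarrow>\<^sub>M count_space UNIV"
proof (induction n)
  case (Suc n)
  show ?case using binop_count_space[OF Suc assms[of n], of "(+)"] by simp
qed simp

text \<open>The assumption on the dimension enters as two distinct directions; all paths lie in the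
  plane that they span.\<close>

locale three_colouring =
  fixes A :: "('d::finite, nat) local_alg" and i1 i2 :: 'd
  assumes ne: "i1 \<noteq> i2" and sol: "solves A (proper_coloring 3)"
begin

lemma ula: "uniform_local_alg {..<3} A"
  using sol by (simp add: solves_def proper_coloring_def)

lemma AE_proper:
  "AE x in lab. (\<forall>v. halts A x v) \<and> (\<forall>u v. (u, v) \<in> grid_adj \<longrightarrow> alg_output A x u \<noteq> alg_output A x v)"
proof -
  have "AE x in random_labels. (\<forall>v. halts A x v) \<and> (\<forall>(u, v)\<in>grid_adj. alg_output A x u \<noteq> alg_output A x v)"
    using sol by (simp add: solves_def proper_coloring_def)
  then show ?thesis unfolding random_labels_eq by eventually_elim auto
qed

definition pt :: "int \<Rightarrow> int \<Rightarrow> int ^ 'd" where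
  "pt a b = (\<chi> i. if i = i1 then a else if i = i2 then b else 0)"

lemma pt_1 [simp]: "pt a b $ i1 = a" and pt_2 [simp]: "pt a b $ i2 = b"
  using ne by (auto simp: pt_def)

lemma pt_add: "pt a b + pt c d = pt (a + c) (b + d)"
  by (simp add: pt_def vec_eq_iff)

lemma pt_0: "pt 0 0 = 0"
  by (simp add: pt_def vec_eq_iff)

lemma pt_adj: "(pt a b, pt (a + 1) b) \<in> grid_adj" "(pt a b, pt a (b + 1)) \<in> grid_adj"
  unfolding grid_adj_iff
  by (intro exI[of _ i1] exI[of _ i2]; use ne in \<open>auto simp: pt_def axis_def vec_eq_iff\<close>)+

abbreviation "C \<equiv> col A"

definition hs :: "nat \<Rightarrow> (int ^ 'd \<Rightarrow> real) \<Rightarrow> int \<Rightarrow> int \<Rightarrow> nat \<Rightarrow> int" where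
  "hs r y a b n = (\<Sum>i<n. inc (C r y (pt (a + int i) b)) (C r y (pt (a + int i + 1) b)))"

definition vs :: "nat \<Rightarrow> (int ^ 'd \<Rightarrow> real) \<Rightarrow> int \<Rightarrow> int \<Rightarrow> nat \<Rightarrow> int" where
  "vs r y a b n = (\<Sum>i<n. inc (C r y (pt a (b + int i))) (C r y (pt a (b + int i + 1))))"

lemma hs_cong:
  assumes "\<And>w. a - int r \<le> w $ i1 \<Longrightarrow> w $ i1 \<le> a + int n + int r \<Longrightarrow> \<bar>w $ i2 - b\<bar> \<le> int r \<Longrightarrow> y w = y' w"
  shows "hs r y a b n = hs r y' a b n"
  unfolding hs_def
proof (rule sum.cong[OF refl])
  fix i assume i: "i \<in> {..<n}"
  have "C r y (pt c b) = C r y' (pt c b)" if "a \<le> c" "c \<le> a + int n" for c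
  proof (rule col_cong, rule assms)
    fix w assume "near (int r) (pt c b) w"
    from this[unfolded near_def, rule_format, of i1] this[unfolded near_def, rule_format, of i2] that
    show "a - int r \<le> w $ i1" "w $ i1 \<le> a + int n + int r" "\<bar>w $ i2 - b\<bar> \<le> int r" by auto
  qed
  then show "inc (C r y (pt (a + int i) b)) (C r y (pt (a + int i + 1) b))
    = inc (C r y' (pt (a + int i) b)) (C r y' (pt (a + int i + 1) b))" using i by simp
qed

text \<open>The window is restricted in direction \<open>i1\<close> only. This suffices because the
  cylinder wraps around in that direction alone.\<close>

lemma vs_cong:
  assumes "\<And>w. \<bar>w $ i1 - a\<bar> \<le> int r \<Longrightarrow> y w = y' w"
  shows "vs r y a b n = vs r y' a b n"
  unfolding vs_def
proof (rule sum.cong[OF refl])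
  fix i
  have "C r y (pt a c) = C r y' (pt a c)" for c
  proof (rule col_cong, rule assms)
    fix w assume "near (int r) (pt a c) w"
    from this[unfolded near_def, rule_format, of i1] show "\<bar>w $ i1 - a\<bar> \<le> int r" by auto
  qed
  then show "inc (C r y (pt a (b + int i))) (C r y (pt a (b + int i + 1)))
    = inc (C r y' (pt a (b + int i))) (C r y' (pt a (b + int i + 1)))" by simp
qed

lemma hs_shift: "hs r (\<lambda>w. y (pt c d + w)) a b n = hs r y (c + a) (d + b) n"
  by (simp add: hs_def col_shift pt_add add.assoc)

lemma vs_shift: "vs r (\<lambda>w. y (pt c d + w)) a b n = vs r y (c + a) (d + b) n"
  by (simp add: vs_def col_shift pt_add add.assoc)

lemma hs_split: "hs r y a b (m + n) = hs r y a b m + hs r y (a + int m) b n"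
  by (induction n) (simp_all add: hs_def add.assoc)

lemma hs_measurable [measurable]: "(\<lambda>x. hs r x a b n) \<in> lab \<rightarrow>\<^sub>M count_space UNIV"
proof -
  have [measurable]: "(\<lambda>x. C r x v) \<in> lab \<rightarrow>\<^sub>M count_space UNIV" for v by (rule col_measurable[OF ula])
  show ?thesis unfolding hs_def by (rule sum_count_space, rule binop_count_space[where h = inc]) measurable
qed

lemma vs_measurable [measurable]: "(\<lambda>x. vs r x a b n) \<in> lab \<rightarrow>\<^sub>M count_space UNIV"
proof -
  have [measurable]: "(\<lambda>x. C r x v) \<in> lab \<rightarrow>\<^sub>M count_space UNIV" for v by (rule col_measurable[OF ula])
  show ?thesis unfolding vs_def by (rule sum_count_space, rule binop_count_space[where h = inc]) measurable
qed

definition tau :: "nat \<Rightarrow> real" where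
  "tau r = measure lab {x \<in> space lab. \<not> good A r x 0}"

lemma tau_nonneg: "0 \<le> tau r" by (simp add: tau_def)

lemma good_measurable [measurable]: "Measurable.pred lab (\<lambda>x. good A r x v)"
  by (rule pred_good[OF ula])

lemma tau_eq: "measure lab {x \<in> space lab. \<not> good A r x v} = tau r"
proof -
  have "measure lab {x \<in> space lab. \<not> good A r (\<lambda>w. x (v + w)) 0} = tau r"
    unfolding tau_def by (rule reindex_law[where V = UNIV]) (auto simp: depends_on_def fun_eq_iff[symmetric] inj_on_def)
  then show ?thesis by (simp add: good_shift)
qed

lemma good_union_bound:
  assumes "finite P" and Q: "Measurable.pred lab Q"
    and imp: "AE x in lab. (\<forall>v\<in>P. good A r x v) \<longrightarrow> Q x"
  shows "measure lab {x \<in> space lab. \<not> Q x} \<le> card P * tau r"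
proof -
  have "measure lab {x \<in> space lab. \<not> Q x} \<le> measure lab (\<Union>v\<in>P. {x \<in> space lab. \<not> good A r x v})"
    by (rule L.finite_measure_mono_AE) (use imp \<open>finite P\<close> in auto)
  also have "\<dots> \<le> (\<Sum>v\<in>P. measure lab {x \<in> space lab. \<not> good A r x v})"
    using \<open>finite P\<close> by (intro L.finite_measure_subadditive_finite) auto
  finally show ?thesis by (simp add: tau_eq)
qed

definition rect :: "nat \<Rightarrow> (int ^ 'd \<Rightarrow> real) \<Rightarrow> int \<Rightarrow> nat \<Rightarrow> nat \<Rightarrow> bool" where
  "rect r y a n N \<longleftrightarrow> hs r y a 0 n + vs r y (a + int n) 0 N = vs r y a 0 N + hs r y a (int N) n"

lemma rect_measurable: "Measurable.pred lab (\<lambda>x. rect r x a n N)"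
  unfolding rect_def by measurable

text \<open>Only the boundary has to be decided within radius \<open>r\<close>. In the interior the
  untruncated output is used, which is almost surely defined and proper whatever the coding radii
  are, so the error grows with the perimeter and not with the area.\<close>

lemma rect_prob:
  "measure lab {x \<in> space lab. \<not> rect r x a n N} \<le> real (2 * (n + 1) + 2 * (N + 1)) * tau r"
proof -
  let ?P = "(\<lambda>i. pt (a + int i) 0) ` {..n} \<union> (\<lambda>i. pt (a + int i) (int N)) ` {..n}
     \<union> ((\<lambda>j. pt a (int j)) ` {..N} \<union> (\<lambda>j. pt (a + int n) (int j)) ` {..N})"
  have ci: "card (f ` {..k}) \<le> k + 1" for f :: "nat \<Rightarrow> int ^ 'd" and k
    using card_image_le[of "{..k}" f] by simp
  have "card ?P \<le> ((n + 1) + (n + 1)) + ((N + 1) + (N + 1))"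
    by (intro order_trans[OF card_Un_le] add_mono ci)
  then have card: "card ?P \<le> 2 * (n + 1) + 2 * (N + 1)" by simp
  have "measure lab {x \<in> space lab. \<not> rect r x a n N} \<le> card ?P * tau r"
  proof (rule good_union_bound[OF _ rect_measurable])
    show "AE x in lab. (\<forall>v\<in>?P. good A r x v) \<longrightarrow> rect r x a n N"
      using AE_proper
    proof (rule AE_mp, intro AE_I2 impI)
      fix x assume x: "x \<in> space lab"
        and pr: "(\<forall>v. halts A x v) \<and> (\<forall>u v. (u, v) \<in> grid_adj \<longrightarrow> alg_output A x u \<noteq> alg_output A x v)"
        and gd: "\<forall>v\<in>?P. good A r x v"
      define f where "f = (\<lambda>i j. alg_output A x (pt (a + int i) (int j)))"
      have "f i j < 3" for i j
      proof -
        obtain s where "view x (pt (a + int i) (int j)) s \<in> nbhds A" using pr unfolding halts_def by blast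
        then have "good A s x (pt (a + int i) (int j))" by (auto simp: good_def)
        then show ?thesis using col_range[OF ula x, of s "pt (a + int i) (int j)"] by (simp add: f_def col_def)
      qed
      moreover have "f i j \<noteq> f (Suc i) j" "f i j \<noteq> f i (Suc j)" for i j
        using pr pt_adj[of "a + int i" "int j"] unfolding f_def by (auto simp: add.assoc add.commute[of 1])
      ultimately have *: "(\<Sum>i<n. inc (f i 0) (f (Suc i) 0)) + (\<Sum>j<N. inc (f n j) (f n (Suc j)))
         = (\<Sum>j<N. inc (f 0 j) (f 0 (Suc j))) + (\<Sum>i<n. inc (f i N) (f (Suc i) N))"
        by (rule inc_rectangle)
      have c: "C r x (pt (a + int i) 0) = f i 0" "C r x (pt (a + int i) (int N)) = f i N" if "i \<le> n" for i
        using gd that by (auto simp: col_def f_def)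
      have d: "C r x (pt a (int j)) = f 0 j" "C r x (pt (a + int n) (int j)) = f n j" if "j \<le> N" for j
        using gd that by (auto simp: col_def f_def)
      have "hs r x a 0 n = (\<Sum>i<n. inc (f i 0) (f (Suc i) 0))" 
        unfolding hs_def by (rule sum.cong[OF refl]) (use c(1) c(1)[of "Suc _"] in \<open>auto simp: add_ac\<close>)
      moreover have "hs r x a (int N) n = (\<Sum>i<n. inc (f i N) (f (Suc i) N))" 
        unfolding hs_def by (rule sum.cong[OF refl]) (use c(2) c(2)[of "Suc _"] in \<open>auto simp: add_ac\<close>)
      moreover have "vs r x a 0 N = (\<Sum>j<N. inc (f 0 j) (f 0 (Suc j)))" 
        unfolding vs_def by (rule sum.cong[OF refl]) (use d(1) d(1)[of "Suc _"] in \<open>auto simp: add_ac\<close>)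
      moreover have "vs r x (a + int n) 0 N = (\<Sum>j<N. inc (f n j) (f n (Suc j)))" 
        unfolding vs_def by (rule sum.cong[OF refl]) (use d(2) d(2)[of "Suc _"] in \<open>auto simp: add_ac\<close>)
      ultimately show "rect r x a n N" using * by (simp add: rect_def)
    qed
  qed simp
  also have "\<dots> \<le> real (2 * (n + 1) + 2 * (N + 1)) * tau r"
    using card tau_nonneg by (intro mult_right_mono) (simp_all only: of_nat_le_iff)
  finally show ?thesis .
qed

end

section \<open>Height changes around a cylinder\<close>

context three_colouring
begin

definition set1 :: "int ^ 'd \<Rightarrow> int \<Rightarrow> int ^ 'd" where
  "set1 w m = (\<chi> i. if i = i1 then m else w $ i)"

lemma set1_1 [simp]: "set1 w m $ i1 = m" and set1_2 [simp]: "set1 w m $ i2 = w $ i2"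
  using ne by (auto simp: set1_def)

lemma set1_idem [simp]: "set1 w (w $ i1) = w"
  by (simp add: set1_def vec_eq_iff)

lemma set1_set1 [simp]: "set1 (set1 w m) k = set1 w k"
  by (simp add: set1_def vec_eq_iff)

lemma set1_pt_add: "set1 (pt a 0 + w) m = set1 w m"
  by (simp add: set1_def vec_eq_iff pt_def)

lemma set1_eqD:
  assumes "set1 w m = set1 w' m'" "w $ i1 = w' $ i1"
  shows "w = w'"
  unfolding vec_eq_iff
proof
  fix i
  show "w $ i = w' $ i"
    using arg_cong[OF assms(1), of "\<lambda>u. u $ i"] assms(2) by (cases "i = i1") (auto simp: set1_def)
qed

definition cyl :: "int \<Rightarrow> int ^ 'd \<Rightarrow> int ^ 'd" where
  "cyl n w = set1 w (w $ i1 mod n)"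

lemma cyl_inj:
  assumes "W = {w. a \<le> w $ i1 \<and> w $ i1 < a + n}"
  shows "inj_on (cyl n) W"
proof (rule inj_onI)
  fix u v assume u: "u \<in> W" and v: "v \<in> W" and eq: "cyl n u = cyl n v"
  have "u $ i1 mod n = v $ i1 mod n" using arg_cong[OF eq, of "\<lambda>w. w $ i1"] by (simp add: cyl_def)
  then have "n dvd u $ i1 - v $ i1" by (simp add: mod_eq_dvd_iff)
  moreover have "\<bar>u $ i1 - v $ i1\<bar> < n" using u v assms by auto
  ultimately have "u $ i1 = v $ i1" using dvd_imp_le_int[of "u $ i1 - v $ i1" n] by fastforce
  then show "u = v" using eq set1_eqD unfolding cyl_def by blast
qed

lemma hs_periodic:
  assumes "\<And>w. y (pt n 0 + w) = y w"
  shows "hs r y (n + a) b k = hs r y a b k" "vs r y (n + a) b k = vs r y a b k"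
  using hs_shift[of r y n 0 a b k] vs_shift[of r y n 0 a b k] assms by simp_all

lemma cyl_shift: "cyl n (pt n 0 + w) = cyl n w"
  by (simp add: cyl_def set1_pt_add)

text \<open>The labels that the rectangle reads occupy \<open>k + 2 * r + 1\<close> columns. These
  embed injectively into the cylinder, so the rectangle has the same law there as on the
  grid.\<close>

lemma dep_rect_cyl:
  assumes n: "int k + 2 * int r + 1 \<le> n"
  shows "measure lab {x \<in> space lab. \<not> rect r (\<lambda>w. x (cyl n w)) a k N} \<le> real (2 * (k + 1) + 2 * (N + 1)) * tau r"
proof -
  have "measure lab {x \<in> space lab. \<not> rect r (\<lambda>w. x (cyl n w)) a k N} = measure lab {x \<in> space lab. \<not> rect r x a k N}"
  proof (rule reindex_law[where V = "{w. a - int r \<le> w $ i1 \<and> w $ i1 < (a - int r) + n}"])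
    show "Measurable.pred lab (\<lambda>x. \<not> rect r x a k N)" using rect_measurable by measurable
    show "inj_on (cyl n) {w. a - int r \<le> w $ i1 \<and> w $ i1 < (a - int r) + n}" by (rule cyl_inj[OF refl])
    show "depends_on (\<lambda>x. \<not> rect r x a k N) {w. a - int r \<le> w $ i1 \<and> w $ i1 < (a - int r) + n}"
    proof (rule depends_onI)
      fix x y :: "int ^ 'd \<Rightarrow> real"
      assume "\<And>w. w \<in> {w. a - int r \<le> w $ i1 \<and> w $ i1 < (a - int r) + n} \<Longrightarrow> x w = y w"
      then have eq: "x w = y w" if "a - int r \<le> w $ i1" "w $ i1 \<le> a + int k + int r" for w using that n by auto
      have "hs r x a c k = hs r y a c k" for c by (rule hs_cong) (use eq in auto)
      moreover have "vs r x a 0 N = vs r y a 0 N" by (rule vs_cong) (use eq in auto)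
      moreover have "vs r x (a + int k) 0 N = vs r y (a + int k) 0 N" by (rule vs_cong) (use eq in auto)
      ultimately show "(\<not> rect r x a k N) = (\<not> rect r y a k N)" by (simp add: rect_def)
    qed
  qed
  then show ?thesis using rect_prob[of r a k N] by simp
qed

text \<open>The cylinder is the grid with labels repeated with period \<open>n\<close> in direction
  \<open>i1\<close>. Such labellings are exceptional on the grid, so nothing is known about the
  output on the whole cylinder, only about windows shorter than \<open>n\<close>.\<close>

definition loop :: "nat \<Rightarrow> nat \<Rightarrow> (int ^ 'd \<Rightarrow> real) \<Rightarrow> int" where
  "loop r n x = hs r (\<lambda>w. x (cyl (int n) w)) 0 0 n"

lemma reindex_measurable [measurable]: "(\<lambda>x k. x (\<rho> k)) \<in> lab \<rightarrow>\<^sub>M lab"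
  unfolding lab_def by (rule measurable_PiM_single') (auto simp: space_PiM space_unif01)

lemma loop_measurable [measurable]: "loop r n \<in> lab \<rightarrow>\<^sub>M count_space UNIV"
  unfolding loop_def by (rule measurable_compose[OF reindex_measurable hs_measurable])

lemma loop_bounds: "\<bar>loop r n x\<bar> \<le> int n" "even (loop r n x - int n)"
  unfolding loop_def hs_def by (rule sum_pm_one inc_cases)+

text \<open>Cutting the cylinder of circumference \<open>n\<close> into two rectangles shows that two far apart
  loops around it have the same height change; since these are independent, the height change is
  essentially deterministic.\<close>

lemma loop_const:
  assumes n: "n \<ge> 4 * r + 4"
  shows "\<exists>t. \<bar>t\<bar> \<le> int n \<and> measure lab {x \<in> space lab. loop r n x = t} \<ge> 1 - 8 * real n * tau r"
proof -
  \<comment> \<open>At vertical distance \<open>2 * r + 1\<close> the two loops read disjoint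
    strips. Cutting at \<open>n div 2\<close> leaves both rectangles, with their margins of
    \<open>r\<close>, shorter than the circumference.\<close>
  define N where "N = 2 * r + 1"
  define m where "m = n div 2"
  define k where "k = n - m"
  have mk: "m + k = n" "m + 2 * r + 1 \<le> n" "k + 2 * r + 1 \<le> n" "m \<le> n" using n by (auto simp: m_def k_def)
  define g where "g = (\<lambda>x. hs r (\<lambda>w. x (cyl (int n) w)) 0 (int N) n)"
  let ?y = "\<lambda>x w. x (cyl (int n) w)"
  have g_eq: "g x = loop r n (\<lambda>w. x (pt 0 (int N) + w))" for x
  proof -
    have "pt 0 (int N) + cyl (int n) w = cyl (int n) (pt 0 (int N) + w)" for w
      by (simp add: cyl_def set1_def vec_eq_iff pt_def)
    then show ?thesis unfolding g_def loop_def using hs_shift[of r "?y x" 0 "int N" 0 0 n] by simp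
  qed
  have gm [measurable]: "g \<in> lab \<rightarrow>\<^sub>M count_space UNIV"
    unfolding g_def by (rule measurable_compose[OF reindex_measurable hs_measurable])
  have per: "?y x (pt (int n) 0 + w) = ?y x w" for x w by (simp add: cyl_shift)
  have loop_eq: "loop r n x = g x" if "rect r (?y x) 0 m N" "rect r (?y x) (int m) k N" for x
  proof -
    \<comment> \<open>The right side of the second rectangle is the left side of the first, so
      adding the two rectangle identities cancels all vertical sides.\<close>
    have "vs r (?y x) (int m + int k) 0 N = vs r (?y x) 0 0 N"
      using hs_periodic(2)[of "?y x" "int n" r 0 0 N, OF per] mk(1) by (simp add: of_nat_add[symmetric])
    moreover have "loop r n x = hs r (?y x) 0 0 m + hs r (?y x) (int m) 0 k"
      unfolding loop_def mk(1)[symmetric] by (simp add: hs_split)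
    moreover have "g x = hs r (?y x) 0 (int N) m + hs r (?y x) (int m) (int N) k"
      unfolding g_def mk(1)[symmetric] by (simp add: hs_split)
    ultimately show ?thesis using that by (simp add: rect_def)
  qed
  have [measurable]: "Measurable.pred lab (\<lambda>x. rect r (?y x) a b N)" for a b
    by (rule measurable_compose[OF reindex_measurable rect_measurable])
  have "measure lab {x \<in> space lab. loop r n x \<noteq> g x}
     \<le> measure lab ({x \<in> space lab. \<not> rect r (?y x) 0 m N} \<union> {x \<in> space lab. \<not> rect r (?y x) (int m) k N})"
    by (intro L.finite_measure_mono) (use loop_eq in auto)
  also have "\<dots> \<le> measure lab {x \<in> space lab. \<not> rect r (?y x) 0 m N} + measure lab {x \<in> space lab. \<not> rect r (?y x) (int m) k N}"
    by (rule measure_Un_le) auto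
  also have "\<dots> \<le> real (2 * (m + 1) + 2 * (N + 1)) * tau r + real (2 * (k + 1) + 2 * (N + 1)) * tau r"
    by (intro add_mono dep_rect_cyl) (use mk in linarith)+
  also have "\<dots> = real (2 * n + 4 + 4 * (N + 1)) * tau r" 
  proof -
    have "(2 * (m + 1) + 2 * (N + 1)) + (2 * (k + 1) + 2 * (N + 1)) = 2 * n + 4 + 4 * (N + 1)" using mk(1) by simp
    then show ?thesis by (metis distrib_right of_nat_add)
  qed
  also have "\<dots> \<le> 8 * real n * tau r"
  proof (rule mult_right_mono[OF _ tau_nonneg])
    have "2 * n + 4 + 4 * (N + 1) \<le> 8 * n" using n by (simp add: N_def)
    then have "real (2 * n + 4 + 4 * (N + 1)) \<le> real (8 * n)" by (simp only: of_nat_le_iff)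
    then show "real (2 * n + 4 + 4 * (N + 1)) \<le> 8 * real n" by simp
  qed
  finally have bad: "measure lab {x \<in> space lab. loop r n x \<noteq> g x} \<le> 8 * real n * tau r" .
  have pm: "Measurable.pred lab (\<lambda>x. loop r n x = g x)"
    by (rule binop_count_space[OF loop_measurable gm, of "(=)"])
  have "measure lab {x \<in> space lab. loop r n x = g x} = 1 - measure lab {x \<in> space lab. loop r n x \<noteq> g x}"
    using L.prob_neg[OF pm[unfolded pred_def]] by simp
  with bad have agree: "measure lab {x \<in> space lab. loop r n x = g x} \<ge> 1 - 8 * real n * tau r" by simp
  have dep: "depends_on (\<lambda>x. hs r (\<lambda>w. x (cyl (int n) w)) 0 b n) {w. \<bar>w $ i2 - b\<bar> \<le> int r}" for b
    by (intro depends_onI hs_cong) (auto simp: cyl_def)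
  have "\<exists>t\<in>{- int n..int n}. measure lab {x \<in> space lab. loop r n x = t} \<ge> 1 - 8 * real n * tau r"
  proof (rule iid_agree_const[OF loop_measurable _ gm])
    show "depends_on (loop r n) {w. \<bar>w $ i2 - 0\<bar> \<le> int r}" unfolding loop_def by (rule dep)
    show "depends_on g {w. \<bar>w $ i2 - int N\<bar> \<le> int r}" unfolding g_def by (rule dep)
    show "{w. \<bar>w $ i2 - 0\<bar> \<le> int r} \<inter> {w :: int ^ 'd. \<bar>w $ i2 - int N\<bar> \<le> int r} = {}"
      by (auto simp: N_def)
    show "measure lab {x \<in> space lab. g x = t} = measure lab {x \<in> space lab. loop r n x = t}" for t
      unfolding g_eq by (rule reindex_law[where V = UNIV]) (auto simp: depends_on_def fun_eq_iff[symmetric] inj_on_def)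
    show "loop r n x \<in> {- int n..int n}" for x using loop_bounds(1)[of r n x] by auto
  qed (use agree in auto)
  then show ?thesis by (auto simp: abs_le_iff)
qed

text \<open>A loop sees one period of labels only, so any periodic relabelling that is injective on
  a period gives the same law. The glued planes are treated this way.\<close>

lemma loop_law:
  fixes \<rho> :: "int ^ 'd \<Rightarrow> 'k"
  assumes per: "\<And>w. \<rho> (cyl (int n) w) = \<rho> w" and inj: "inj_on \<rho> {w. 0 \<le> w $ i1 \<and> w $ i1 < int n}" and n: "n > 0"
  shows "measure lab {\<omega> \<in> space lab. hs r (\<lambda>w. \<omega> (\<rho> w)) 0 0 n = t} = measure lab {x \<in> space lab. loop r n x = t}"
proof -
  have "measure lab {\<omega> \<in> space lab. loop r n (\<lambda>w. \<omega> (\<rho> w)) = t} = measure lab {x \<in> space lab. loop r n x = t}"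
  proof (rule reindex_law[OF _ _ inj])
    show "depends_on (\<lambda>x. loop r n x = t) {w. 0 \<le> w $ i1 \<and> w $ i1 < int n}"
    proof (rule depends_onI)
      fix x y :: "int ^ 'd \<Rightarrow> real"
      assume eq: "\<And>w. w \<in> {w. 0 \<le> w $ i1 \<and> w $ i1 < int n} \<Longrightarrow> x w = y w"
      have "(\<lambda>w. x (cyl (int n) w)) = (\<lambda>w. y (cyl (int n) w))" using n by (intro ext eq) (simp add: cyl_def)
      then show "(loop r n x = t) = (loop r n y = t)" by (simp add: loop_def)
    qed
  qed measurable
  then show ?thesis by (simp add: loop_def per)
qed

end

section \<open>Exchanging halves of loops\<close>

text \<open>A union bound provides a single sample point at which several likely statements hold
  together; relations between deterministic constants are then read off at that point.\<close>

lemma (in prob_space) exists_all_good: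
  assumes "finite I" and ev: "\<And>i. i \<in> I \<Longrightarrow> {x \<in> space M. \<not> Q i x} \<in> events"
    and lt: "(\<Sum>i\<in>I. prob {x \<in> space M. \<not> Q i x}) < 1" and ae: "AE x in M. R x"
  shows "\<exists>x\<in>space M. R x \<and> (\<forall>i\<in>I. Q i x)"
proof (rule ccontr)
  assume "\<not> ?thesis"
  then have bad: "\<And>x. x \<in> space M \<Longrightarrow> R x \<Longrightarrow> \<exists>i\<in>I. \<not> Q i x" by blast
  have "prob (space M) \<le> prob (\<Union>i\<in>I. {x \<in> space M. \<not> Q i x})"
  proof (rule finite_measure_mono_AE)
    show "AE x in M. x \<in> space M \<longrightarrow> x \<in> (\<Union>i\<in>I. {x \<in> space M. \<not> Q i x})"
      using ae by eventually_elim (use bad in auto)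
    show "(\<Union>i\<in>I. {x \<in> space M. \<not> Q i x}) \<in> events" using assms(1) ev by auto
  qed
  also have "\<dots> \<le> (\<Sum>i\<in>I. prob {x \<in> space M. \<not> Q i x})"
    using assms(1) ev by (intro finite_measure_subadditive_finite) auto
  finally show False using lt by (simp add: prob_space)
qed

context three_colouring
begin

text \<open>A loop of length \<open>p + q\<close> glued from a segment of length \<open>p\<close> of one plane and one of length \<open>q\<close>
  of another. Around the junctions it sees the starts of both planes whatever \<open>p\<close> and \<open>q\<close> are, which
  makes the height change the sum of a function of \<open>p\<close> and a function of \<open>q\<close>.\<close>

definition sheet :: "int \<Rightarrow> int \<Rightarrow> int ^ 'd \<Rightarrow> bool \<times> (int ^ 'd)" where
  "sheet p q w = (let m = w $ i1 mod (p + q) in if m < p then (False, set1 w m) else (True, set1 w (m - p)))"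

text \<open>The segment runs from \<open>r\<close> to \<open>r + p\<close>. Its views therefore
  start at 0 in one plane and end at \<open>2 * r\<close> in the other, and the length of the
  segment in the other plane does not matter as long as it exceeds \<open>2 * r\<close>.\<close>

definition half :: "nat \<Rightarrow> nat \<Rightarrow> bool \<Rightarrow> (bool \<times> (int ^ 'd) \<Rightarrow> real) \<Rightarrow> int" where
  "half r p s \<omega> = hs r (\<lambda>w. if w $ i1 < int p then \<omega> (s, w) else \<omega> (\<not> s, set1 w (w $ i1 - int p))) (int r) 0 p"

text \<open>By periodicity the loop may start at \<open>r\<close> instead of 0, which puts each
  junction inside one half.\<close>

lemma loop_sheet:
  assumes p: "2 * r < p" and q: "2 * r < q"
  shows "hs r (\<lambda>w. \<omega> (sheet (int p) (int q) w)) 0 0 (p + q) = half r p False \<omega> + half r q True \<omega>"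
proof -
  let ?y = "\<lambda>w. \<omega> (sheet (int p) (int q) w)"
  have per: "?y (pt (int (p + q)) 0 + w) = ?y w" for w
    by (simp add: sheet_def Let_def set1_pt_add)
  have "hs r ?y 0 0 (p + q) + hs r ?y (int (p + q)) 0 r = hs r ?y 0 0 r + hs r ?y (int r) 0 (p + q)"
    using hs_split[of r ?y 0 0 "p + q" r] hs_split[of r ?y 0 0 r "p + q"] by (simp add: add.commute)
  moreover have "hs r ?y (int (p + q)) 0 r = hs r ?y 0 0 r"
    using hs_periodic(1)[of ?y "int (p + q)" r 0 0 r, OF per] by simp
  ultimately have "hs r ?y 0 0 (p + q) = hs r ?y (int r) 0 p + hs r ?y (int r + int p) 0 q"
    by (simp add: hs_split)
  moreover have "hs r ?y (int r) 0 p = half r p False \<omega>"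
    unfolding half_def
  proof (rule hs_cong)
    fix w :: "int ^ 'd" assume "int r - int r \<le> w $ i1" "w $ i1 \<le> int r + int p + int r"
    then have "w $ i1 mod (int p + int q) = w $ i1" using q by (intro mod_pos_pos_trivial) auto
    then show "?y w = (if w $ i1 < int p then \<omega> (False, w) else \<omega> (\<not> False, set1 w (w $ i1 - int p)))"
      by (simp add: sheet_def)
  qed
  \<comment> \<open>Translation by \<open>p\<close> turns the second junction into the first one,
    with the planes and the lengths exchanged.\<close>
  moreover have "hs r ?y (int r + int p) 0 q = half r q True \<omega>"
  proof -
    have "hs r ?y (int r + int p) 0 q = hs r (\<lambda>w. ?y (pt (int p) 0 + w)) (int r) 0 q"
      using hs_shift[of r ?y "int p" 0 "int r" 0 q] by (simp add: add.commute)
    also have "\<dots> = half r q True \<omega>"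
      unfolding half_def
    proof (rule hs_cong)
      fix w :: "int ^ 'd" assume w: "int r - int r \<le> w $ i1" "w $ i1 \<le> int r + int q + int r"
      show "?y (pt (int p) 0 + w) = (if w $ i1 < int q then \<omega> (True, w) else \<omega> (\<not> True, set1 w (w $ i1 - int q)))"
      proof (cases "w $ i1 < int q")
        case True
        then have "(int p + w $ i1) mod (int p + int q) = int p + w $ i1"
          using w by (intro mod_pos_pos_trivial) auto
        then show ?thesis using True w by (simp add: sheet_def set1_pt_add)
      next
        case False
        have "(int p + w $ i1) mod (int p + int q) = ((w $ i1 - int q) + (int p + int q)) mod (int p + int q)"
          by (simp add: algebra_simps)
        also have "\<dots> = (w $ i1 - int q) mod (int p + int q)" by (rule mod_add_self2)
        also have "\<dots> = w $ i1 - int q" using w p False by (intro mod_pos_pos_trivial) auto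
        finally have "(int p + w $ i1) mod (int p + int q) = w $ i1 - int q" .
        then show ?thesis using False w p by (simp add: sheet_def set1_pt_add)
      qed
    qed
    finally show ?thesis .
  qed
  ultimately show ?thesis by simp
qed

lemma half_law:
  assumes p: "2 * r < p" and q: "2 * r < q"
  shows "measure lab {\<omega> \<in> space lab. half r p False \<omega> + half r q True \<omega> = t}
       = measure lab {x \<in> space lab. loop r (p + q) x = t}"
proof -
  have "measure lab {\<omega> \<in> space lab. hs r (\<lambda>w. \<omega> (sheet (int p) (int q) w)) 0 0 (p + q) = t}
      = measure lab {x \<in> space lab. loop r (p + q) x = t}"
  proof (rule loop_law)
    show "sheet (int p) (int q) (cyl (int (p + q)) w) = sheet (int p) (int q) w" for w
      by (simp add: sheet_def cyl_def Let_def)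
    show "inj_on (sheet (int p) (int q)) {w. 0 \<le> w $ i1 \<and> w $ i1 < int (p + q)}"
    proof (rule inj_onI)
      fix u v :: "int ^ 'd" assume "u \<in> {w. 0 \<le> w $ i1 \<and> w $ i1 < int (p + q)}" "v \<in> {w. 0 \<le> w $ i1 \<and> w $ i1 < int (p + q)}"
      then have m: "u $ i1 mod (int p + int q) = u $ i1" "v $ i1 mod (int p + int q) = v $ i1" by auto
      assume eq: "sheet (int p) (int q) u = sheet (int p) (int q) v"
      then have s: "set1 u (if u $ i1 < int p then u $ i1 else u $ i1 - int p)
             = set1 v (if v $ i1 < int p then v $ i1 else v $ i1 - int p)"
        "(u $ i1 < int p) = (v $ i1 < int p)"
        by (auto simp: sheet_def m Let_def split: if_splits)
      from arg_cong[OF s(1), of "\<lambda>w. w $ i1"] s(2) have "u $ i1 = v $ i1" by (auto split: if_splits)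
      then show "u = v" using set1_eqD[OF s(1)] by simp
    qed
  qed (use p in auto)
  then show ?thesis by (simp only: loop_sheet[OF p q])
qed

lemma half_measurable [measurable]: "half r p s \<in> lab \<rightarrow>\<^sub>M count_space UNIV"
proof -
  have "(\<lambda>\<omega> w. if w $ i1 < int p then \<omega> (s, w) else \<omega> (\<not> s, set1 w (w $ i1 - int p))) \<in> lab \<rightarrow>\<^sub>M lab"
    unfolding lab_def
  proof (rule measurable_PiM_single')
    fix w
    show "(\<lambda>\<omega>. if w $ i1 < int p then \<omega> (s, w) else \<omega> (\<not> s, set1 w (w $ i1 - int p)))
        \<in> PiM UNIV (\<lambda>_. unif01) \<rightarrow>\<^sub>M unif01" by (cases "w $ i1 < int p") simp_all
  qed (auto simp: space_PiM space_unif01 PiE_iff)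
  from measurable_compose[OF this hs_measurable] show ?thesis unfolding half_def[abs_def] .
qed

lemma slope:
  assumes small: "32 * real M * tau r < 1" and M: "3 * (4 * r + 4) \<le> M"
  obtains \<sigma> t where "\<sigma> = 1 \<or> \<sigma> = -1" "\<sigma> * t \<ge> int M - 2 * (4 * int r + 4)"
    "measure lab {x \<in> space lab. loop r M x = t} \<ge> 1 - 8 * real M * tau r"
proof -
  define n0 where "n0 = 4 * r + 4"
  have "\<exists>t. \<forall>n. n \<ge> n0 \<longrightarrow> \<bar>t n\<bar> \<le> int n \<and> measure lab {x \<in> space lab. loop r n x = t n} \<ge> 1 - 8 * real n * tau r"
    by (intro choice allI) (use loop_const n0_def in blast)
  then obtain t where tb: "\<And>n. n \<ge> n0 \<Longrightarrow> \<bar>t n\<bar> \<le> int n"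
    and tp: "\<And>n. n \<ge> n0 \<Longrightarrow> measure lab {x \<in> space lab. loop r n x = t n} \<ge> 1 - 8 * real n * tau r" by blast
  have bound: "8 * real n * tau r \<le> 8 * real M * tau r" if "n \<le> M" for n
    using that tau_nonneg[of r] by (simp add: mult_right_mono)
  \<comment> \<open>The four pairings are read off the same two planes. Each misses its typical
    height change with probability at most \<open>8 * M * tau r\<close>, so
    \<open>32 * M * tau r < 1\<close> leaves a labelling that serves all four; there both sides are
    the sum of the same four halves.\<close>
  have ex: "t (p + q) + t (p' + q') = t (p + q') + t (p' + q)"
    if pq: "2 * r + 2 \<le> p" "2 * r + 2 \<le> q" "2 * r + 2 \<le> p'" "2 * r + 2 \<le> q'"
      "p + q \<le> M" "p + q' \<le> M" "p' + q \<le> M" "p' + q' \<le> M" for p q p' q'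
  proof -
    define I where "I = {(p, q), (p', q'), (p, q'), (p', q)}"
    have finI: "finite I" by (simp add: I_def)
    have cI: "card I \<le> 4" unfolding I_def by (simp add: card_insert_if)
    define Q where "Q = (\<lambda>(p, q) \<omega>. half r p False \<omega> + half r q True \<omega> = t (p + q))"
    have Qm: "Measurable.pred lab (Q i)" for i
    proof -
      have "(\<lambda>\<omega>. half r (fst i) False \<omega> + half r (snd i) True \<omega>) \<in> lab \<rightarrow>\<^sub>M count_space UNIV"
        by (rule binop_count_space[OF half_measurable half_measurable])
      from measurable_compose[OF this, of "\<lambda>z. z = t (fst i + snd i)"]
      have "Measurable.pred lab (\<lambda>\<omega>. half r (fst i) False \<omega> + half r (snd i) True \<omega> = t (fst i + snd i))"
        by simp
      moreover have "Q i = (\<lambda>\<omega>. half r (fst i) False \<omega> + half r (snd i) True \<omega> = t (fst i + snd i))"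
        by (cases i) (simp add: Q_def)
      ultimately show ?thesis by simp
    qed
    have each: "measure lab {\<omega> \<in> space lab. \<not> Q i \<omega>} \<le> 8 * real M * tau r" if "i \<in> I" for i
    proof -
      obtain a b where i: "i = (a, b)" by (cases i)
      have ab: "2 * r < a" "2 * r < b" "n0 \<le> a + b" "a + b \<le> M"
        using that pq by (auto simp: I_def i n0_def)
      have "measure lab {\<omega> \<in> space lab. \<not> Q i \<omega>} = 1 - measure lab {\<omega> \<in> space lab. Q i \<omega>}"
        using L.prob_neg[OF Qm[unfolded pred_def]] by simp
      also have "measure lab {\<omega> \<in> space lab. Q i \<omega>} = measure lab {x \<in> space lab. loop r (a + b) x = t (a + b)}"
        unfolding Q_def i by (simp add: half_law[OF ab(1,2)])
      finally show ?thesis using tp[OF ab(3)] bound[OF ab(4)] by linarith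
    qed
    have "(\<Sum>i\<in>I. measure lab {\<omega> \<in> space lab. \<not> Q i \<omega>}) \<le> real (card I) * (8 * real M * tau r)"
      using sum_bounded_above[of I _ "8 * real M * tau r", OF each] by simp
    also have "\<dots> \<le> 4 * (8 * real M * tau r)"
      using cI tau_nonneg[of r] by (intro mult_right_mono) auto
    also have "\<dots> < 1" using small by simp
    finally have "\<exists>\<omega>\<in>space lab. True \<and> (\<forall>i\<in>I. Q i \<omega>)"
      using Qm by (intro L.exists_all_good[OF finI]) (auto simp: pred_def)
    then obtain \<omega> where "\<forall>i\<in>I. Q i \<omega>" by blast
    then have "half r p False \<omega> + half r q True \<omega> = t (p + q)" "half r p' False \<omega> + half r q' True \<omega> = t (p' + q')"
      "half r p False \<omega> + half r q' True \<omega> = t (p + q')" "half r p' False \<omega> + half r q True \<omega> = t (p' + q)"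
      by (auto simp: I_def Q_def)
    then show ?thesis by linarith
  qed
  define \<sigma> where "\<sigma> = t (n0 + 1) - t n0"
  have step: "t (n + 1) = t n + \<sigma>" if n: "n0 \<le> n" "n + 1 \<le> M" for n
  proof -
    \<comment> \<open>As \<open>n0\<close> is twice \<open>2 * r + 2\<close>, lengthening one half
      by 1 raises a loop of length \<open>n\<close> and one of length \<open>n0\<close> by the same
      amount.\<close>
    define k where "k = n - (2 * r + 2)"
    have e: "(2 * r + 2) + k = n" "(2 * r + 3) + (2 * r + 2) = n0 + 1" "(2 * r + 2) + (2 * r + 2) = n0"
      "(2 * r + 3) + k = n + 1" "2 * r + 2 \<le> k" using n by (auto simp: n0_def k_def)
    have "t ((2 * r + 2) + k) + t ((2 * r + 3) + (2 * r + 2)) = t ((2 * r + 2) + (2 * r + 2)) + t ((2 * r + 3) + k)"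
      by (rule ex) (use e n in linarith)+
    then show ?thesis unfolding e \<sigma>_def by linarith
  qed
  have affine: "n0 + k \<le> M \<Longrightarrow> t (n0 + k) = t n0 + int k * \<sigma>" for k
  proof (induction k)
    case (Suc k)
    then show ?case using step[of "n0 + k"] by (simp add: algebra_simps)
  qed simp
  \<comment> \<open>A value of positive probability is attained by some labelling, so it has the
    parity of the length.\<close>
  have parity: "even (t n - int n)" if "n0 \<le> n" "n \<le> M" for n
  proof -
    have "1 - 8 * real n * tau r > 0" using bound[OF that(2)] small tau_nonneg[of r] by linarith
    then have "measure lab {x \<in> space lab. loop r n x = t n} > 0" using tp[OF that(1)] by linarith
    then have "{x \<in> space lab. loop r n x = t n} \<noteq> {}" by force
    then obtain x where "loop r n x = t n" by blast
    then show ?thesis using loop_bounds(2)[of r n x] by simp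
  qed
  have "n0 + 1 \<le> M" using M by (simp add: n0_def)
  then have "even (t n0 - int n0)" by (intro parity) auto
  moreover have "even (t (n0 + 1) - int (n0 + 1))" using \<open>n0 + 1 \<le> M\<close> by (intro parity) auto
  ultimately have "odd \<sigma>" unfolding \<sigma>_def by simp
  have tM: "t M = t n0 + int (M - n0) * \<sigma>" using affine[of "M - n0"] M by (simp add: n0_def)
  have bM: "\<bar>t M\<bar> \<le> int M" "\<bar>t n0\<bar> \<le> int n0" using tb[of M] tb[of n0] M by (auto simp: n0_def)
  have Mn: "3 * n0 \<le> M" "n0 > 0" using M by (auto simp: n0_def)
  \<comment> \<open>A slope of absolute value at least 3 gives
    \<open>3 * (M - n0) \<le> M + n0\<close>, which fails for \<open>M \<ge> 3 * n0\<close>.\<close>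
  have "\<bar>\<sigma>\<bar> < 3"
  proof (rule ccontr)
    assume "\<not> \<bar>\<sigma>\<bar> < 3"
    then have "int (M - n0) * 3 \<le> int (M - n0) * \<bar>\<sigma>\<bar>" by (intro mult_left_mono) auto
    also have "\<dots> = \<bar>t M - t n0\<bar>" using tM by (simp add: abs_mult)
    also have "\<dots> \<le> int M + int n0" using bM by linarith
    finally show False using Mn by simp
  qed
  with \<open>odd \<sigma>\<close> have \<sigma>: "\<sigma> = 1 \<or> \<sigma> = -1" by presburger
  have "\<sigma> * t M = \<sigma> * t n0 + int (M - n0)" using \<sigma> tM by auto
  moreover have "\<sigma> * t n0 \<ge> - int n0" using \<sigma> bM(2) by auto
  ultimately have "\<sigma> * t M \<ge> int M - 2 * (4 * int r + 4)" using Mn by (simp add: n0_def)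
  then show thesis using that \<sigma> tp[of M] Mn by auto
qed

end

section \<open>The first moment is infinite\<close>

context three_colouring
begin

definition steps :: "nat \<Rightarrow> int \<Rightarrow> int \<Rightarrow> (int ^ 'd \<Rightarrow> real) \<Rightarrow> bool" where
  "steps r a \<sigma> x \<longleftrightarrow> inc (C r x (pt a 0)) (C r x (pt (a + 1) 0)) = \<sigma>"

lemma steps_measurable [measurable]: "Measurable.pred lab (steps r a \<sigma>)"
proof -
  have "(\<lambda>x. inc (C r x (pt a 0)) (C r x (pt (a + 1) 0))) \<in> lab \<rightarrow>\<^sub>M count_space UNIV"
    by (rule binop_count_space; rule col_measurable[OF ula])
  from measurable_compose[OF this, of "\<lambda>z. z = \<sigma>"] show ?thesis
    unfolding steps_def[abs_def] by simp
qed

lemma steps_shift: "steps r a \<sigma> (\<lambda>w. x (pt b 0 + w)) = steps r (b + a) \<sigma> x"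
  by (simp add: steps_def col_shift pt_add add.assoc)

lemma steps_depends: "depends_on (steps r a \<sigma>) {w. a - int r \<le> w $ i1 \<and> w $ i1 \<le> a + 1 + int r}"
proof (rule depends_onI)
  fix x y :: "int ^ 'd \<Rightarrow> real"
  assume eq: "\<And>w. w \<in> {w. a - int r \<le> w $ i1 \<and> w $ i1 \<le> a + 1 + int r} \<Longrightarrow> x w = y w"
  have "C r x (pt c 0) = C r y (pt c 0)" if "c = a \<or> c = a + 1" for c
  proof (rule col_cong, rule eq)
    fix w assume "near (int r) (pt c 0) w"
    from this[unfolded near_def, rule_format, of i1] that
    show "w \<in> {w. a - int r \<le> w $ i1 \<and> w $ i1 \<le> a + 1 + int r}" by auto
  qed
  then show "steps r a \<sigma> x = steps r a \<sigma> y" by (simp add: steps_def)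
qed

definition beta :: "nat \<Rightarrow> int \<Rightarrow> real" where
  "beta r \<sigma> = measure lab {x \<in> space lab. \<not> steps r 0 \<sigma> x}"

lemma steps_law:
  assumes "inj_on \<rho> {w. a - int r \<le> w $ i1 \<and> w $ i1 \<le> a + 1 + int r}"
  shows "measure lab {x \<in> space lab. \<not> steps r a \<sigma> (\<lambda>w. x (\<rho> w))} = beta r \<sigma>"
proof -
  have "measure lab {x \<in> space lab. \<not> steps r a \<sigma> (\<lambda>w. x (\<rho> w))} = measure lab {x \<in> space lab. \<not> steps r a \<sigma> x}"
    by (rule reindex_law[OF _ _ assms]) (use steps_depends in \<open>auto simp: depends_on_def\<close>)
  also have "\<dots> = measure lab {x \<in> space lab. \<not> steps r 0 \<sigma> (\<lambda>w. x (pt a 0 + w))}"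
    by (simp add: steps_shift)
  also have "\<dots> = beta r \<sigma>" unfolding beta_def
    by (rule reindex_law[where V = UNIV]) (auto simp: depends_on_def fun_eq_iff[symmetric] inj_on_def)
  finally show ?thesis .
qed

text \<open>The expected number of steps of the wrong sign around a loop of length \<open>M\<close>
  is \<open>M * beta r \<sigma>\<close>. If the height change is the typical one, which falls short
  of \<open>M\<close> by at most \<open>2 * (4 * r + 4)\<close>, there are at most
  \<open>4 * r + 4\<close> wrong steps; otherwise the trivial bound \<open>M\<close> is paid with
  probability at most \<open>8 * M * tau r\<close>.\<close>

lemma beta_bound:
  assumes small: "32 * real M * tau r < 1" and M: "3 * (4 * r + 4) \<le> M"
  shows "\<exists>\<sigma>\<in>{1, -1}. real M * beta r \<sigma> \<le> real (4 * r + 4) + real M * (8 * real M * tau r)"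
proof -
  obtain \<sigma> t where \<sigma>: "\<sigma> = 1 \<or> \<sigma> = -1" and t: "\<sigma> * t \<ge> int M - 2 * (4 * int r + 4)"
    and whp: "measure lab {x \<in> space lab. loop r M x = t} \<ge> 1 - 8 * real M * tau r"
    using slope[OF small M] by blast
  let ?E = "\<lambda>i. {x \<in> space lab. \<not> steps r (int i) \<sigma> (\<lambda>w. x (cyl (int M) w))}"
  let ?B = "{x \<in> space lab. loop r M x \<noteq> t}"
  have Em: "?E i \<in> sets lab" for i
  proof -
    have "Measurable.pred lab (\<lambda>x. \<not> steps r (int i) \<sigma> (\<lambda>w. x (cyl (int M) w)))"
      by (intro pred_intros_logic(2) measurable_compose[OF reindex_measurable steps_measurable])
    then show ?thesis by (simp add: pred_def)
  qed
  have Gm: "{x \<in> space lab. loop r M x = t} \<in> sets lab"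
    using measurable_compose[OF loop_measurable, of "\<lambda>z. z = t" "count_space UNIV" r M] by (simp add: pred_def)
  have B: "measure lab ?B \<le> 8 * real M * tau r" "?B \<in> sets lab"
  proof -
    have "?B = space lab - {x \<in> space lab. loop r M x = t}" by auto
    then show "?B \<in> sets lab" using Gm by simp
    show "measure lab ?B \<le> 8 * real M * tau r" using L.prob_neg[OF Gm] whp by simp
  qed
  have Ep: "measure lab (?E i) = beta r \<sigma>" for i
  proof (rule steps_law, rule inj_on_subset)
    show "inj_on (cyl (int M)) {w. int i - int r \<le> w $ i1 \<and> w $ i1 < (int i - int r) + int M}"
      by (rule cyl_inj[OF refl])
  qed (use M in auto)
  have pointwise: "(\<Sum>i<M. indicat_real (?E i) x) \<le> real (4 * r + 4) + real M * indicat_real ?B x"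
    if x: "x \<in> space lab" for x
  proof (cases "x \<in> ?B")
    case True
    have "(\<Sum>i<M. indicat_real (?E i) x) \<le> (\<Sum>i<M. 1)" by (intro sum_mono) (simp add: indicator_def)
    then show ?thesis using True by simp
  next
    case False
    let ?f = "\<lambda>i. inc (C r (\<lambda>w. x (cyl (int M) w)) (pt (0 + int i) 0)) (C r (\<lambda>w. x (cyl (int M) w)) (pt (0 + int i + 1) 0))"
    have "t = (\<Sum>i<M. ?f i)" using False x by (simp add: loop_def hs_def)
    moreover define S where "S = (\<Sum>i<M. if ?f i = \<sigma> then 0 else 1 :: int)"
    ultimately have "\<sigma> * t = int M - 2 * S"
      using sum_pm_one(3)[of ?f \<sigma> M] inc_cases \<sigma> by simp
    then have "int M - 2 * (4 * int r + 4) \<le> int M - 2 * S" using t by metis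
    then have le: "S \<le> 4 * int r + 4" by simp
    have "(\<Sum>i<M. indicat_real (?E i) x) = (\<Sum>i<M. real_of_int (if ?f i = \<sigma> then 0 else 1))"
      using x by (intro sum.cong) (simp_all add: steps_def indicator_def)
    also have "\<dots> = real_of_int S" by (simp add: S_def)
    also have "\<dots> \<le> real_of_int (4 * int r + 4)" using le by (simp only: of_int_le_iff)
    finally show ?thesis using False by simp
  qed
  have "real M * beta r \<sigma> = (\<Sum>i<M. measure lab (?E i))" by (simp add: Ep)
  also have "\<dots> = (\<integral>x. (\<Sum>i<M. indicat_real (?E i) x) \<partial>lab)"
    using Em by (subst Bochner_Integration.integral_sum) (auto simp: L.emeasure_eq_measure)
  also have "\<dots> \<le> (\<integral>x. real (4 * r + 4) + real M * indicat_real ?B x \<partial>lab)"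
    by (rule integral_mono) (use Em B pointwise in \<open>auto intro!: Bochner_Integration.integrable_sum
        Bochner_Integration.integrable_add integrable_mult_right simp: L.emeasure_eq_measure\<close>)
  also have "\<dots> = real (4 * r + 4) + real M * measure lab ?B"
    using B by (subst Bochner_Integration.integral_add) (auto simp: L.emeasure_eq_measure L.prob_space)
  also have "\<dots> \<le> real (4 * r + 4) + real M * (8 * real M * tau r)"
    using B by (intro add_left_mono mult_left_mono) auto
  finally show ?thesis using \<sigma> by blast
qed

text \<open>\<open>r\<close> times the probability of a radius above \<open>r\<close> is at most the
  tail of the series for the mean. It matters that this is o(1) and not just bounded, since loops
  have to be a large multiple of \<open>r\<close> long.\<close>

lemma moment_tau:
  assumes fin: "moment A 1 < \<infinity>" and \<eta>: "\<eta> > 0"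
  shows "\<exists>R. \<forall>r\<ge>R. real r * tau r \<le> \<eta>"
proof -
  define p where "p = (\<lambda>s. measure lab {x \<in> space lab. coding_radius A x 0 = enat s})"
  have pm: "{x \<in> space lab. coding_radius A x 0 = enat s} \<in> sets lab" for s
  proof -
    have "Measurable.pred lab (\<lambda>x. view x 0 s \<in> nbhds A \<and> (\<forall>s'<s. view x 0 s' \<notin> nbhds A))"
      using pred_view_nbhds[OF ula] by measurable
    then show ?thesis by (simp add: coding_radius_eq_enat pred_def)
  qed
  have "moment A 1 = (\<Sum>s. ennreal (real s * p s))"
    unfolding moment_def random_labels_eq p_def
    by (intro suminf_cong) (simp add: L.emeasure_eq_measure ennreal_mult)
  then have sum: "summable (\<lambda>s. real s * p s)"
    using fin by (intro summable_suminf_not_top) (auto simp: p_def)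
  from suminf_exist_split[OF \<eta> this] obtain R where
    R: "\<And>n. n \<ge> R \<Longrightarrow> norm (\<Sum>i. real (i + n) * p (i + n)) < \<eta>" by blast
  have "real r * tau r \<le> \<eta>" if "r \<ge> R" for r
  proof -
    have psum: "summable (\<lambda>i. p (i + Suc r))"
    proof (rule summable_comparison_test)
      show "summable (\<lambda>i. real (i + Suc r) * p (i + Suc r))" using sum by (subst summable_iff_shift)
      show "\<exists>N. \<forall>n\<ge>N. norm (p (n + Suc r)) \<le> real (n + Suc r) * p (n + Suc r)"
      proof (intro exI[of _ 0] allI impI)
        fix n
        have "1 * p (n + Suc r) \<le> real (n + Suc r) * p (n + Suc r)" by (rule mult_right_mono) (auto simp: p_def)
        then show "norm (p (n + Suc r)) \<le> real (n + Suc r) * p (n + Suc r)" by (simp add: p_def)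
      qed
    qed
    have "tau r \<le> measure lab (\<Union>i. {x \<in> space lab. coding_radius A x 0 = enat (i + Suc r)})"
      unfolding tau_def
    proof (rule L.finite_measure_mono_AE)
      show "AE x in lab. x \<in> {x \<in> space lab. \<not> good A r x 0} \<longrightarrow> x \<in> (\<Union>i. {x \<in> space lab. coding_radius A x 0 = enat (i + Suc r)})"
        using AE_proper
      proof (eventually_elim, safe)
        fix x assume x: "x \<in> space lab" "\<not> good A r x 0" and "\<forall>v. halts A x v"
        then obtain s where s: "coding_radius A x 0 = enat s" by (auto simp: coding_radius_def)
        then have "view x 0 s \<in> nbhds A" by (simp add: coding_radius_eq_enat)
        then have "s > r" using x(2) by (auto simp: good_def not_less[symmetric])
        then have "s = (s - Suc r) + Suc r" by simp
        then show "x \<in> (\<Union>i. {x \<in> space lab. coding_radius A x 0 = enat (i + Suc r)})" using s x(1) by auto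
      qed
    qed (use pm in auto)
    also have "\<dots> = (\<Sum>i. p (i + Suc r))"
      unfolding p_def using pm
      by (intro sums_unique L.finite_measure_UNION) (auto simp: disjoint_family_on_def)
    finally have "real r * tau r \<le> real r * (\<Sum>i. p (i + Suc r))" by (rule mult_left_mono) simp
    also have "\<dots> = (\<Sum>i. real r * p (i + Suc r))" using psum by (rule suminf_mult[symmetric])
    also have "\<dots> \<le> (\<Sum>i. real (i + Suc r) * p (i + Suc r))"
    proof (rule suminf_le)
      show "real r * p (n + Suc r) \<le> real (n + Suc r) * p (n + Suc r)" for n
        by (rule mult_right_mono) (auto simp: p_def)
      show "summable (\<lambda>i. real r * p (i + Suc r))" using psum by (rule summable_mult)
      show "summable (\<lambda>i. real (i + Suc r) * p (i + Suc r))" using sum by (subst summable_iff_shift)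
    qed
    also have "\<dots> \<le> \<eta>" using R[of "Suc r"] that by (simp only: real_norm_def) linarith
    finally show ?thesis .
  qed
  then show ?thesis by blast
qed

text \<open>Unlike \<open>beta\<close>, this counts only decided pairs and so increases with
  \<open>r\<close>. A fixed radius can thus be bounded by arbitrarily large scales.\<close>

definition gamma :: "nat \<Rightarrow> int \<Rightarrow> real" where
  "gamma r \<sigma> = measure lab {x \<in> space lab. good A r x (pt 0 0) \<and> good A r x (pt 1 0) \<and> \<not> steps r 0 \<sigma> x}"

lemma col_mono: "good A r x v \<Longrightarrow> r \<le> r' \<Longrightarrow> C r' x v = C r x v"
  by (simp add: col_def good_mono)

lemma gamma_mono:
  assumes "r \<le> r'"
  shows "gamma r \<sigma> \<le> gamma r' \<sigma>"
  unfolding gamma_def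
proof (rule L.finite_measure_mono)
  have "good A r' x v \<and> C r' x v = C r x v" if "good A r x v" for x v
    using that assms good_mono col_mono by blast
  then show "{x \<in> space lab. good A r x (pt 0 0) \<and> good A r x (pt 1 0) \<and> \<not> steps r 0 \<sigma> x}
     \<subseteq> {x \<in> space lab. good A r' x (pt 0 0) \<and> good A r' x (pt 1 0) \<and> \<not> steps r' 0 \<sigma> x}"
    by (auto simp: steps_def)
qed measurable

lemma gamma_beta: "gamma r \<sigma> \<le> beta r \<sigma>"
  unfolding gamma_def beta_def by (rule L.finite_measure_mono) auto

lemma gamma_small:
  assumes fin: "moment A 1 < \<infinity>" and \<epsilon>: "\<epsilon> > 0"
  shows "\<exists>\<sigma>\<in>{1, -1}. gamma r0 \<sigma> \<le> \<epsilon>"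
proof -
  define K :: nat where "K = nat \<lceil>2 / \<epsilon>\<rceil> + 3"
  have K: "real K \<ge> 2 / \<epsilon>" "K \<ge> 3" unfolding K_def by linarith+
  \<comment> \<open>With \<open>M = K * (4 * r + 4)\<close> this gives
    \<open>M * tau r \<le> 8 * min (1 / 300) (\<epsilon> / 200)\<close>. The first bound yields
    \<open>32 * M * tau r < 1\<close>, the second makes the atypical loops cost at most
    \<open>\<epsilon> / 2\<close>; the other \<open>\<epsilon> / 2\<close> is
    \<open>1 / K\<close>.\<close>
  define \<eta> where "\<eta> = min (1 / 300) (\<epsilon> / 200) / real K"
  have \<eta>: "\<eta> > 0" using \<epsilon> K by (simp add: \<eta>_def)
  obtain R where R: "\<And>r. r \<ge> R \<Longrightarrow> real r * tau r \<le> \<eta>" using moment_tau[OF fin \<eta>] by blast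
  define r where "r = max R (max r0 1)"
  define M where "M = K * (4 * r + 4)"
  have "real M * tau r \<le> real (K * (8 * r)) * tau r"
    using tau_nonneg unfolding M_def r_def by (intro mult_right_mono) (auto simp del: of_nat_mult)
  also have "\<dots> = 8 * real K * (real r * tau r)" by simp
  also have "\<dots> \<le> 8 * real K * \<eta>" using R[of r] by (intro mult_left_mono) (auto simp: r_def)
  also have "\<dots> = 8 * min (1 / 300) (\<epsilon> / 200)" using K by (simp add: \<eta>_def)
  finally have Mt: "real M * tau r \<le> 8 * min (1 / 300) (\<epsilon> / 200)" .
  then have "32 * real M * tau r < 1" by (auto simp: min_def split: if_splits)
  moreover have "3 * (4 * r + 4) \<le> M" using K unfolding M_def by (intro mult_right_mono) auto
  ultimately obtain \<sigma> where \<sigma>: "\<sigma> \<in> {1, -1}"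
    and b: "real M * beta r \<sigma> \<le> real (4 * r + 4) + real M * (8 * real M * tau r)"
    using beta_bound by blast
  have M0: "real M > 0" using K by (simp add: M_def)
  have "real (4 * r + 4) = real M * (1 / real K)" using K by (simp add: M_def)
  also have "\<dots> \<le> real M * (\<epsilon> / 2)"
    using K \<epsilon> M0 by (intro mult_left_mono) (auto simp: field_simps)
  finally have "real (4 * r + 4) \<le> real M * (\<epsilon> / 2)" .
  moreover have "real M * (8 * real M * tau r) \<le> real M * (\<epsilon> / 2)"
    using Mt \<epsilon> by (intro mult_left_mono) (auto simp: min_def split: if_splits)
  ultimately have "real M * beta r \<sigma> \<le> real M * \<epsilon>" using b by (simp add: field_simps)
  then have "beta r \<sigma> \<le> \<epsilon>" using M0 by simp
  moreover have "gamma r0 \<sigma> \<le> gamma r \<sigma>" by (rule gamma_mono) (simp add: r_def)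
  ultimately show ?thesis using gamma_beta[of r \<sigma>] \<sigma> by (meson order_trans)
qed

text \<open>The sign found at a large scale may depend on the scale and on the precision. If both
  signs had positive \<open>gamma\<close> somewhere, both would be bounded below at a common radius,
  and no sign could be made small there.\<close>

lemma gamma_zero:
  assumes fin: "moment A 1 < \<infinity>"
  obtains \<sigma> where "\<sigma> \<in> {1, -1}" "\<And>r. gamma r \<sigma> = 0"
proof -
  have nn: "gamma r \<sigma> \<ge> 0" for r \<sigma> by (simp add: gamma_def)
  have "(\<forall>r. gamma r 1 = 0) \<or> (\<forall>r. gamma r (-1) = 0)"
  proof (rule ccontr)
    assume "\<not> ?thesis"
    then obtain r1 r2 where "gamma r1 1 > 0" "gamma r2 (-1) > 0"
      using nn by (metis order_le_less)
    then have pos: "gamma (max r1 r2) 1 > 0" "gamma (max r1 r2) (-1) > 0"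
      using gamma_mono[of r1 "max r1 r2" 1] gamma_mono[of r2 "max r1 r2" "-1"] by linarith+
    define \<epsilon> where "\<epsilon> = min (gamma (max r1 r2) 1) (gamma (max r1 r2) (-1)) / 2"
    have "\<epsilon> > 0" "\<epsilon> < gamma (max r1 r2) 1" "\<epsilon> < gamma (max r1 r2) (-1)"
      using pos by (auto simp: \<epsilon>_def min_def)
    then show False using gamma_small[OF fin, of \<epsilon> "max r1 r2"] by auto
  qed
  then show thesis using that by blast
qed

lemma AE_steps:
  assumes zero: "\<And>r. gamma r \<sigma> = 0"
  shows "AE x in lab. \<forall>a. inc (alg_output A x (pt a 0)) (alg_output A x (pt (a + 1) 0)) = \<sigma>"
proof -
  have "AE x in lab. \<forall>a r. good A r x (pt a 0) \<and> good A r x (pt (a + 1) 0) \<longrightarrow> steps r a \<sigma> x"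
  proof (subst AE_all_countable, rule allI, subst AE_all_countable, rule allI)
    fix a r
    let ?Q = "\<lambda>x. good A r x (pt 0 0) \<and> good A r x (pt 1 0) \<and> \<not> steps r 0 \<sigma> x"
    have Qm: "Measurable.pred lab ?Q" by measurable
    have "measure lab {x \<in> space lab. ?Q (\<lambda>w. x (pt a 0 + w))} = measure lab {x \<in> space lab. ?Q x}"
      by (rule reindex_law[OF Qm, where V = UNIV]) (auto simp: depends_on_def fun_eq_iff[symmetric] inj_on_def)
    then have "measure lab {x \<in> space lab. good A r x (pt a 0) \<and> good A r x (pt (a + 1) 0) \<and> \<not> steps r a \<sigma> x} = 0"
      using zero[of r] by (simp add: gamma_def good_shift steps_shift pt_add)
    then have "AE x in lab. \<not> (good A r x (pt a 0) \<and> good A r x (pt (a + 1) 0) \<and> \<not> steps r a \<sigma> x)"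
      by (subst (asm) L.prob_eq_0) auto
    then show "AE x in lab. good A r x (pt a 0) \<and> good A r x (pt (a + 1) 0) \<longrightarrow> steps r a \<sigma> x"
      by eventually_elim auto
  qed
  then show ?thesis using AE_proper
  proof (eventually_elim, intro allI)
    fix x a
    assume st: "\<forall>a r. good A r x (pt a 0) \<and> good A r x (pt (a + 1) 0) \<longrightarrow> steps r a \<sigma> x"
      and "(\<forall>v. halts A x v) \<and> (\<forall>u v. (u, v) \<in> grid_adj \<longrightarrow> alg_output A x u \<noteq> alg_output A x v)"
    then obtain s s' where "view x (pt a 0) s \<in> nbhds A" "view x (pt (a + 1) 0) s' \<in> nbhds A"
      unfolding halts_def by blast
    then have g: "good A (max s s') x (pt a 0)" "good A (max s s') x (pt (a + 1) 0)"
      unfolding good_def by (auto intro: exI[of _ s] exI[of _ s'])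
    with st have "steps (max s s') a \<sigma> x" by blast
    then show "inc (alg_output A x (pt a 0)) (alg_output A x (pt (a + 1) 0)) = \<sigma>"
      using g by (simp add: steps_def col_def)
  qed
qed

lemma inc_mod:
  assumes "a < 3" "b < 3" "a \<noteq> b"
  shows "int b mod 3 = (int a + inc a b) mod 3"
proof -
  have n: "n = 0 \<or> n = 1 \<or> n = 2" if "n < 3" for n :: nat using that by auto
  show ?thesis
    using n[OF assms(1)] n[OF assms(2)] assms(3) by (elim disjE) (simp_all add: inc_def)
qed

lemma moment_infinite: "moment A 1 = \<infinity>"
proof (rule ccontr)
  assume "\<not> ?thesis"
  then have fin: "moment A 1 < \<infinity>" by (simp add: less_top)
  obtain \<sigma> where \<sigma>: "\<And>r. gamma r \<sigma> = 0" using gamma_zero[OF fin] by blast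
  obtain R where "\<And>r. r \<ge> R \<Longrightarrow> real r * tau r \<le> 1 / 100" using moment_tau[OF fin, of "1 / 100"] by auto
  then have "real (max R 1) * tau (max R 1) \<le> 1 / 100" by simp
  then obtain r :: nat where "r \<ge> 1" and "real r * tau r \<le> 1 / 100" by (metis max.cobounded2)
  moreover have "1 * tau r \<le> real r * tau r" using \<open>r \<ge> 1\<close> tau_nonneg by (intro mult_right_mono) auto
  ultimately have tr: "tau r \<le> 1 / 100" by simp
  \<comment> \<open>A multiple of the period 3, and more than \<open>2 * r\<close>, so that the two
    views are disjoint.\<close>
  define m where "m = 3 * int r"
  let ?f = "\<lambda>x. C r x 0" and ?g = "\<lambda>x. C r x (pt m 0)"
  have AE_lt: "AE x in lab. \<forall>v. alg_output A x v < 3"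
    using AE_proper AE_space
  proof (eventually_elim, intro allI)
    fix x v assume h: "(\<forall>v. halts A x v) \<and> (\<forall>u v. (u, v) \<in> grid_adj \<longrightarrow> alg_output A x u \<noteq> alg_output A x v)"
      and x: "x \<in> space lab"
    then obtain s where "view x v s \<in> nbhds A" unfolding halts_def by blast
    then have "good A s x v" by (auto simp: good_def)
    then show "alg_output A x v < 3" using col_range[OF ula x, of s v] by (simp add: col_def)
  qed
  have eq: "AE x in lab. alg_output A x (pt m 0) = alg_output A x 0"
    using AE_steps[OF \<sigma>] AE_lt AE_proper
  proof eventually_elim
    fix x
    assume st: "\<forall>a. inc (alg_output A x (pt a 0)) (alg_output A x (pt (a + 1) 0)) = \<sigma>"
      and lt: "\<forall>v. alg_output A x v < 3"
      and pr: "(\<forall>v. halts A x v) \<and> (\<forall>u v. (u, v) \<in> grid_adj \<longrightarrow> alg_output A x u \<noteq> alg_output A x v)"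
    have "int (alg_output A x (pt (int k) 0)) mod 3 = (int (alg_output A x 0) + int k * \<sigma>) mod 3" for k
    proof (induction k)
      case 0
      show ?case by (simp add: pt_0)
    next
      case (Suc k)
      have "int (alg_output A x (pt (int k + 1) 0)) mod 3 = (int (alg_output A x (pt (int k) 0)) + \<sigma>) mod 3"
        using inc_mod[of "alg_output A x (pt (int k) 0)" "alg_output A x (pt (int k + 1) 0)"] lt pr pt_adj(1)[of "int k" 0] st
        by auto
      also have "\<dots> = ((int (alg_output A x 0) + int k * \<sigma>) + \<sigma>) mod 3"
        using Suc.IH by (metis mod_add_left_eq)
      finally show ?case by (simp add: algebra_simps)
    qed
    moreover have "int (3 * r) * \<sigma> = (int r * \<sigma>) * 3" "int (3 * r) = m" by (simp_all add: m_def)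
    ultimately have "int (alg_output A x (pt m 0)) mod 3 = (int (alg_output A x 0) + (int r * \<sigma>) * 3) mod 3"
      by metis
    then have "int (alg_output A x (pt m 0)) mod 3 = int (alg_output A x 0) mod 3"
      by (simp only: mod_mult_self1)
    then show "alg_output A x (pt m 0) = alg_output A x 0" using lt by (simp add: mod_pos_pos_trivial)
  qed
  have fm: "(\<lambda>x. C r x v) \<in> lab \<rightarrow>\<^sub>M count_space UNIV" for v by (rule col_measurable[OF ula])
  have pm: "Measurable.pred lab (\<lambda>x. ?f x = ?g x)" by (rule binop_count_space[OF fm fm])
  have "measure lab {x \<in> space lab. \<not> ?f x = ?g x} \<le> real (card {0, pt m 0}) * tau r"
    by (rule good_union_bound[OF _ pm]) (use eq in \<open>auto simp: col_def\<close>)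
  also have "\<dots> \<le> 2 * tau r" using tau_nonneg by (intro mult_right_mono) (auto simp: card_insert_if)
  finally have "measure lab {x \<in> space lab. \<not> ?f x = ?g x} \<le> 2 / 100" using tr by simp
  then have agree: "measure lab {x \<in> space lab. ?f x = ?g x} \<ge> 1 - 2 / 100"
    using L.prob_neg[OF pm[unfolded pred_def]] by simp
  have shift: "measure lab {x \<in> space lab. C r x v = t} = measure lab {x \<in> space lab. ?f x = t}" for v t
  proof -
    have "measure lab {x \<in> space lab. C r (\<lambda>w. x (v + w)) 0 = t} = measure lab {x \<in> space lab. ?f x = t}"
      by (rule reindex_law[where V = UNIV]) (use fm in \<open>auto simp: depends_on_def fun_eq_iff[symmetric] inj_on_def\<close>)
    then show ?thesis by (simp add: col_shift)
  qed
  \<comment> \<open>Two independent copies of a colour that agree with probability 98 percent: one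
    colour has at least that probability.\<close>
  have "\<exists>t\<in>{..<3}. measure lab {x \<in> space lab. ?f x = t} \<ge> 1 - 2 / 100"
  proof (rule iid_agree_const[OF fm _ fm])
    show "depends_on ?f {w. near (int r) 0 w}" by (intro depends_onI col_cong) auto
    show "depends_on ?g {w. near (int r) (pt m 0) w}" by (intro depends_onI col_cong) auto
    have "\<not> (near (int r) 0 w \<and> near (int r) (pt m 0) w)" for w
    proof
      assume w: "near (int r) 0 w \<and> near (int r) (pt m 0) w"
      then have "\<bar>w $ i1\<bar> \<le> int r" "\<bar>m - w $ i1\<bar> \<le> int r" unfolding near_def by (force, metis pt_1)
      then show False using \<open>r \<ge> 1\<close> unfolding m_def by linarith
    qed
    then show "{w. near (int r) 0 w} \<inter> {w. near (int r) (pt m 0) w} = {}" by blast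
    show "?f x \<in> {..<3}" if "x \<in> space lab" for x using col_range[OF ula that] by simp
  qed (use shift agree in auto)
  then obtain j where j: "measure lab {x \<in> space lab. ?f x = j} \<ge> 1 - 2 / 100" by blast
  \<comment> \<open>By translation invariance two neighbours are both likely to have the colour
    \<open>j\<close>. The four failure probabilities add up to at most 6/100, so some labelling
    gives both neighbours the true colour \<open>j\<close>.\<close>
  define Q where "Q = (\<lambda>(b, i) x. if b then good A r x (pt i 0) else C r x (pt i 0) = j)"
  let ?I = "{(True, 0), (True, 1), (False, 0), (False, 1)} :: (bool \<times> int) set"
  have "\<exists>x\<in>space lab. (alg_output A x (pt 0 0) \<noteq> alg_output A x (pt 1 0)) \<and> (\<forall>i\<in>?I. Q i x)"
  proof (rule L.exists_all_good)
    have cm: "{x \<in> space lab. C r x v = j} \<in> sets lab" for v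
      using measurable_compose[OF fm, of "\<lambda>z. z = j" "count_space UNIV" v] by (simp add: pred_def)
    have cm': "{x \<in> space lab. C r x v \<noteq> j} \<in> sets lab" for v
    proof -
      have "{x \<in> space lab. C r x v \<noteq> j} = space lab - {x \<in> space lab. C r x v = j}" by blast
      then show ?thesis using sets.compl_sets[OF cm[of v]] by (simp only:)
    qed
    have gm: "{x \<in> space lab. \<not> good A r x v} \<in> sets lab" for v
      using pred_intros_logic(2)[OF good_measurable] unfolding pred_def .
    show "{x \<in> space lab. \<not> Q i x} \<in> sets lab" for i
      using cm'[of "pt (snd i) 0"] gm[of "pt (snd i) 0"] by (cases i; cases "fst i") (simp_all add: Q_def)
    have "measure lab {x \<in> space lab. C r x v \<noteq> j} \<le> 2 / 100" for v
      using L.prob_neg[OF cm[of v]] j shift[of v j] by simp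
    from this[of "pt 0 0"] this[of "pt 1 0"] tr
    show "(\<Sum>i\<in>?I. measure lab {x \<in> space lab. \<not> Q i x}) < 1"
      by (simp add: Q_def tau_eq)
    show "AE x in lab. alg_output A x (pt 0 0) \<noteq> alg_output A x (pt 1 0)"
      using AE_proper by eventually_elim (use pt_adj(1)[of 0 0] in auto)
  qed simp
  then obtain x where "alg_output A x (pt 0 0) \<noteq> alg_output A x (pt 1 0)" "\<forall>i\<in>?I. Q i x" by blast
  then show False by (auto simp: Q_def col_def)
qed

end

section \<open>Upper bound, deterministic part: a colouring from a covering hierarchy\<close>

section \<open>Colourings from hierarchies of islands\<close>

text \<open>The range is 7 = 3 + 1 + 3: if the thickenings by 3 of two components touch, the
  components are linked. Hence distinct islands of one level are never adjacent.\<close>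

definition link :: "(int ^ 'd) set \<Rightarrow> (int ^ 'd) rel" where
  "link S = {(u, v). u \<in> S \<and> v \<in> S \<and> near 7 u v}"

lemma linkI: "u \<in> S \<Longrightarrow> v \<in> S \<Longrightarrow> near 7 u v \<Longrightarrow> (u, v) \<in> (link S)\<^sup>*"
  by (auto simp: link_def)

lemma link_sym: "(u, v) \<in> (link S)\<^sup>* \<Longrightarrow> (v, u) \<in> (link S)\<^sup>*"
proof -
  have "sym (link S)" by (auto simp: sym_def link_def near_sym)
  then show "(u, v) \<in> (link S)\<^sup>* \<Longrightarrow> (v, u) \<in> (link S)\<^sup>*" using sym_rtrancl symD by metis
qed

lemma link_mono: "S \<subseteq> T \<Longrightarrow> (u, v) \<in> (link S)\<^sup>* \<Longrightarrow> (u, v) \<in> (link T)\<^sup>*"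
  by (rule subsetD[OF rtrancl_mono]) (auto simp: link_def)

lemma link_in: "(u, v) \<in> (link S)\<^sup>* \<Longrightarrow> u \<in> S \<Longrightarrow> v \<in> S"
  by (erule rtranclE) (auto simp: link_def)

text \<open>The union of all islands of level below \<open>k\<close>. The recursion spells islands
  out because \<open>island\<close> itself refers to \<open>Y\<close>; \<open>Y_Suc\<close> is the
  readable form.\<close>

primrec Y :: "(nat \<Rightarrow> (int ^ 'd) set) \<Rightarrow> nat \<Rightarrow> (int ^ 'd) set" where
  "Y U 0 = {}"
| "Y U (Suc k) = Y U k \<union> {w. \<exists>u\<in>U k. \<exists>q. (u, q) \<in> (link (Y U k \<union> U k))\<^sup>* \<and> near 3 q w}"

definition island :: "(nat \<Rightarrow> (int ^ 'd) set) \<Rightarrow> nat \<Rightarrow> int ^ 'd \<Rightarrow> (int ^ 'd) set" where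
  "island U k u = {w. \<exists>q. (u, q) \<in> (link (Y U k \<union> U k))\<^sup>* \<and> near 3 q w}"

lemma Y_Suc: "Y U (Suc k) = Y U k \<union> (\<Union>u\<in>U k. island U k u)"
  by (auto simp: island_def)

declare Y.simps(2) [simp del]

lemma island_ball: "near 3 u z \<Longrightarrow> z \<in> island U k u"
  by (auto simp: island_def)

lemma island_self: "u \<in> island U k u"
  by (rule island_ball) simp

lemma S_subset_Y: "Y U k \<union> U k \<subseteq> Y U (Suc k)"
  unfolding Y_Suc using island_self by blast

lemma Y_mono: "j \<le> k \<Longrightarrow> Y U j \<subseteq> Y U k"
  by (rule lift_Suc_mono_le[of "Y U"]) (auto simp: Y_Suc)

lemma island_subset_Y: "u \<in> U k \<Longrightarrow> island U k u \<subseteq> Y U (Suc k)"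
  unfolding Y_Suc by blast

lemma island_eq:
  assumes u: "u \<in> U k" "u' \<in> U k" and a: "a \<in> island U k u" "a' \<in> island U k u'" and adj: "near 1 a a'"
  shows "island U k u = island U k u'"
proof -
  let ?S = "Y U k \<union> U k"
  obtain q q' where q: "(u, q) \<in> (link ?S)\<^sup>*" "near 3 q a" and q': "(u', q') \<in> (link ?S)\<^sup>*" "near 3 q' a'"
    using a by (auto simp: island_def)
  have "near (3 + 1 + 3) q q'"
    using near_trans[OF near_trans[OF q(2) adj]] q'(2) near_sym by blast
  moreover have "q \<in> ?S" "q' \<in> ?S" using link_in q q' u by blast+
  ultimately have "(q, q') \<in> (link ?S)\<^sup>*" by (intro linkI) auto
  then have *: "(u, u') \<in> (link ?S)\<^sup>*" using q(1) link_sym[OF q'(1)] by simp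
  then have "(u, w) \<in> (link ?S)\<^sup>* \<longleftrightarrow> (u', w) \<in> (link ?S)\<^sup>*" for w
    using link_sym[OF *] by (meson rtrancl_trans)
  then show ?thesis by (simp add: island_def)
qed

text \<open>A lower island is part of the set whose components form the higher level, and it is
  connected under \<open>link\<close>. One contact therefore absorbs all of it, and thickening the
  component adds a margin of 3 around it, enough room for its collar.\<close>

lemma island_nested:
  assumes kk: "k < k'" and u: "u \<in> U k" "u' \<in> U k'"
    and a: "a \<in> island U k u" "a' \<in> island U k' u'" and adj: "near 1 a a'"
    and w: "w \<in> island U k u" "near 3 w z"
  shows "z \<in> island U k' u'"
proof -
  let ?S = "Y U k \<union> U k" and ?T = "Y U k' \<union> U k'"
  have YT: "Y U (Suc k) \<subseteq> ?T" using Y_mono[of "Suc k" k' U] kk by auto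
  then have ST: "?S \<subseteq> ?T" using S_subset_Y by blast
  have IT: "island U k u \<subseteq> ?T" using island_subset_Y[of u U k] u YT by blast
  have reach: "(u, x) \<in> (link ?T)\<^sup>*" if x: "x \<in> island U k u" for x
  proof -
    obtain q where q: "(u, q) \<in> (link ?S)\<^sup>*" "near 3 q x" using x by (auto simp: island_def)
    have "q \<in> ?S" using link_in[OF q(1)] u by blast
    then have "(q, x) \<in> (link ?T)\<^sup>*" using ST IT x q(2) by (intro linkI) (auto intro: near_mono)
    then show ?thesis using link_mono[OF ST q(1)] by simp
  qed
  obtain q' where q': "(u', q') \<in> (link ?T)\<^sup>*" "near 3 q' a'" using a by (auto simp: island_def)
  have "near (3 + 1) q' a" using near_trans[OF q'(2)] adj near_sym by blast
  then have "(q', a) \<in> (link ?T)\<^sup>*"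
    using IT a link_in[OF q'(1)] u by (intro linkI) (auto intro: near_mono)
  then have "(u', w) \<in> (link ?T)\<^sup>*"
    using q'(1) link_sym[OF reach[OF a(1)]] reach[OF w(1)] by (meson rtrancl_trans)
  then show ?thesis using w(2) by (auto simp: island_def)
qed

text \<open>The island of level \<open>k\<close> that contains \<open>v\<close>, or the empty set.
  By \<open>island_eq\<close> the union has at most one distinct member.\<close>

definition isle :: "(nat \<Rightarrow> (int ^ 'd) set) \<Rightarrow> nat \<Rightarrow> int ^ 'd \<Rightarrow> (int ^ 'd) set" where
  "isle U k v = (\<Union>u\<in>{u \<in> U k. v \<in> island U k u}. island U k u)"

lemma isle_eq:
  assumes "u \<in> U k" "v \<in> island U k u"
  shows "isle U k v = island U k u"
proof -
  have "island U k a = island U k u" if "a \<in> U k" "v \<in> island U k a" for a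
    by (rule island_eq[OF that(1) assms(1) that(2) assms(2)]) simp
  then have "isle U k v = (\<Union>a\<in>{a \<in> U k. v \<in> island U k a}. island U k u)"
    unfolding isle_def by (intro SUP_cong) auto
  then show ?thesis using assms by auto
qed

lemma isle_mem: "isle U k v \<noteq> {} \<longleftrightarrow> v \<in> isle U k v"
  by (auto simp: isle_def)

lemma isle_obtain:
  assumes "v \<in> isle U k v"
  obtains u where "u \<in> U k" "isle U k v = island U k u" "v \<in> island U k u"
proof -
  obtain u where "u \<in> U k" "v \<in> island U k u" using assms by (auto simp: isle_def)
  then show thesis using that isle_eq by blast
qed

lemma isle_adj_same:
  assumes "u \<in> isle U k u" "v \<in> isle U k v" "near 1 u v"
  shows "isle U k u = isle U k v"
  using assms by (elim isle_obtain) (metis island_eq)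

lemma isle_adj_nested:
  assumes "u \<in> isle U k u" "v \<in> isle U k' v" "near 1 u v" "k < k'" "w \<in> isle U k u" "near 3 w z"
  shows "z \<in> isle U k' v"
  using assms(1,2)
proof (elim isle_obtain)
  fix a b assume "a \<in> U k" "isle U k u = island U k a" "u \<in> island U k a"
    "b \<in> U k'" "isle U k' v = island U k' b" "v \<in> island U k' b"
  then show ?thesis using island_nested[of k k' a U b u v w z] assms by simp
qed

lemma isle_transfer: "v \<in> isle U k u \<Longrightarrow> isle U k v = isle U k u"
proof -
  assume "v \<in> isle U k u"
  then obtain a where a: "a \<in> U k" "u \<in> island U k a" "v \<in> island U k a" by (auto simp: isle_def)
  then show ?thesis using isle_eq[of a U k u] isle_eq[of a U k v] by simp
qed

lemma isle_deep: "v \<in> U k \<Longrightarrow> near 3 v z \<Longrightarrow> z \<in> isle U k v"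
  using isle_eq[of v U k v] island_self island_ball by blast

text \<open>The supremum distance from \<open>v\<close> to the complement of \<open>E\<close>, cut
  off at 3.\<close>

definition depth :: "(int ^ 'd) set \<Rightarrow> int ^ 'd \<Rightarrow> nat" where
  "depth E v = (if \<forall>z. near 2 v z \<longrightarrow> z \<in> E then 3 else if \<forall>z. near 1 v z \<longrightarrow> z \<in> E then 2
     else if v \<in> E then 1 else 0)"

lemma depth_le: "depth E v \<le> 3"
  by (simp add: depth_def)

lemma depth_adj:
  assumes "near 1 u v"
  shows "depth E u \<le> depth E v + 1"
proof -
  have 1: "near 2 u z" if "near 1 v z" for z using near_trans[OF assms that] by simp
  have 2: "near 1 u v" "near 2 v v" "near 1 v v" "near 1 u u" "near 2 u u" using assms by auto
  show ?thesis unfolding depth_def using 1 2 by auto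
qed

text \<open>The least height that is at least \<open>F\<close> and is even exactly if
  \<open>b\<close>, reduced modulo 3.\<close>

definition cc :: "bool \<Rightarrow> nat \<Rightarrow> nat" where
  "cc b F = (if even F = b then F else F + 1) mod 3"

lemma cc_less: "cc b F < 3"
  by (simp add: cc_def)

text \<open>The two heights have opposite parities and differ by at most 2, hence by exactly
  1.\<close>

lemma cc_adj:
  assumes "F \<le> 3" "G \<le> 3" "F \<le> G + 1" "G \<le> F + 1"
  shows "cc b F \<noteq> cc (\<not> b) G"
proof -
  have "F = 0 \<or> F = 1 \<or> F = 2 \<or> F = 3" "G = 0 \<or> G = 1 \<or> G = 2 \<or> G = 3" using assms by auto
  then show ?thesis using assms(3,4) by (cases b) (elim disjE; simp add: cc_def)+
qed

text \<open>Raising the height by 3 has the same effect as exchanging the two checkerboard phases.\<close>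

lemma cc_flip: "cc b 3 = cc (\<not> b) 0"
  by (cases b) (simp_all add: cc_def)

text \<open>Vertices \<open>lead E\<close> that are equivariant under translations are obtained from an arbitrary
  representative of each translation class, whose leader is the origin.\<close>

definition translates :: "(int ^ 'd) set \<Rightarrow> (int ^ 'd) set set" where
  "translates E = range (\<lambda>t. (+) t ` E)"

definition lead :: "(int ^ 'd::finite) set \<Rightarrow> int ^ 'd" where
  "lead E = (THE t. E = (+) t ` (SOME F. F \<in> translates E))"

lemma translates_translate: "translates ((+) s ` E) = translates E"
proof -
  have "(+) t ` (+) s ` E = (+) (t + s) ` E" for t by (auto simp: image_image add.assoc)
  moreover have "(+) t ` E = (+) (t - s) ` (+) s ` E" for t by (auto simp: image_image)
  ultimately show ?thesis unfolding translates_def by blast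
qed

text \<open>Translation by \<open>s\<close> changes the sum of the coordinates by
  \<open>card F\<close> times \<open>s\<close>, so a nonempty finite set determines the translation.
  For infinite islands no equivariant leader need exist.\<close>

lemma translate_eqD:
  fixes F :: "(int ^ 'd::finite) set"
  assumes "finite F" "F \<noteq> {}" "(+) s ` F = (+) t ` F"
  shows "s = t"
proof -
  have s: "(\<Sum>w\<in>(+) a ` F. w $ i) = of_nat (card F) * a $ i + (\<Sum>w\<in>F. w $ i)" for a i
    by (subst sum.reindex) (auto simp: sum.distrib)
  have "int (card F) * s $ i = int (card F) * t $ i" for i
    using s[where a = s and i = i] s[where a = t and i = i] assms(3) by auto
  then show ?thesis using assms by (auto simp: vec_eq_iff)
qed

lemma lead_translate:
  fixes E :: "(int ^ 'd::finite) set"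
  assumes "finite E" "E \<noteq> {}"
  shows "lead ((+) s ` E) = s + lead E"
proof -
  define F where "F = (SOME F. F \<in> translates E)"
  have "E \<in> translates E" unfolding translates_def by (rule range_eqI[of _ _ 0]) simp
  then have "F \<in> translates E" unfolding F_def by (rule someI)
  then obtain t where t: "F = (+) t ` E" by (auto simp: translates_def)
  then have E: "E = (+) (- t) ` F" by (auto simp: image_image)
  have F: "finite F" "F \<noteq> {}" using t assms by auto
  have "lead ((+) a ` E) = a - t" for a
    unfolding lead_def translates_translate F_def[symmetric]
  proof (rule the_equality)
    show e: "(+) a ` E = (+) (a - t) ` F" by (subst E) (auto simp: image_image)
    show "x = a - t" if "(+) a ` E = (+) x ` F" for x using translate_eqD[OF F, of x "a - t"] that e by simp
  qed
  from this[of s] this[of 0] show ?thesis by simp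
qed

text \<open>The phase is measured from the leader, so it is determined by the island up to
  translation and requires no global parity.\<close>

definition par :: "(int ^ 'd::finite) set \<Rightarrow> int ^ 'd \<Rightarrow> bool" where
  "par E v \<longleftrightarrow> even (\<Sum>i\<in>UNIV. v $ i - lead E $ i)"

lemma par_adj:
  fixes u v :: "int ^ 'd::finite"
  assumes "(u, v) \<in> grid_adj"
  shows "par E v \<longleftrightarrow> \<not> par E u"
proof -
  have *: "par E (w + axis i 1) \<longleftrightarrow> \<not> par E w" for w :: "int ^ 'd" and i
  proof -
    have "(\<Sum>j\<in>UNIV. (w + axis i 1) $ j - lead E $ j) = (\<Sum>j\<in>UNIV. (w $ j - lead E $ j) + (if j = i then 1 else 0))"
      by (rule sum.cong) (auto simp: axis_def)
    also have "\<dots> = (\<Sum>j\<in>UNIV. w $ j - lead E $ j) + 1"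
      by (subst sum.distrib) simp
    finally show ?thesis by (simp add: par_def)
  qed
  show ?thesis using assms * by (auto simp: grid_adj_iff)
qed

lemma par_translate: "finite E \<Longrightarrow> E \<noteq> {} \<Longrightarrow> par ((+) t ` E) (t + v) = par E v"
  by (simp add: par_def lead_translate)

text \<open>\<open>E\<close> is the smallest island around \<open>v\<close> and \<open>E'\<close> the next one. If \<open>v\<close> is in no second island,
  \<open>j\<close> and \<open>E'\<close> are meaningless, but then \<open>v\<close> is deep in \<open>E\<close>.\<close>

definition colour :: "(nat \<Rightarrow> (int ^ 'd::finite) set) \<Rightarrow> int ^ 'd \<Rightarrow> nat" where
  "colour U v =
    (let i = (LEAST k. v \<in> isle U k v); j = (LEAST k. i < k \<and> v \<in> isle U k v);
         E = isle U i v; E' = isle U j v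
     in if depth E v = 3 then cc (par E v) 0
        else cc (par E' v) (if par E v = par E' v then 0 else depth E v))"

lemma colour_deep:
  assumes "v \<in> isle U i v" "\<And>k. k < i \<Longrightarrow> v \<notin> isle U k v" "depth (isle U i v) v = 3"
  shows "colour U v = cc (par (isle U i v) v) 0"
proof -
  have "(LEAST k. v \<in> isle U k v) = i" using assms by (intro Least_equality) (auto simp: not_less[symmetric])
  then show ?thesis using assms by (simp add: colour_def Let_def)
qed

text \<open>If a second island exists, the deep case is not separate: by \<open>cc_flip\<close>,
  height 3 over the outer phase is height 0 over the inner one.\<close>

lemma colour_two:
  assumes "v \<in> isle U i v" "\<And>k. k < i \<Longrightarrow> v \<notin> isle U k v" "i < j" "v \<in> isle U j v" "\<And>k. i < k \<Longrightarrow> k < j \<Longrightarrow> v \<notin> isle U k v"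
  shows "colour U v = cc (par (isle U j v) v) (if par (isle U i v) v = par (isle U j v) v then 0 else depth (isle U i v) v)"
proof -
  have i: "(LEAST k. v \<in> isle U k v) = i" using assms by (intro Least_equality) (auto simp: not_less[symmetric])
  have j: "(LEAST k. i < k \<and> v \<in> isle U k v) = j" using assms by (intro Least_equality) (auto simp: not_less[symmetric])
  have "cc b 3 = cc b' 0" if "b \<noteq> b'" for b b' using that cc_flip[of b] by auto
  from this[of "par (isle U j v) v" "par (isle U i v) v"]
  show ?thesis unfolding colour_def Let_def i j
    by (cases "par (isle U i v) v = par (isle U j v) v"; cases "depth (isle U i v) v = 3") simp_all
qed

text \<open>If \<open>v\<close> lies in the smallest island \<open>K\<close> of \<open>u\<close>,
  nesting gives both vertices the same larger islands, so their colours differ only through the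
  parity and a depth that changes by at most 1. Otherwise \<open>u\<close> is on the rim of
  \<open>K\<close>, and the smallest island of \<open>v\<close> is the second island of
  \<open>u\<close>; there \<open>v\<close> is deep by the margin of 3, so it has height 0 over the
  phase from which \<open>u\<close> starts with height at most 1.\<close>

lemma colour_proper_aux:
  assumes cover: "\<And>v. \<exists>k. v \<in> U k" and adj: "(u, v) \<in> grid_adj"
    and i: "u \<in> isle U i u" "\<And>k. k < i \<Longrightarrow> u \<notin> isle U k u"
    and i': "v \<in> isle U i' v" "\<And>k. k < i' \<Longrightarrow> v \<notin> isle U k v" and le: "i \<le> i'"
  shows "colour U u \<noteq> colour U v"
proof -
  have n: "near 1 u v" "near 1 v u" using adj grid_adj_near near_sym by blast+
  have par: "par E v = (\<not> par E u)" for E by (rule par_adj[OF adj])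
  define K where "K = isle U i u"
  have dU: "depth (isle U k w) w = 3" if "w \<in> U k" for k w
    using isle_deep[of w U k] that near_mono[of 2 w _ 3] by (auto simp: depth_def)
  have inU: "w \<in> isle U k w" if "w \<in> U k" for k w using isle_deep[of w U k w] that by simp
  have nested: "z \<in> isle U k y" if "i < k" "y \<in> isle U k y" "near 1 u y" "w \<in> K" "near 3 w z" for k y w z
    using isle_adj_nested[of u U i y k w z] i that by (simp add: K_def)
  show ?thesis
  proof (cases "v \<in> K")
    case True
    have Kv: "isle U i v = K" using isle_transfer[of v U i u] True by (simp add: K_def)
    then have "i' = i" using i'(2)[of i] le True by (metis order_le_less)
    have vi: "v \<in> isle U i v" using Kv True by simp
    have same: "u \<in> isle U k u \<longleftrightarrow> v \<in> isle U k v" "u \<in> isle U k u \<Longrightarrow> isle U k u = isle U k v" if k: "i < k" for k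
    proof -
      have a: "isle U k v = isle U k u" if "u \<in> isle U k u"
        using nested[OF k that _ True, of v] isle_transfer[of v U k u] by simp
      have b: "isle U k u = isle U k v" if "v \<in> isle U k v"
        using nested[OF k that n(1), of u u] i(1) isle_transfer[of u U k v] by (simp add: K_def)
      show "u \<in> isle U k u \<longleftrightarrow> v \<in> isle U k v" using a b isle_mem by metis
      show "u \<in> isle U k u \<Longrightarrow> isle U k u = isle U k v" using a by simp
    qed
    show ?thesis
    proof (cases "\<exists>k>i. u \<in> isle U k u")
      case True
      define j where "j = (LEAST k. i < k \<and> u \<in> isle U k u)"
      have j: "i < j" "u \<in> isle U j u" using True LeastI_ex[of "\<lambda>k. i < k \<and> u \<in> isle U k u"] by (auto simp: j_def)
      have j': "u \<notin> isle U k u" if "i < k" "k < j" for k using that not_less_Least unfolding j_def by blast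
      have cu: "colour U u = cc (par (isle U j u) u) (if par K u = par (isle U j u) u then 0 else depth K u)"
        unfolding K_def using colour_two[OF i j j'] .
      have "colour U v = cc (par (isle U j v) v) (if par (isle U i v) v = par (isle U j v) v then 0 else depth (isle U i v) v)"
      proof (rule colour_two[OF vi _ j(1)])
        show "v \<notin> isle U k v" if "k < i" for k using i'(2) that \<open>i' = i\<close> by blast
        show "v \<in> isle U j v" using same(1)[OF j(1)] j(2) by blast
        show "v \<notin> isle U k v" if "i < k" "k < j" for k using same(1)[OF that(1)] j'[OF that] by blast
      qed
      then have cv: "colour U v = cc (\<not> par (isle U j u) u) (if par K u = par (isle U j u) u then 0 else depth K v)"
        using same(2)[OF j] Kv par by simp
      show ?thesis unfolding cu cv
        using depth_adj[OF n(1), of K] depth_adj[OF n(2), of K] depth_le[of K u] depth_le[of K v]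
        by (intro cc_adj) auto
    next
      \<comment> \<open>Without a larger island, the covering assumption puts both vertices into
        \<open>U i\<close> itself, where the depth is 3.\<close>
      case False
      have only: "w \<in> U i" if w: "w = u \<or> w = v" for w
      proof -
        obtain k where k: "w \<in> U k" using cover by blast
        then have "w \<in> isle U k w" by (rule inU)
        moreover have "\<not> i < k" using False same(1)[of k] w calculation by blast
        ultimately have "k = i" using i(2) i'(2) w \<open>i' = i\<close> by (metis linorder_neqE_nat)
        then show ?thesis using k by simp
      qed
      have "colour U u = cc (par K u) 0" unfolding K_def
        by (rule colour_deep[OF i]) (assumption, rule dU[OF only], simp)
      moreover have "colour U v = cc (par (isle U i v) v) 0"
      proof (rule colour_deep[OF vi])
        show "v \<notin> isle U k v" if "k < i" for k using i'(2) that \<open>i' = i\<close> by blast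
        show "depth (isle U i v) v = 3" by (rule dU[OF only]) simp
      qed
      ultimately show ?thesis using cc_adj[of 0 0] par Kv by simp
    qed
  next
    case False
    have notdeep: "depth K u \<noteq> 3" "depth K u = 1"
    proof -
      have "\<not> (\<forall>z. near 1 u z \<longrightarrow> z \<in> K)" using False n(1) by blast
      moreover have "\<not> (\<forall>z. near 2 u z \<longrightarrow> z \<in> K)" using False near_mono[OF n(1), of 2] by auto
      ultimately show "depth K u = 1" using i(1) by (simp add: depth_def K_def)
      then show "depth K u \<noteq> 3" by simp
    qed
    obtain k0 where k0: "u \<in> U k0" using cover by blast
    have "k0 \<noteq> i" using dU[OF k0] notdeep K_def by auto
    moreover have "\<not> k0 < i" using i(2) inU[OF k0] by blast
    ultimately have ex: "i < k0 \<and> u \<in> isle U k0 u" using inU[OF k0] by simp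
    define j where "j = (LEAST k. i < k \<and> u \<in> isle U k u)"
    have j: "i < j" "u \<in> isle U j u"
      using LeastI[of "\<lambda>k. i < k \<and> u \<in> isle U k u", OF ex] by (auto simp: j_def)
    have j': "u \<notin> isle U k u" if "i < k" "k < j" for k using that not_less_Least unfolding j_def by blast
    define L where "L = isle U j u"
    have L3: "z \<in> L" if "near 3 u z" for z
      using nested[OF j _ _ that] i(1) unfolding L_def K_def by simp
    have vL: "v \<in> L" using L3 near_mono[OF n(1), of 3] by auto
    then have Lv: "isle U j v = L" using isle_transfer[of v U j u] by (simp add: L_def)
    have "i' \<noteq> i"
    proof
      assume "i' = i"
      then have "isle U i u = isle U i v" using isle_adj_same[OF i(1) _ n(1)] i'(1) by simp
      then show False using False i'(1) \<open>i' = i\<close> by (simp add: K_def)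
    qed
    with le have ii: "i < i'" by simp
    have "i' = j"
    proof (rule antisym)
      show "i' \<le> j" using i'(2)[of j] Lv vL by (metis not_le)
      have "u \<in> isle U i' v" using nested[OF ii i'(1) n(1), of u u] i(1) by (simp add: K_def)
      then have "u \<in> isle U i' u" using isle_transfer[of u U i' v] by simp
      then show "j \<le> i'" using j'[OF ii] by (metis not_le)
    qed
    have deep: "depth L v = 3"
    proof -
      have "z \<in> L" if "near 2 v z" for z using L3 near_trans[OF n(1) that] by simp
      then show ?thesis by (simp add: depth_def)
    qed
    have cu: "colour U u = cc (par L u) (if par K u = par L u then 0 else depth K u)"
      unfolding K_def L_def using colour_two[OF i j j'] .
    have "colour U v = cc (par (isle U i' v) v) 0"
      by (rule colour_deep[OF i']) (assumption, simp add: \<open>i' = j\<close> Lv deep)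
    then have cv: "colour U v = cc (\<not> par L u) 0" using Lv \<open>i' = j\<close> par by simp
    show ?thesis unfolding cu cv using notdeep(2) by (intro cc_adj) auto
  qed
qed

lemma colour_proper:
  assumes cover: "\<And>v. \<exists>k. v \<in> U k" and adj: "(u, v) \<in> grid_adj"
  shows "colour U u \<noteq> colour U v"
proof -
  have ex: "\<exists>k. w \<in> isle U k w" for w using cover[of w] isle_deep[of w U _ w] by auto
  have least: "w \<in> isle U (LEAST k. w \<in> isle U k w) w" "\<And>k. k < (LEAST k. w \<in> isle U k w) \<Longrightarrow> w \<notin> isle U k w" for w
    using LeastI_ex[OF ex[of w]] not_less_Least by blast+
  have adj': "(v, u) \<in> grid_adj" using adj by (auto simp: grid_adj_iff)
  show ?thesis
    using colour_proper_aux[OF cover adj least least] colour_proper_aux[OF cover adj' least least]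
    by (metis nle_le)
qed

section \<open>Locality of the islands\<close>

text \<open>Walking inside \<open>S\<close> by steps of length at most \<open>\<omega>\<close> never
  leaves the cube of radius \<open>\<beta>\<close> around a centre. This bounds clusters without
  naming components, and cubes may overlap.\<close>

definition clustered :: "int \<Rightarrow> int \<Rightarrow> (int ^ 'd) set \<Rightarrow> bool" where
  "clustered \<beta> \<omega> S \<longleftrightarrow> (\<exists>Cn. (\<forall>u\<in>S. \<exists>c\<in>Cn. near \<beta> c u) \<and>
     (\<forall>u\<in>S. \<forall>v\<in>S. \<forall>c\<in>Cn. near \<omega> u v \<longrightarrow> near \<beta> c u \<longrightarrow> near \<beta> c v))"

definition agree :: "int ^ 'd \<Rightarrow> int \<Rightarrow> int ^ 'd \<Rightarrow> (int ^ 'd) set \<Rightarrow> (int ^ 'd) set \<Rightarrow> bool" where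
  "agree t s v S S' \<longleftrightarrow> (\<forall>w. near s v w \<longrightarrow> (w \<in> S \<longleftrightarrow> t + w \<in> S'))"

lemma near_add_iff: "near s (t + v) w \<longleftrightarrow> near s v (w - t)"
  using near_translate[of s t v "w - t"] by simp

lemma agree_sym: "agree t s v S S' \<Longrightarrow> agree (- t) s (t + v) S' S"
  unfolding agree_def near_add_iff by (metis add.commute diff_add_cancel uminus_add_conv_diff)

lemma agree_mono: "agree t s v S S' \<Longrightarrow> s' \<le> s \<Longrightarrow> agree t s' v S S'"
  unfolding agree_def using near_mono by blast

lemma agree_Un: "agree t s v S S' \<Longrightarrow> agree t s v T T' \<Longrightarrow> agree t s v (S \<union> T) (S' \<union> T')"
  unfolding agree_def by blast

lemma finite_near:
  fixes v :: "int ^ 'd::finite"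
  shows "finite {w. near s v w}"
proof -
  have "finite ((\<lambda>f. \<chi> i. f i) ` (PiE UNIV (\<lambda>i. {v $ i - s..v $ i + s})))"
    by (intro finite_imageI finite_PiE) auto
  moreover have "{w. near s v w} \<subseteq> (\<lambda>f. \<chi> i. f i) ` (PiE UNIV (\<lambda>i. {v $ i - s..v $ i + s}))"
  proof
    fix w assume "w \<in> {w. near s v w}"
    then have "\<bar>v $ i - w $ i\<bar> \<le> s" for i by (simp add: near_def)
    then have "v $ i - s \<le> w $ i \<and> w $ i \<le> v $ i + s" for i by (metis abs_diff_le_iff abs_minus_commute)
    then have "($) w \<in> PiE UNIV (\<lambda>i. {v $ i - s..v $ i + s})" by auto
    then show "w \<in> (\<lambda>f. \<chi> i. f i) ` (PiE UNIV (\<lambda>i. {v $ i - s..v $ i + s}))"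
      by (rule rev_image_eqI) (simp add: vec_eq_iff)
  qed
  ultimately show ?thesis by (rule finite_subset[rotated])
qed

text \<open>\<open>D k\<close> bounds the chains inside the islands below level \<open>k\<close>,
  \<open>W k\<close> is the wall width, and \<open>loc k\<close> is the margin that determines
  \<open>Y U k\<close>. The constants leave slack in the two closing estimates
  \<open>2 * (10 + D k) + (D k + 14) \<le> W k\<close> and
  \<open>2 * (b k + 2 * D k + 17) \<le> D (Suc k)\<close>.\<close>

locale scales =
  fixes b D W loc :: "nat \<Rightarrow> int"
  assumes b: "\<And>k. 0 \<le> b k" and D0: "D 0 = 0" and D: "\<And>k. D (Suc k) = 2 * b k + 4 * D k + 40"
    and W: "\<And>k. W k = 3 * D k + 50"
    and loc0: "loc 0 = 0" and loc: "\<And>k. loc (Suc k) = loc k + 3 + 2 * (b k + 7 + D k)"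
begin

lemma D_nonneg: "0 \<le> D k"
  by (induction k) (use b in \<open>auto simp: D0 D\<close>)

lemma loc_nonneg: "0 \<le> loc k"
  by (induction k) (use b D_nonneg in \<open>auto simp: loc0 loc\<close>)

definition adm :: "(nat \<Rightarrow> (int ^ 'd) set) \<Rightarrow> bool" where
  "adm U \<longleftrightarrow> (\<forall>k. clustered (b k) (W k) (U k))"

definition bounded_links :: "(nat \<Rightarrow> (int ^ 'd) set) \<Rightarrow> nat \<Rightarrow> bool" where
  "bounded_links U k \<longleftrightarrow> (\<forall>u v. (u, v) \<in> (link (Y U k))\<^sup>* \<longrightarrow> near (D k) u v)"

text \<open>Chains leaving \<open>U k\<close> return to it within distance \<open>W k\<close>, hence never leave
  the cluster around the centre \<open>c\<close>.\<close>

lemma chain_in_cluster: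
  assumes bl: "bounded_links U k"
    and cl: "\<forall>u\<in>U k. \<forall>v\<in>U k. near (W k) u v \<longrightarrow> near (b k) c u \<longrightarrow> near (b k) c v"
    and a: "a \<in> U k" "near (b k) c a" and ch: "(a, v) \<in> (link (Y U k \<union> U k))\<^sup>*"
  shows "\<exists>a'\<in>U k. near (b k) c a' \<and> near (7 + D k) a' v"
proof -
  \<comment> \<open>Invariant along the chain: the current point is in the cluster, or it hangs off
    a cluster point by an excursion through lower islands, whose length is at most
    \<open>7 + D k\<close>.\<close>
  have "\<exists>a'\<in>U k. near (b k) c a' \<and>
      (v = a' \<or> (\<exists>z\<in>Y U k. near 7 a' z \<and> (z, v) \<in> (link (Y U k))\<^sup>*))"
    using ch
  proof (induction rule: rtrancl_induct)
    case base
    then show ?case using a by blast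
  next
    case (step v v')
    obtain a' where a': "a' \<in> U k" "near (b k) c a'"
      and v: "v = a' \<or> (\<exists>z\<in>Y U k. near 7 a' z \<and> (z, v) \<in> (link (Y U k))\<^sup>*)"
      using step.IH by blast
    have v': "v' \<in> Y U k \<union> U k" "near 7 v v'" using step.hyps(2) by (auto simp: link_def)
    have av: "near (7 + D k) a' v"
      using v
    proof
      assume "v = a'"
      then show ?thesis using D_nonneg[of k] by simp
    next
      assume "\<exists>z\<in>Y U k. near 7 a' z \<and> (z, v) \<in> (link (Y U k))\<^sup>*"
      then show ?thesis using bl near_trans unfolding bounded_links_def by blast
    qed
    show ?case
    proof (cases "v' \<in> U k")
      case True
      have "near (W k) a' v'"
        using near_mono[OF near_trans[OF av v'(2)]] D_nonneg[of k] by (simp add: W)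
      then show ?thesis using cl a' True by blast
    next
      case False
      then have Y: "v' \<in> Y U k" using v' by blast
      have "near 7 a' v' \<and> (v', v') \<in> (link (Y U k))\<^sup>*" if "v = a'" using that v' by simp
      moreover have "(z, v') \<in> (link (Y U k))\<^sup>*" if "z \<in> Y U k" "(z, v) \<in> (link (Y U k))\<^sup>*" for z
      proof -
        have "v \<in> Y U k" using link_in[OF that(2) that(1)] .
        then have "(v, v') \<in> link (Y U k)" using Y v'(2) by (simp add: link_def)
        then show ?thesis using that(2) by simp
      qed
      ultimately show ?thesis using v a' Y by blast
    qed
  qed
  then obtain a' where a': "a' \<in> U k" "near (b k) c a'"
    and "v = a' \<or> (\<exists>z\<in>Y U k. near 7 a' z \<and> (z, v) \<in> (link (Y U k))\<^sup>*)" by blast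
  moreover from this(3) have "near (7 + D k) a' v"
  proof
    assume "v = a'"
    then show ?thesis using D_nonneg[of k] by simp
  next
    assume "\<exists>z\<in>Y U k. near 7 a' z \<and> (z, v) \<in> (link (Y U k))\<^sup>*"
    then show ?thesis using bl near_trans unfolding bounded_links_def by blast
  qed
  ultimately show ?thesis by blast
qed

text \<open>A chain that meets the new islands returns to them after excursions of length at most
  \<open>D k + 14\<close>. As points of new islands are within \<open>10 + D k\<close> of
  \<open>U k\<close>, consecutive visits belong to cluster points at distance at most
  \<open>W k\<close>, hence to one cluster.\<close>

lemma bounded_links_Suc:
  assumes bl: "bounded_links U k" and cl: "clustered (b k) (W k) (U k)"
  shows "bounded_links U (Suc k)"
proof -
  obtain Cn where c1: "\<And>u. u \<in> U k \<Longrightarrow> \<exists>c\<in>Cn. near (b k) c u"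
    and c2: "\<And>u v c. u \<in> U k \<Longrightarrow> v \<in> U k \<Longrightarrow> c \<in> Cn \<Longrightarrow> near (W k) u v \<Longrightarrow> near (b k) c u \<Longrightarrow> near (b k) c v"
    using cl unfolding clustered_def by blast
  define G where "G = (\<Union>u\<in>U k. island U k u)"
  have YG: "Y U (Suc k) = Y U k \<union> G" by (simp add: Y_Suc G_def)
  define Gc where "Gc = (\<lambda>c p. \<exists>a\<in>U k. near (b k) c a \<and> near (10 + D k) a p)"
  have G1: "\<exists>a\<in>U k. near (10 + D k) a p \<and> (\<exists>c\<in>Cn. near (b k) c a)" if p: "p \<in> G" for p
  proof -
    obtain u q where u: "u \<in> U k" "(u, q) \<in> (link (Y U k \<union> U k))\<^sup>*" "near 3 q p"
      using p by (auto simp: G_def island_def)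
    obtain c where c: "c \<in> Cn" "near (b k) c u" using c1[OF u(1)] by blast
    obtain a where a: "a \<in> U k" "near (b k) c a" "near (7 + D k) a q"
    proof -
      have "\<forall>u\<in>U k. \<forall>v\<in>U k. near (W k) u v \<longrightarrow> near (b k) c u \<longrightarrow> near (b k) c v" using c2 c(1) by blast
      from chain_in_cluster[OF bl this u(1) c(2) u(2)] show ?thesis using that by blast
    qed
    have "near (7 + D k + 3) a p" by (rule near_trans[OF a(3) u(3)])
    then show ?thesis using a c by (auto simp: add.commute add.left_commute)
  qed
  have G2: "Gc c p'" if c: "c \<in> Cn" and p: "Gc c p" "p' \<in> G" "near (D k + 14) p p'" for c p p'
  proof -
    obtain a where a: "a \<in> U k" "near (b k) c a" "near (10 + D k) a p" using p by (auto simp: Gc_def)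
    obtain a' where a': "a' \<in> U k" "near (10 + D k) a' p'" using G1[OF p(2)] by blast
    have "near (10 + D k + (D k + 14) + (10 + D k)) a a'"
      using near_trans[OF near_trans[OF a(3) p(3)]] a'(2) near_sym by blast
    then have "near (W k) a a'" by (rule near_mono) (simp add: W)
    then show ?thesis using c2[OF a(1) a'(1) c _ a(2)] a' by (auto simp: Gc_def)
  qed
  have reach: "near (b k + 2 * D k + 17) c v"
    if c: "c \<in> Cn" and p: "Gc c p" "p \<in> G" and ch: "(p, v) \<in> (link (Y U k \<union> G))\<^sup>*" for c p v
  proof -
    have "(v \<in> G \<and> Gc c v) \<or> (\<exists>p'. Gc c p' \<and> (\<exists>z\<in>Y U k. near 7 p' z \<and> (z, v) \<in> (link (Y U k))\<^sup>*))"
      using ch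
    proof (induction rule: rtrancl_induct)
      case base
      then show ?case using p by blast
    next
      case (step v v')
      have v': "v' \<in> Y U k \<union> G" "near 7 v v'" using step.hyps(2) by (auto simp: link_def)
      from step.IH show ?case
      proof
        assume v: "v \<in> G \<and> Gc c v"
        show ?thesis
        proof (cases "v' \<in> G")
          case True
          have "near (D k + 14) v v'" using v'(2) D_nonneg[of k] by (auto elim: near_mono)
          then show ?thesis using G2[OF c _ True] v True by blast
        next
          case False
          then show ?thesis using v v' by blast
        qed
      next
        assume "\<exists>p'. Gc c p' \<and> (\<exists>z\<in>Y U k. near 7 p' z \<and> (z, v) \<in> (link (Y U k))\<^sup>*)"
        then obtain p' z where p': "Gc c p'" "z \<in> Y U k" "near 7 p' z" "(z, v) \<in> (link (Y U k))\<^sup>*" by blast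
        have zv: "near (D k) z v" using bl p'(4) unfolding bounded_links_def by blast
        show ?thesis
        proof (cases "v' \<in> G")
          case True
          have "near (7 + D k + 7) p' v'" using near_trans[OF near_trans[OF p'(3) zv] v'(2)] .
          then have "near (D k + 14) p' v'" by (rule near_mono) simp
          then show ?thesis using G2[OF c p'(1) True] True by blast
        next
          case False
          then have "v' \<in> Y U k" using v' by blast
          moreover have "v \<in> Y U k" using link_in[OF p'(4,2)] .
          ultimately have "(v, v') \<in> link (Y U k)" using v'(2) by (simp add: link_def)
          then have "(z, v') \<in> (link (Y U k))\<^sup>*" using p'(4) by simp
          then show ?thesis using p' by blast
        qed
      qed
    qed
    then show ?thesis
    proof
      assume "v \<in> G \<and> Gc c v"
      then obtain a where "near (b k) c a" "near (10 + D k) a v" by (auto simp: Gc_def)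
      then have "near (b k + (10 + D k)) c v" by (rule near_trans)
      then show ?thesis using D_nonneg[of k] by (auto elim: near_mono)
    next
      assume "\<exists>p'. Gc c p' \<and> (\<exists>z\<in>Y U k. near 7 p' z \<and> (z, v) \<in> (link (Y U k))\<^sup>*)"
      then obtain p' z a where "near (b k) c a" "near (10 + D k) a p'" "near 7 p' z" "near (D k) z v"
        using bl unfolding bounded_links_def Gc_def by blast
      then have "near (b k + (10 + D k) + 7 + D k) c v" by (blast intro: near_trans)
      then show ?thesis by (rule near_mono) simp
    qed
  qed
  \<comment> \<open>A chain either avoids the new islands or has a point \<open>p\<close> in one of
    them. In the second case both ends are measured from the centre belonging to \<open>p\<close>,
    which gives twice the radius.\<close>
  have split: "(u, v) \<in> (link (Y U k))\<^sup>* \<or>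
      (\<exists>p\<in>G. (p, u) \<in> (link (Y U k \<union> G))\<^sup>* \<and> (p, v) \<in> (link (Y U k \<union> G))\<^sup>*)"
    if "(u, v) \<in> (link (Y U k \<union> G))\<^sup>*" for u v
    using that
  proof (induction rule: rtrancl_induct)
    case (step v v')
    have st: "v \<in> Y U k \<union> G" "v' \<in> Y U k \<union> G" "near 7 v v'" using step.hyps(2) by (auto simp: link_def)
    show ?case
    proof (cases "v \<in> G \<or> v' \<in> G")
      case True
      have uv: "(v, u) \<in> (link (Y U k \<union> G))\<^sup>*" using link_sym[OF step.hyps(1)] .
      have vv: "(v, v') \<in> (link (Y U k \<union> G))\<^sup>*" using step.hyps(2) by blast
      show ?thesis using True
      proof
        assume "v \<in> G"
        then show ?thesis using uv vv by blast
      next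
        assume "v' \<in> G"
        moreover have "(v', u) \<in> (link (Y U k \<union> G))\<^sup>*" using link_sym[OF vv] uv by (rule rtrancl_trans)
        ultimately show ?thesis by blast
      qed
    next
      case False
      then have "(v, v') \<in> link (Y U k)" using st by (auto simp: link_def)
      then show ?thesis using step.IH step.hyps(2) by (meson rtrancl.rtrancl_into_rtrancl)
    qed
  qed simp
  show ?thesis
    unfolding bounded_links_def YG
  proof (intro allI impI)
    fix u v assume "(u, v) \<in> (link (Y U k \<union> G))\<^sup>*"
    from split[OF this] show "near (D (Suc k)) u v"
    proof
      assume "(u, v) \<in> (link (Y U k))\<^sup>*"
      then have "near (D k) u v" using bl by (simp add: bounded_links_def)
      then show ?thesis by (rule near_mono) (use D_nonneg[of k] b[of k] in \<open>simp add: D\<close>)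
    next
      assume "\<exists>p\<in>G. (p, u) \<in> (link (Y U k \<union> G))\<^sup>* \<and> (p, v) \<in> (link (Y U k \<union> G))\<^sup>*"
      then obtain p where p: "p \<in> G" "(p, u) \<in> (link (Y U k \<union> G))\<^sup>*" "(p, v) \<in> (link (Y U k \<union> G))\<^sup>*" by blast
      obtain a c where "a \<in> U k" "near (10 + D k) a p" "c \<in> Cn" "near (b k) c a" using G1[OF p(1)] by blast
      then have c: "c \<in> Cn" "Gc c p" by (auto simp: Gc_def)
      have "near (b k + 2 * D k + 17) c u" "near (b k + 2 * D k + 17) c v" using reach[OF c p(1)] p by blast+
      then have "near (b k + 2 * D k + 17 + (b k + 2 * D k + 17)) u v" using near_sym near_trans by blast
      then show ?thesis by (rule near_mono) (simp add: D)
    qed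
  qed
qed

lemma bounded_links:
  fixes U :: "nat \<Rightarrow> (int ^ 'd) set"
  shows "adm U \<Longrightarrow> bounded_links U k"
proof (induction k)
  case 0
  have "u = v" if "(u, v) \<in> (link {})\<^sup>*" for u v :: "int ^ 'd"
    using that by (cases rule: rtranclE) (auto simp: link_def)
  then have "near 0 u v" if "(u, v) \<in> (link {})\<^sup>*" for u v :: "int ^ 'd"
    using that by fastforce
  then show ?case by (simp add: bounded_links_def D0)
next
  case (Suc k)
  then show ?case by (intro bounded_links_Suc) (auto simp: adm_def)
qed

section \<open>Locality: islands are determined by a bounded window\<close>

definition \<Delta> :: "nat \<Rightarrow> int" where
  "\<Delta> k = 2 * (b k + 7 + D k)"

lemma \<Delta>_nonneg: "0 \<le> \<Delta> k"
  using b[of k] D_nonneg[of k] by (simp add: \<Delta>_def)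

lemma component_diameter:
  assumes "adm U" "u \<in> U k" "(u, p) \<in> (link (Y U k \<union> U k))\<^sup>*" "(u, q) \<in> (link (Y U k \<union> U k))\<^sup>*"
  shows "near (\<Delta> k) p q"
proof -
  have "clustered (b k) (W k) (U k)" using assms(1) by (simp add: adm_def)
  then obtain Cn where c1: "\<And>u. u \<in> U k \<Longrightarrow> \<exists>c\<in>Cn. near (b k) c u"
    and c2: "\<And>u v c. u \<in> U k \<Longrightarrow> v \<in> U k \<Longrightarrow> c \<in> Cn \<Longrightarrow> near (W k) u v \<Longrightarrow> near (b k) c u \<Longrightarrow> near (b k) c v"
    unfolding clustered_def by blast
  obtain c where c: "c \<in> Cn" "near (b k) c u" using c1[OF assms(2)] by blast
  have "near (b k + (7 + D k)) c x" if "(u, x) \<in> (link (Y U k \<union> U k))\<^sup>*" for x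
  proof -
    have "\<forall>u\<in>U k. \<forall>v\<in>U k. near (W k) u v \<longrightarrow> near (b k) c u \<longrightarrow> near (b k) c v" using c2 c(1) by blast
    from chain_in_cluster[OF bounded_links[OF assms(1)] this assms(2) c(2) that]
    show ?thesis using near_trans by blast
  qed
  then have "near (b k + (7 + D k) + (b k + (7 + D k))) p q" using assms(3,4) near_sym near_trans by blast
  then show ?thesis by (simp add: \<Delta>_def add.commute add.left_commute add.assoc)
qed

text \<open>The whole chain lies in one component, hence within \<open>\<Delta> k\<close> of its
  end, and agreement of the sets on that window copies it.\<close>

lemma chain_transfer:
  assumes adm: "adm U" and u: "u \<in> U k" and ch: "(u, q) \<in> (link (Y U k \<union> U k))\<^sup>*"
    and ag: "agree t (s + \<Delta> k) v (Y U k \<union> U k) (Y U' k \<union> U' k)" and q: "near s v q"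
  shows "(t + u, t + q) \<in> (link (Y U' k \<union> U' k))\<^sup>*"
proof -
  let ?S = "Y U k \<union> U k"
  have in': "t + p \<in> Y U' k \<union> U' k" if "(u, p) \<in> (link ?S)\<^sup>*" for p
  proof -
    have "near (s + \<Delta> k) v p" using near_trans[OF q component_diameter[OF adm u ch that]] .
    moreover have "p \<in> ?S" using link_in[OF that] u by blast
    ultimately show ?thesis using ag by (simp add: agree_def)
  qed
  show ?thesis using ch
  proof (induction rule: rtrancl_induct)
    case (step p p')
    have "near 7 p p'" using step.hyps(2) by (auto simp: link_def)
    moreover have "(u, p') \<in> (link ?S)\<^sup>*" using step.hyps by simp
    ultimately have "(t + p, t + p') \<in> link (Y U' k \<union> U' k)"
      using in'[of p] in'[of p'] step.hyps(1) by (simp add: link_def)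
    then show ?case using step.IH by simp
  qed simp
qed

lemma island_transfer:
  assumes adm: "adm U" and ag: "agree t (s + 3 + \<Delta> k) v (Y U k \<union> U k) (Y U' k \<union> U' k)"
    and agU: "agree t (s + 3 + \<Delta> k) v (U k) (U' k)"
    and u: "u \<in> U k" and w: "w \<in> island U k u" "near s v w"
  shows "t + u \<in> U' k" "t + w \<in> island U' k (t + u)"
proof -
  obtain q where q: "(u, q) \<in> (link (Y U k \<union> U k))\<^sup>*" "near 3 q w" using w by (auto simp: island_def)
  have vq: "near (s + 3) v q" using near_trans[OF w(2)] q(2) near_sym by blast
  have "(t + u, t + q) \<in> (link (Y U' k \<union> U' k))\<^sup>*"
    by (rule chain_transfer[OF adm u q(1) ag vq])
  then show "t + w \<in> island U' k (t + u)" using q(2) unfolding island_def by (auto simp del: near_add_iff)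
  have "near (s + 3 + \<Delta> k) v u" using near_trans[OF vq] component_diameter[OF adm u q(1)] by blast
  then show "t + u \<in> U' k" using agU u by (simp add: agree_def)
qed

text \<open>Each level widens the window by 3 for the thickening and by \<open>\<Delta> k\<close>
  for the component. The converse inclusion is the same argument with \<open>- t\<close>.\<close>

lemma Y_local:
  assumes "adm U" "adm U'" "\<And>j. j < k \<Longrightarrow> agree t (s + loc k) v (U j) (U' j)"
  shows "agree t s v (Y U k) (Y U' k)"
  using assms(3)
proof (induction k arbitrary: s)
  case 0
  then show ?case by (simp add: agree_def)
next
  case (Suc k)
  have ag: "agree t (s + 3 + \<Delta> k) v (Y U k) (Y U' k)"
  proof (rule Suc.IH)
    fix j assume "j < k"
    then show "agree t (s + 3 + \<Delta> k + loc k) v (U j) (U' j)"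
      using Suc.prems[of j] by (simp add: loc \<Delta>_def add_ac)
  qed
  have agU: "agree t (s + 3 + \<Delta> k) v (U k) (U' k)"
    by (rule agree_mono[OF Suc.prems[of k]]) (use loc_nonneg[of k] in \<open>auto simp: loc \<Delta>_def\<close>)
  note agS = agree_Un[OF ag agU]
  have ag0: "agree t s v (Y U k) (Y U' k)" using ag by (rule agree_mono) (use \<Delta>_nonneg[of k] in simp)
  show ?case unfolding agree_def Y_Suc
  proof (intro allI impI)
    fix w assume w: "near s v w"
    have 1: "w \<in> (\<Union>u\<in>U k. island U k u) \<Longrightarrow> t + w \<in> (\<Union>u\<in>U' k. island U' k u)"
      using island_transfer[OF assms(1) agS agU _ _ w] by blast
    have "- t + (t + w) \<in> (\<Union>u\<in>U k. island U k u)" if h: "t + w \<in> (\<Union>u\<in>U' k. island U' k u)"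
    proof -
      have "near s (t + v) (t + w)" using w by simp
      then show ?thesis using island_transfer[OF assms(2) agree_sym[OF agS] agree_sym[OF agU]] h by blast
    qed
    then have 2: "t + w \<in> (\<Union>u\<in>U' k. island U' k u) \<Longrightarrow> w \<in> (\<Union>u\<in>U k. island U k u)" by simp
    have 3: "w \<in> Y U k \<longleftrightarrow> t + w \<in> Y U' k" using ag0 w by (simp add: agree_def)
    show "w \<in> Y U k \<union> (\<Union>u\<in>U k. island U k u) \<longleftrightarrow> t + w \<in> Y U' k \<union> (\<Union>u\<in>U' k. island U' k u)"
      using 1 2 3 by blast
  qed
qed

lemma isle_near:
  assumes "adm U" "w \<in> isle U k v"
  shows "near (\<Delta> k + 6) v w"
proof -
  obtain u where u: "u \<in> U k" "v \<in> island U k u" "w \<in> island U k u" using assms(2) by (auto simp: isle_def)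
  then obtain q q' where q: "(u, q) \<in> (link (Y U k \<union> U k))\<^sup>*" "near 3 q v"
    and q': "(u, q') \<in> (link (Y U k \<union> U k))\<^sup>*" "near 3 q' w"
    by (auto simp: island_def)
  have "near 3 v q" using q(2) near_sym by blast
  from near_trans[OF near_trans[OF this component_diameter[OF assms(1) u(1) q(1) q'(1)]] q'(2)]
  have "near (3 + \<Delta> k + 3) v w" .
  then show ?thesis by (simp add: add.commute)
qed

lemma isle_finite:
  fixes U :: "nat \<Rightarrow> (int ^ 'd::finite) set"
  shows "adm U \<Longrightarrow> finite (isle U k v)"
  by (rule finite_subset[OF _ finite_near[of "\<Delta> k + 6" v]]) (use isle_near in auto)

lemma isle_local_half:
  assumes adm: "adm U" "adm U'" and ag: "\<And>j. j \<le> k \<Longrightarrow> agree t R v (U j) (U' j)"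
    and R: "2 * \<Delta> k + 9 + loc k \<le> R" and w: "w \<in> isle U k v"
  shows "t + w \<in> isle U' k (t + v)"
proof -
  \<comment> \<open>The island of \<open>v\<close> stays within \<open>\<Delta> k + 6\<close>;
    deciding membership of its points takes another \<open>3 + \<Delta> k\<close>, and
    \<open>loc k\<close> for the lower levels.\<close>
  let ?s = "\<Delta> k + 6"
  have "agree t (?s + 3 + \<Delta> k) v (Y U k) (Y U' k)"
  proof (rule Y_local[OF adm])
    fix j assume "j < k"
    then show "agree t (?s + 3 + \<Delta> k + loc k) v (U j) (U' j)" using R by (intro agree_mono[OF ag]) auto
  qed
  moreover have agU: "agree t (?s + 3 + \<Delta> k) v (U k) (U' k)"
    using R loc_nonneg[of k] by (intro agree_mono[OF ag]) auto
  ultimately have agS: "agree t (?s + 3 + \<Delta> k) v (Y U k \<union> U k) (Y U' k \<union> U' k)" by (rule agree_Un)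
  obtain u where u: "u \<in> U k" "v \<in> island U k u" "w \<in> island U k u" using w by (auto simp: isle_def)
  have "near ?s v v" "near ?s v w" using isle_near[OF adm(1) w] \<Delta>_nonneg[of k] by auto
  then have "t + u \<in> U' k" "t + v \<in> island U' k (t + u)" "t + w \<in> island U' k (t + u)"
    using island_transfer[OF adm(1) agS agU u(1)] u by blast+
  then show ?thesis by (auto simp: isle_def)
qed

lemma isle_local:
  assumes adm: "adm U" "adm U'" and ag: "\<And>j. j \<le> k \<Longrightarrow> agree t R v (U j) (U' j)"
    and R: "2 * \<Delta> k + 9 + loc k \<le> R"
  shows "isle U' k (t + v) = (+) t ` isle U k v"
proof
  show "(+) t ` isle U k v \<subseteq> isle U' k (t + v)"
    using isle_local_half[OF adm ag R] by blast
  have ag': "agree (- t) R (t + v) (U' j) (U j)" if "j \<le> k" for j using agree_sym[OF ag[OF that]] .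
  have "- t + w \<in> isle U k v" if "w \<in> isle U' k (t + v)" for w
    using isle_local_half[OF adm(2,1) ag' R that] by simp
  moreover have "w = t + (- t + w)" for w by simp
  ultimately show "isle U' k (t + v) \<subseteq> (+) t ` isle U k v" by blast
qed

lemma depth_translate: "depth ((+) t ` E) (t + v) = depth E v"
proof -
  have m: "t + w \<in> (+) t ` E \<longleftrightarrow> w \<in> E" for w by auto
  have "(\<forall>z. near s (t + v) z \<longrightarrow> z \<in> (+) t ` E) \<longleftrightarrow> (\<forall>z. near s v z \<longrightarrow> z \<in> E)" (is "?L = ?R") for s
  proof
    assume L: ?L
    show ?R
    proof (intro allI impI)
      fix z assume "near s v z"
      then have "near s (t + v) (t + z)" by simp
      then show "z \<in> E" using L m by blast
    qed
  next
    assume R: ?R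
    show ?L
    proof (intro allI impI)
      fix z assume "near s (t + v) z"
      then have "near s v (z - t)" by (simp add: near_add_iff)
      then have "t + (z - t) \<in> (+) t ` E" using R by blast
      then show "z \<in> (+) t ` E" by simp
    qed
  qed
  then show ?thesis using m[of v] by (simp add: depth_def)
qed

text \<open>This justifies stopping in a cluster of level \<open>k\<close>: there \<open>v\<close>
  is deep in its island of level \<open>k\<close>, so either its smallest island already decides the
  colour or the second one has level at most \<open>k\<close>. Higher levels have no
  influence.\<close>

lemma colour_local:
  fixes U U' :: "nat \<Rightarrow> (int ^ 'd::finite) set"
  assumes adm: "adm U" "adm U'" and ag: "\<And>j. j \<le> k \<Longrightarrow> agree t R v (U j) (U' j)"
    and R: "\<And>j. j \<le> k \<Longrightarrow> 2 * \<Delta> j + 9 + loc j \<le> R" and v: "v \<in> U k"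
  shows "colour U' (t + v) = colour U v"
proof -
  have eq: "isle U' j (t + v) = (+) t ` isle U j v" if "j \<le> k" for j
    by (rule isle_local[OF adm, where R = R]) (use ag R that in auto)
  then have mem: "t + v \<in> isle U' j (t + v) \<longleftrightarrow> v \<in> isle U j v" if "j \<le> k" for j
    using that by auto
  have pe: "par (isle U' j (t + v)) (t + v) = par (isle U j v) v" if "j \<le> k" "v \<in> isle U j v" for j
    unfolding eq[OF that(1)] using that(2) isle_finite[OF adm(1)] by (intro par_translate) auto
  have de: "depth (isle U' j (t + v)) (t + v) = depth (isle U j v) v" if "j \<le> k" for j
    unfolding eq[OF that] by (rule depth_translate)
  have vk: "v \<in> isle U k v" using isle_deep[of v U k v] v by simp
  define i where "i = (LEAST j. v \<in> isle U j v)"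
  have i: "v \<in> isle U i v" "i \<le> k" unfolding i_def using vk by (rule LeastI, rule Least_le)
  have i_min: "v \<notin> isle U j v" if "j < i" for j using that not_less_Least unfolding i_def by blast
  have i': "t + v \<in> isle U' i (t + v)" using mem[OF i(2)] i(1) by simp
  have i'_min: "t + v \<notin> isle U' j (t + v)" if "j < i" for j using mem[of j] i_min[OF that] that i(2) by simp
  show ?thesis
  proof (cases "depth (isle U i v) v = 3")
    case True
    then have True': "depth (isle U' i (t + v)) (t + v) = 3" using de[OF i(2)] by simp
    show ?thesis
      using colour_deep[OF i(1) i_min True] colour_deep[OF i' i'_min True'] pe[OF i(2,1)] by simp
  next
    case False
    have "depth (isle U k v) v = 3"
      using isle_deep[of v U k] v near_mono[of 2 v _ 3] by (auto simp: depth_def)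
    then have ik: "i < k" using False i(2) by (metis order_le_less)
    define j where "j = (LEAST j. i < j \<and> v \<in> isle U j v)"
    have ex: "i < k \<and> v \<in> isle U k v" using ik vk by simp
    have j: "i < j" "v \<in> isle U j v" using LeastI[of "\<lambda>j. i < j \<and> v \<in> isle U j v", OF ex] by (auto simp: j_def)
    have jk: "j \<le> k" unfolding j_def using ex by (rule Least_le)
    have j_min: "v \<notin> isle U l v" if "i < l" "l < j" for l using that not_less_Least unfolding j_def by blast
    have j': "t + v \<in> isle U' j (t + v)" using mem[OF jk] j(2) by simp
    have j'_min: "t + v \<notin> isle U' l (t + v)" if "i < l" "l < j" for l
      using mem[of l] j_min[OF that] that jk by simp
    show ?thesis
      using colour_two[OF i(1) i_min j j_min] colour_two[OF i' i'_min j(1) j' j'_min]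
        pe[OF i(2,1)] pe[OF jk j(2)] de[OF i(2)] by simp
  qed
qed

end

section \<open>The island algorithm\<close>

text \<open>Cubes of radius \<open>\<beta>\<close> with walls reaching \<open>\<omega>\<close> to
  either side: a point must be clear of the wall of every centre and inside the cube of at least
  one.\<close>

definition base :: "int \<Rightarrow> int \<Rightarrow> (int ^ 'd) set \<Rightarrow> (int ^ 'd) set" where
  "base \<beta> \<omega> Cn = {v. (\<exists>c\<in>Cn. near (\<beta> - \<omega>) c v) \<and> (\<forall>c\<in>Cn. near (\<beta> - \<omega>) c v \<or> \<not> near (\<beta> + \<omega>) c v)}"

lemma clustered_base:
  assumes "0 \<le> \<omega>"
  shows "clustered \<beta> \<omega> (base \<beta> \<omega> Cn)"
  unfolding clustered_def
proof (intro exI[of _ Cn] conjI ballI impI)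
  fix u assume "u \<in> base \<beta> \<omega> Cn"
  then obtain c where "c \<in> Cn" "near (\<beta> - \<omega>) c u" by (auto simp: base_def)
  moreover from this(2) have "near \<beta> c u" by (rule near_mono) (use assms in simp)
  ultimately show "\<exists>c\<in>Cn. near \<beta> c u" by blast
next
  fix u v c assume v: "v \<in> base \<beta> \<omega> Cn" and c: "c \<in> Cn" and n: "near \<omega> u v" "near \<beta> c u"
  have "near (\<beta> + \<omega>) c v" by (rule near_trans[OF n(2,1)])
  then have "near (\<beta> - \<omega>) c v" using v c by (auto simp: base_def)
  then show "near \<beta> c v" by (rule near_mono) (use assms in simp)
qed

lemma base_cong:
  assumes om: "0 \<le> \<omega>" and eq: "\<And>c. near (\<beta> + \<omega>) c v \<Longrightarrow> c \<in> Cn \<longleftrightarrow> t + c \<in> Cn'"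
  shows "v \<in> base \<beta> \<omega> Cn \<longleftrightarrow> t + v \<in> base \<beta> \<omega> Cn'"
proof -
  have m: "near (\<beta> - \<omega>) c w \<Longrightarrow> near (\<beta> + \<omega>) c w" for c w :: "int ^ 'a"
    by (erule near_mono) (use om in simp)
  have tr: "near s c (t + v) \<longleftrightarrow> near s (c - t) v" for s c
    by (metis near_sym near_add_iff)
  have eq': "c \<in> Cn' \<longleftrightarrow> c - t \<in> Cn" if "near (\<beta> + \<omega>) c (t + v)" for c
    using eq[of "c - t"] that by (simp add: tr)
  have 1: "(\<exists>c\<in>Cn. near (\<beta> - \<omega>) c v) \<longleftrightarrow> (\<exists>c\<in>Cn'. near (\<beta> - \<omega>) c (t + v))"
  proof
    assume "\<exists>c\<in>Cn. near (\<beta> - \<omega>) c v"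
    then obtain c where "c \<in> Cn" "near (\<beta> - \<omega>) c v" by blast
    then show "\<exists>c\<in>Cn'. near (\<beta> - \<omega>) c (t + v)" using eq m by (intro bexI[of _ "t + c"]) auto
  next
    assume "\<exists>c\<in>Cn'. near (\<beta> - \<omega>) c (t + v)"
    then obtain c where "c \<in> Cn'" "near (\<beta> - \<omega>) c (t + v)" by blast
    then show "\<exists>c\<in>Cn. near (\<beta> - \<omega>) c v" using eq' m tr by (intro bexI[of _ "c - t"]) auto
  qed
  have 2: "(\<forall>c\<in>Cn. near (\<beta> - \<omega>) c v \<or> \<not> near (\<beta> + \<omega>) c v) \<longleftrightarrow>
     (\<forall>c\<in>Cn'. near (\<beta> - \<omega>) c (t + v) \<or> \<not> near (\<beta> + \<omega>) c (t + v))" (is "?L \<longleftrightarrow> ?R")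
  proof
    assume ?L
    then show ?R using eq' tr by blast
  next
    assume R: ?R
    show ?L
    proof
      fix c assume "c \<in> Cn"
      then show "near (\<beta> - \<omega>) c v \<or> \<not> near (\<beta> + \<omega>) c v"
        using R eq[of c] by (cases "near (\<beta> + \<omega>) c v") auto
    qed
  qed
  show ?thesis unfolding base_def using 1 2 by blast
qed

lemma grid_ball_supset:
  fixes w :: "int ^ 'd::finite"
  assumes "near (int s) 0 w"
  shows "w \<in> grid_ball 0 (CARD('d) * s)"
proof -
  have path: "(v, v + w) \<in> grid_adj ^^ n" if "(\<Sum>i\<in>UNIV. \<bar>w $ i\<bar>) = int n" for n and v w :: "int ^ 'd"
    using that
  proof (induction n arbitrary: w)
    case 0
    then have "w $ i = 0" for i by (simp add: sum_nonneg_eq_0_iff)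
    then have "w = 0" by (simp add: vec_eq_iff)
    then show ?case by simp
  next
    case (Suc n)
    have "\<exists>i. w $ i \<noteq> 0"
    proof (rule ccontr)
      assume "\<not> ?thesis"
      then show False using Suc.prems by simp
    qed
    then obtain i where i: "w $ i \<noteq> 0" by blast
    define w' where "w' = w - axis i (sgn (w $ i))"
    have "(\<Sum>j\<in>UNIV. \<bar>w' $ j\<bar>) = (\<Sum>j\<in>UNIV. \<bar>w $ j\<bar> - (if j = i then 1 else 0))"
      by (rule sum.cong) (use i in \<open>auto simp: w'_def axis_def sgn_if\<close>)
    also have "\<dots> = int n" using Suc.prems by (subst sum_subtractf) simp
    finally have "(v, v + w') \<in> grid_adj ^^ n" by (rule Suc.IH)
    moreover have "(v + w', v + w) \<in> grid_adj"
      unfolding grid_adj_iff using i by (intro exI[of _ i]) (auto simp: w'_def axis_def vec_eq_iff sgn_if)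
    ultimately show ?case by auto
  qed
  have "(\<Sum>i\<in>UNIV. \<bar>w $ i\<bar>) \<le> (\<Sum>i\<in>(UNIV::'d set). int s)"
    using assms by (intro sum_mono) (auto simp: near_def)
  then have le: "nat (\<Sum>i\<in>UNIV. \<bar>w $ i\<bar>) \<le> CARD('d) * s" by (simp add: nat_le_iff)
  have "(0, 0 + w) \<in> grid_adj ^^ nat (\<Sum>i\<in>UNIV. \<bar>w $ i\<bar>)" by (rule path) (simp add: sum_nonneg)
  then show ?thesis using le by (auto simp: grid_ball_def)
qed

lemma finite_grid_ball: "finite (grid_ball v r :: (int ^ 'd::finite) set)"
  by (rule finite_subset[OF _ finite_near[of "int r" v]]) (use grid_ball_near in auto)

section \<open>Concrete scales and their inequalities\<close>

definition bn :: "nat \<Rightarrow> nat" where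
  "bn k = 2 ^ ((k + 6)\<^sup>2)"

definition bs :: "nat \<Rightarrow> int" where
  "bs k = int (bn k)"

primrec Ds :: "nat \<Rightarrow> int" where
  "Ds 0 = 0"
| "Ds (Suc k) = 2 * bs k + 4 * Ds k + 40"

definition Ws :: "nat \<Rightarrow> int" where
  "Ws k = 3 * Ds k + 50"

primrec locs :: "nat \<Rightarrow> int" where
  "locs 0 = 0"
| "locs (Suc k) = locs k + 3 + 2 * (bs k + 7 + Ds k)"

interpretation sc: scales bs Ds Ws locs
  by unfold_locales (auto simp: bs_def Ws_def)

lemma bn_Suc: "bn (Suc k) = 2 ^ (2 * k + 13) * bn k"
  unfolding bn_def by (simp add: power_add[symmetric] power2_eq_square algebra_simps)

lemma bn_large: "2 ^ 36 \<le> bn k"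
  unfolding bn_def by (rule power_increasing) (auto simp: power2_eq_square algebra_simps)

lemma bs_large: "1000 \<le> bs k"
proof -
  have "(1000::nat) \<le> 2 ^ 36" by simp
  then have "1000 \<le> bn k" using bn_large[of k] by linarith
  then show ?thesis unfolding bs_def by linarith
qed

lemma bs_Suc: "1000 * bs k \<le> bs (Suc k)"
proof -
  have "(2::nat) ^ 13 \<le> 2 ^ (2 * k + 13)" by (rule power_increasing) auto
  then have "1000 \<le> (2::nat) ^ (2 * k + 13)" by simp
  then have "1000 * bn k \<le> bn (Suc k)" unfolding bn_Suc by (rule mult_right_mono) simp
  then show ?thesis unfolding bs_def by linarith
qed

lemma bs_mono: "j \<le> k \<Longrightarrow> bs j \<le> bs k"
  by (rule lift_Suc_mono_le[of bs]) (use bs_Suc bs_large in \<open>smt (verit)\<close>)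

lemma Ds_le: "Ds k \<le> bs k" "Ds (Suc k) \<le> 7 * bs k"
proof -
  show 1: "Ds k \<le> bs k" for k
  proof (induction k)
    case (Suc k)
    then show ?case using bs_Suc[of k] bs_large[of k] by simp
  qed (use bs_large[of 0] in simp)
  show "Ds (Suc k) \<le> 7 * bs k" using 1[of k] bs_large[of k] by simp
qed

lemma Ws_le: "2 * Ws k \<le> bs k" "Ws (Suc k) \<le> 26 * bs k" "0 \<le> Ws k"
proof -
  have "Ws (Suc k) \<le> 26 * bs k" for k using Ds_le(2)[of k] bs_large[of k] by (simp add: Ws_def del: Ds.simps)
  then show "Ws (Suc k) \<le> 26 * bs k" .
  show "2 * Ws k \<le> bs k"
  proof (cases k)
    case 0
    then show ?thesis using bs_large[of 0] by (simp add: Ws_def)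
  next
    case (Suc j)
    then show ?thesis using \<open>\<And>k. Ws (Suc k) \<le> 26 * bs k\<close>[of j] bs_Suc[of j] bs_large[of j] by simp
  qed
  show "0 \<le> Ws k" using sc.D_nonneg[of k] by (simp add: Ws_def)
qed

lemma locs_le: "locs k \<le> bs k"
proof (induction k)
  case (Suc k)
  then show ?case using bs_Suc[of k] bs_large[of k] Ds_le(1)[of k] by simp
qed (use bs_large[of 0] in simp)

lemma radius_bound: "j \<le> k \<Longrightarrow> 2 * sc.\<Delta> j + 9 + locs j \<le> 12 * bs k"
  using bs_mono[of j k] locs_le[of j] Ds_le(1)[of j] bs_large[of j] by (simp add: sc.\<Delta>_def)

text \<open>The numerator is the binary logarithm of \<open>bn k\<close>. A cube with at least
  \<open>bn k ^ d\<close> points then has no centre with probability at most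
  \<open>exp (- (k + 6)^2)\<close>, which is below \<open>1 / bn k\<close>.\<close>

definition dens :: "nat \<Rightarrow> nat \<Rightarrow> real" where
  "dens d k = real ((k + 6)\<^sup>2) / real (bn k) ^ d"

text \<open>Level \<open>k\<close> reads the labels shifted by \<open>shv k\<close>, so that at a given vertex different levels use
  disjoint sets of labels and hence are independent.\<close>

definition shv :: "nat \<Rightarrow> int ^ 'd" where
  "shv k = (\<chi> i. 4 * bs k)"

definition centres :: "nat \<Rightarrow> (int ^ 'd::finite \<Rightarrow> real) \<Rightarrow> (int ^ 'd) set" where
  "centres k x = {w. x (w + shv k) < dens CARD('d) k}"

definition clus :: "(int ^ 'd::finite \<Rightarrow> real) \<Rightarrow> nat \<Rightarrow> (int ^ 'd) set" where
  "clus x k = base (bs k) (Ws k) (centres k x)"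

lemma dens_pos: "0 < dens d k"
  by (simp add: dens_def bn_def)

lemma dens_le_1:
  assumes "d > 0"
  shows "dens d k \<le> 1"
proof -
  have "(k + 6)\<^sup>2 \<le> 2 ^ (k + 6)\<^sup>2" by (rule less_imp_le[OF less_exp])
  also have "\<dots> = bn k ^ 1" by (simp add: bn_def)
  also have "\<dots> \<le> bn k ^ d" using assms bn_large[of k] by (intro power_increasing) (auto simp: bn_def)
  finally have "real ((k + 6)\<^sup>2) \<le> real (bn k ^ d)" by (simp only: of_nat_le_iff)
  then show ?thesis unfolding dens_def by (simp add: divide_le_eq bn_def)
qed

text \<open>In units of \<open>bn k\<close>: 12 for the window that fixes the colour, at most 3/2
  from there to the centres, and 4 for the shift of the labels, which makes 17.5; the rest is
  slack.\<close>

definition rad :: "nat \<Rightarrow> nat" where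
  "rad k = 20 * bn k"

definition rho :: "'d::finite itself \<Rightarrow> nat \<Rightarrow> nat" where
  "rho _ k = CARD('d) * rad k"

lemma rho_mono: "strict_mono (rho TYPE('d::finite))"
proof (rule strict_monoI_Suc)
  fix k
  have "bs k < bs (Suc k)" using bs_Suc[of k] bs_large[of k] by simp
  then show "rho TYPE('d) k < rho TYPE('d) (Suc k)" by (simp add: rho_def rad_def bs_def)
qed

text \<open>The hierarchy as guessed from one ball; labels outside count as 1, so it is reliable
  only near the origin. At radius \<open>rho TYPE('d) k\<close> the condition keeps exactly the
  levels up to \<open>k\<close>.\<close>

definition patch :: "nat \<Rightarrow> (int ^ 'd::finite \<Rightarrow> real) \<Rightarrow> nat \<Rightarrow> (int ^ 'd) set" where
  "patch r y j = (if rho TYPE('d) j \<le> r then clus (ext_lab (grid_ball 0 r) y) j else {})"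

definition island_alg :: "('d::finite, nat) local_alg" where
  "island_alg = \<lparr>nbhds = {(rho TYPE('d) k, y) | k y. y \<in> space (PiM (grid_ball 0 (rho TYPE('d) k)) (\<lambda>_. unif01)) \<and> 0 \<in> patch (rho TYPE('d) k) y k},
     rule = (\<lambda>(r, y). colour (patch r y) 0)\<rparr>"

lemma near_shv: "near (4 * bs k) w (w + shv k)"
  by (simp add: near_def shv_def bs_def)

lemma clus_agree:
  fixes x z :: "int ^ 'd::finite \<Rightarrow> real"
  assumes eq: "\<And>u. near (18 * bs k) 0 u \<Longrightarrow> z u = x (v + u)" and jk: "j \<le> k"
  shows "agree (- v) (12 * bs k) v (clus x j) (clus z j)"
  unfolding agree_def clus_def
proof (intro allI impI base_cong Ws_le)
  fix w c :: "int ^ 'd" assume w: "near (12 * bs k) v w" and c: "near (bs j + Ws j) c w"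
  have "near (12 * bs k + (bs j + Ws j) + 4 * bs j) v (c + shv j)"
    using near_trans[OF near_trans[OF w] near_shv] c near_sym by blast
  then have "near (18 * bs k) v (c + shv j)"
    by (rule near_mono) (use bs_mono[OF jk] Ws_le(1)[of j] bs_large[of j] in simp)
  then have "near (18 * bs k) (- v + v) (- v + (c + shv j))" unfolding near_translate .
  then have "z (- v + (c + shv j)) = x (v + (- v + (c + shv j)))" by (intro eq) simp
  then show "c \<in> centres j x \<longleftrightarrow> - v + c \<in> centres j z" by (simp add: centres_def diff_add_eq)
qed

lemma adm_clus: "sc.adm (clus x)"
  by (simp add: sc.adm_def clus_def clustered_base Ws_le)

lemma adm_patch: "sc.adm (patch r y)"
  by (auto simp: sc.adm_def patch_def clus_def clustered_base Ws_le) (simp add: clustered_def)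

context
  fixes x :: "int ^ 'd::finite \<Rightarrow> real" and v :: "int ^ 'd" and k :: nat and y
  assumes y: "y = restrict (\<lambda>w. x (v + w)) (grid_ball 0 (rho TYPE('d) k))"
begin

lemma patch_agree: "j \<le> k \<Longrightarrow> agree (- v) (12 * bs k) v (clus x j) (patch (rho TYPE('d) k) y j)"
proof -
  assume jk: "j \<le> k"
  have "rho TYPE('d) j \<le> rho TYPE('d) k" using jk rho_mono strict_mono_less_eq by blast
  moreover have E: "ext_lab (grid_ball 0 (rho TYPE('d) k)) y u = x (v + u)" if "near (18 * bs k) 0 u" for u
  proof -
    have "near (int (rad k)) 0 u" using that by (rule near_mono) (simp add: rad_def bs_def)
    then have "u \<in> grid_ball 0 (rho TYPE('d) k)" unfolding rho_def by (rule grid_ball_supset)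
    then show ?thesis by (simp add: ext_lab_def y)
  qed
  moreover have "agree (- v) (12 * bs k) v (clus x j) (clus (ext_lab (grid_ball 0 (rho TYPE('d) k)) y) j)"
    using E jk by (intro clus_agree)
  ultimately show ?thesis by (simp add: patch_def)
qed

lemma patch_mem: "0 \<in> patch (rho TYPE('d) k) y k \<longleftrightarrow> v \<in> clus x k"
proof -
  have "near (12 * bs k) v v" using bs_large[of k] by simp
  then show ?thesis using patch_agree[of k] unfolding agree_def by force
qed

lemma patch_colour:
  assumes "v \<in> clus x k"
  shows "colour (patch (rho TYPE('d) k) y) 0 = colour (clus x) v"
  using sc.colour_local[OF adm_clus adm_patch patch_agree radius_bound assms] by simp

end

lemma view_island_alg:
  fixes x :: "int ^ 'd::finite \<Rightarrow> real"
  assumes x: "x \<in> space lab"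
  shows "view x v r \<in> nbhds island_alg \<longleftrightarrow> (\<exists>k. r = rho TYPE('d) k \<and> v \<in> clus x k)"
proof -
  have sp: "restrict (\<lambda>w. x (v + w)) (grid_ball 0 r) \<in> space (PiM (grid_ball 0 r) (\<lambda>_. unif01))" for r
    using measurable_space[OF view_measurable x] .
  have "view x v r \<in> nbhds island_alg \<longleftrightarrow>
     (\<exists>k. r = rho TYPE('d) k \<and> 0 \<in> patch (rho TYPE('d) k) (restrict (\<lambda>w. x (v + w)) (grid_ball 0 (rho TYPE('d) k))) k)"
    using sp by (auto simp: island_alg_def view_def)
  then show ?thesis by (simp add: patch_mem[OF refl])
qed

text \<open>The stopping level need not be identified: for every \<open>k\<close> with
  \<open>v\<close> in \<open>clus x k\<close> the patch yields the same colour.\<close>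

lemma output_island_alg:
  fixes x :: "int ^ 'd::finite \<Rightarrow> real"
  assumes x: "x \<in> space lab" and ex: "\<exists>k. v \<in> clus x k"
  shows "halts island_alg x v" "alg_output island_alg x v = colour (clus x) v"
proof -
  obtain k0 where "v \<in> clus x k0" using ex by blast
  then have r0: "view x v (rho TYPE('d) k0) \<in> nbhds island_alg" using view_island_alg[OF x] by blast
  then show "halts island_alg x v" by (auto simp: halts_def)
  let ?r = "LEAST r. view x v r \<in> nbhds island_alg"
  have "view x v ?r \<in> nbhds island_alg" using r0 by (rule LeastI)
  then obtain k where k: "?r = rho TYPE('d) k" "v \<in> clus x k" using view_island_alg[OF x] by blast
  have "alg_output island_alg x v = colour (patch (rho TYPE('d) k) (restrict (\<lambda>w. x (v + w)) (grid_ball 0 (rho TYPE('d) k)))) 0"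
    unfolding alg_output_def k(1) by (simp add: island_alg_def view_def)
  also have "\<dots> = colour (clus x) v" by (rule patch_colour[OF refl k(2)])
  finally show "alg_output island_alg x v = colour (clus x) v" .
qed

section \<open>The probability of being undecided\<close>

lemma pred_label [measurable]: "Measurable.pred lab (\<lambda>x. x u < (q :: real))"
proof -
  have "(\<lambda>t. t) \<in> unif01 \<rightarrow>\<^sub>M borel" unfolding unif01_def by (intro measurable_restrict_space1) simp
  from measurable_compose[OF lab_component this] have [measurable]: "(\<lambda>x. x u) \<in> borel_measurable lab" .
  show ?thesis by measurable
qed

lemma label_prob:
  assumes "0 \<le> q" "q \<le> 1"
  shows "measure lab {x \<in> space lab. x u < q} = q"
proof -
  have S: "{0..<q} \<in> sets unif01" unfolding sets_unif01 sets_restrict_space_iff[of "{0..1::real}" borel, simplified] using assms by auto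
  have "measure lab {x \<in> space lab. x u < q} = measure (distr lab unif01 (\<lambda>x. x u)) {0..<q}"
    using S by (subst measure_distr) (auto intro!: arg_cong[of _ _ "measure lab"] simp: space_lab)
  also have "distr (lab :: ('a \<Rightarrow> real) measure) unif01 (\<lambda>x. x u) = unif01"
    unfolding lab_def by (rule distr_PiM_component) (auto intro: prob_space_unif01)
  also have "measure unif01 {0..<q} = measure lborel {0..<q}"
    unfolding unif01_def using assms by (intro measure_restrict_space) auto
  finally show ?thesis using assms by simp
qed

lemma pred_clus [measurable]: "Measurable.pred lab (\<lambda>x. v \<in> clus x k)"
  unfolding clus_def base_def centres_def mem_Collect_eq Bex_def Ball_def by measurable

lemma clus_depends:
  "depends_on (\<lambda>x. 0 \<in> clus x k) {u :: int ^ 'd::finite. near (bs k + Ws k) (shv k) u}"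
proof (rule depends_onI)
  fix x y :: "int ^ 'd \<Rightarrow> real"
  assume eq: "\<And>w. w \<in> {u. near (bs k + Ws k) (shv k) u} \<Longrightarrow> x w = y w"
  have "0 \<in> base (bs k) (Ws k) (centres k x) \<longleftrightarrow> 0 + 0 \<in> base (bs k) (Ws k) (centres k y)"
  proof (rule base_cong[OF Ws_le(3)])
    fix c :: "int ^ 'd" assume "near (bs k + Ws k) c 0"
    then have "near (bs k + Ws k) (shv k + 0) (shv k + c)" unfolding near_translate using near_sym by blast
    then have "x (c + shv k) = y (c + shv k)" by (intro eq) (simp add: add.commute)
    then show "c \<in> centres k x \<longleftrightarrow> 0 + c \<in> centres k y" by (simp add: centres_def)
  qed
  then show "(0 \<in> clus x k) = (0 \<in> clus y k)" by (simp add: clus_def)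
qed

text \<open>The rule only sees which labels of its ball fall below finitely many thresholds.\<close>

definition code :: "nat \<Rightarrow> (int ^ 'd::finite \<Rightarrow> real) \<Rightarrow> (nat \<times> (int ^ 'd)) set" where
  "code r y = {(j, w). rho TYPE('d) j \<le> r \<and> w \<in> grid_ball 0 r \<and> y w < dens CARD('d) j}"

lemma patch_code:
  fixes y z :: "int ^ 'd::finite \<Rightarrow> real"
  assumes "code r y = code r z"
  shows "patch r y = patch r z"
proof
  fix j
  have "centres j (ext_lab (grid_ball 0 r) u) = {w. (j, w + shv j) \<in> code r u}"
    if "rho TYPE('d) j \<le> r" for u :: "int ^ 'd \<Rightarrow> real"
    using that dens_le_1[of "CARD('d)" j] by (auto simp: centres_def ext_lab_def code_def)
  then show "patch r y j = patch r z j" using assms by (simp add: patch_def clus_def)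
qed

lemma code_measurable:
  "code r \<in> PiM (grid_ball 0 r :: (int ^ 'd::finite) set) (\<lambda>_. unif01) \<rightarrow>\<^sub>M count_space (Pow ({j. rho TYPE('d) j \<le> r} \<times> grid_ball 0 r))"
proof -
  let ?M = "PiM (grid_ball 0 r :: (int ^ 'd) set) (\<lambda>_. unif01)"
  let ?F = "{j. rho TYPE('d) j \<le> r} \<times> (grid_ball 0 r :: (int ^ 'd) set)"
  have "{j. rho TYPE('d) j \<le> r} \<subseteq> {..r}"
    using strict_mono_imp_increasing[OF rho_mono] order_trans by fastforce
  then have fin: "finite ?F" using finite_grid_ball finite_subset by blast
  have lp: "Measurable.pred ?M (\<lambda>y. y w < q)" if "w \<in> grid_ball 0 r" for w and q :: real
  proof -
    have "Measurable.pred ?M (\<lambda>y. ext_lab (grid_ball 0 r) y w < q)" by (rule pred_ext_lab) measurable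
    then show ?thesis using that by (simp add: ext_lab_def)
  qed
  show ?thesis
  proof (subst measurable_count_space_eq2[OF iffD2[OF finite_Pow_iff fin]], intro conjI ballI)
    show "code r \<in> space ?M \<rightarrow> Pow ?F" by (auto simp: code_def)
    fix T assume T: "T \<in> Pow ?F"
    have "code r -` {T} \<inter> space ?M = {y \<in> space ?M. \<forall>p\<in>?F. (y (snd p) < dens CARD('d) (fst p)) = (p \<in> T)}"
    proof -
      have sub: "code r y \<subseteq> ?F" for y :: "int ^ 'd \<Rightarrow> real" by (auto simp: code_def)
      have "code r y = T \<longleftrightarrow> (\<forall>p\<in>?F. (p \<in> code r y) = (p \<in> T))" for y :: "int ^ 'd \<Rightarrow> real"
        using T sub[of y] by blast
      moreover have "p \<in> code r y \<longleftrightarrow> y (snd p) < dens CARD('d) (fst p)" if "p \<in> ?F" for p and y :: "int ^ 'd \<Rightarrow> real"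
        using that by (cases p) (simp add: code_def)
      ultimately have "code r y = T \<longleftrightarrow> (\<forall>p\<in>?F. (y (snd p) < dens CARD('d) (fst p)) = (p \<in> T))"
        for y :: "int ^ 'd \<Rightarrow> real" by simp
      then show ?thesis by blast
    qed
    moreover have "Measurable.pred ?M (\<lambda>y. \<forall>p\<in>?F. (y (snd p) < dens CARD('d) (fst p)) = (p \<in> T))"
    proof (intro pred_intros_finite(3)[OF fin])
      fix p assume "p \<in> ?F"
      then have "snd p \<in> grid_ball 0 r" by auto
      from lp[OF this, of "dens CARD('d) (fst p)"] pred_intros_logic(2)[OF lp[OF this, of "dens CARD('d) (fst p)"]]
      show "Measurable.pred ?M (\<lambda>y. (y (snd p) < dens CARD('d) (fst p)) = (p \<in> T))"
        by (cases "p \<in> T") (simp_all only: simp_thms)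
    qed
    ultimately show "code r -` {T} \<inter> space ?M \<in> sets ?M" by (simp only: pred_def)
  qed
qed

lemma uniform_island_alg: "uniform_local_alg {..<3} (island_alg :: ('d::finite, nat) local_alg)"
  unfolding uniform_local_alg_def
proof (intro conjI allI)
  fix r
  let ?M = "PiM (grid_ball 0 r :: (int ^ 'd) set) (\<lambda>_. unif01)"
  show "{y. (r, y) \<in> nbhds (island_alg :: ('d, nat) local_alg)} \<in> sets ?M"
  proof (cases "\<exists>k. r = rho TYPE('d) k")
    case True
    then obtain k where k: "r = rho TYPE('d) k" by blast
    have "{y. (r, y) \<in> nbhds (island_alg :: ('d, nat) local_alg)} = {y \<in> space ?M. 0 \<in> clus (ext_lab (grid_ball 0 r) y) k}"
      using strict_mono_eq[OF rho_mono[where 'd = 'd], of k] unfolding k by (auto simp: island_alg_def patch_def)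
    moreover have "Measurable.pred ?M (\<lambda>y. 0 \<in> clus (ext_lab (grid_ball 0 r) y) k)"
      by (rule pred_ext_lab[OF pred_clus])
    ultimately show ?thesis by (simp add: pred_def)
  next
    case False
    then have "{y. (r, y) \<in> nbhds (island_alg :: ('d, nat) local_alg)} = {}" by (auto simp: island_alg_def)
    then show ?thesis by simp
  qed
  \<comment> \<open>The rule factors through the finitely valued \<open>code\<close>: any labelling
    with the same code represents it.\<close>
  define f where "f = (\<lambda>T. colour (patch r (SOME y. code r y = T)) (0 :: int ^ 'd))"
  have eq: "rule island_alg (r, y) = f (code r y)" for y :: "int ^ 'd \<Rightarrow> real"
  proof -
    have "code r (SOME z. code r z = code r y) = code r y" by (rule someI[of _ y]) simp
    then have "patch r (SOME z. code r z = code r y) = patch r y" by (rule patch_code)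
    then show ?thesis by (simp add: f_def island_alg_def)
  qed
  have "(\<lambda>y. f (code r y)) \<in> ?M \<rightarrow>\<^sub>M count_space {..<3}"
    by (rule measurable_compose[OF code_measurable]) (auto simp: f_def colour_def Let_def cc_less)
  then show "(\<lambda>y. rule island_alg (r, y)) \<in> restrict_space ?M {y. (r, y) \<in> nbhds (island_alg :: ('d, nat) local_alg)} \<rightarrow>\<^sub>M count_space {..<3}"
    unfolding eq by (rule measurable_restrict_space1)
qed simp

definition miss :: "'d::finite itself \<Rightarrow> nat \<Rightarrow> real" where
  "miss _ k = measure lab {x \<in> space lab. (0 :: int ^ 'd) \<notin> clus x k}"

text \<open>At the origin, level \<open>j\<close> reads labels whose coordinates lie between
  \<open>2.5 * bs j\<close> and \<open>5.5 * bs j\<close>. The scales grow by a factor of at least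
  1000, so these cubes are disjoint.\<close>

lemma miss_product:
  "measure lab {x \<in> space lab. \<forall>j<k. (0 :: int ^ 'd::finite) \<notin> clus x j} = (\<Prod>j<k. miss TYPE('d) j)"
proof -
  have "measure lab {x \<in> space lab. \<forall>j\<in>{..<k}. (0 :: int ^ 'd) \<notin> clus x j}
      = (\<Prod>j\<in>{..<k}. measure lab {x \<in> space lab. (0 :: int ^ 'd) \<notin> clus x j})"
  proof (rule indep_disjoint_family)
    show "depends_on (\<lambda>x. (0 :: int ^ 'd) \<notin> clus x j) {u. near (bs j + Ws j) (shv j) u}" for j
      using clus_depends[of j] unfolding depends_on_def by blast
    have "{u. near (bs j + Ws j) (shv j) u} \<inter> {u :: int ^ 'd. near (bs l + Ws l) (shv l) u} = {}" if "j < l" for j l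
    proof -
      have "False" if u: "near (bs j + Ws j) (shv j) u" "near (bs l + Ws l) (shv l) u" for u :: "int ^ 'd"
      proof -
        fix i :: 'd
        have "\<bar>4 * bs j - u $ i\<bar> \<le> bs j + Ws j" "\<bar>4 * bs l - u $ i\<bar> \<le> bs l + Ws l"
          using u by (auto simp: near_def shv_def)
        then show False
          using Ws_le(1)[of j] Ws_le(1)[of l] bs_large[of j] bs_Suc[of j] bs_mono[of "Suc j" l] \<open>j < l\<close> by linarith
      qed
      then show ?thesis by blast
    qed
    then show "disjoint_family_on (\<lambda>j. {u :: int ^ 'd. near (bs j + Ws j) (shv j) u}) {..<k}"
      unfolding disjoint_family_on_def by (metis Int_commute linorder_neqE_nat)
  qed measurable
  then show ?thesis by (simp only: miss_def Ball_def lessThan_iff)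
qed

lemma card_near:
  assumes "0 \<le> s"
  shows "card {c :: int ^ 'd::finite. near s c 0} = nat (2 * s + 1) ^ CARD('d)"
proof -
  have "bij_betw (\<lambda>f. \<chi> i. f i) (PiE (UNIV :: 'd set) (\<lambda>_. {-s..s})) {c. near s c 0}"
  proof (rule bij_betwI[of _ _ _ "\<lambda>c. ($) c"])
    show "(\<lambda>f. \<chi> i. f i) \<in> (PiE (UNIV :: 'd set) (\<lambda>_. {-s..s})) \<rightarrow> {c. near s c 0}"
      by (auto simp: near_def PiE_iff abs_le_iff minus_le_iff[of _ s])
    show "($) \<in> {c. near s c 0} \<rightarrow> (PiE (UNIV :: 'd set) (\<lambda>_. {-s..s}))"
      by (auto simp: near_def abs_le_iff minus_le_iff[of _ s])
  qed (auto simp: vec_eq_iff)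
  from bij_betw_same_card[OF this] show ?thesis using assms by (simp add: card_PiE)
qed

lemma power_diff_le:
  fixes x y :: real
  assumes "0 \<le> y" "y \<le> x"
  shows "x ^ d - y ^ d \<le> real d * (x - y) * x ^ (d - 1)"
proof (cases d)
  case (Suc n)
  have "x ^ Suc n - y ^ Suc n = (x - y) * (\<Sum>p<Suc n. x ^ p * y ^ (n - p))"
    by (rule diff_power_eq_sum)
  also have "\<dots> \<le> (x - y) * (\<Sum>p<Suc n. x ^ p * x ^ (n - p))"
    using assms by (intro mult_left_mono sum_mono power_mono) auto
  also have "(\<Sum>p<Suc n. x ^ p * x ^ (n - p)) = (\<Sum>p<Suc n. x ^ n)"
    by (intro sum.cong refl) (simp add: power_add[symmetric])
  finally show ?thesis using Suc by (simp add: algebra_simps)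
qed simp

text \<open>The 1 pays for the absence of a centre, the other term for a centre whose wall covers
  the origin: the shell of such centres has at most \<open>d * (4 * W) * (4 * b) ^ (d - 1)\<close>
  points, with \<open>W\<close> at most 26 times the previous scale.\<close>

definition Mc :: "nat \<Rightarrow> real" where
  "Mc d = 1 + 26 * real d * 4 ^ d"

text \<open>The origin is missed only if the inner cube has no centre or the shell between the inner
  and outer cube has one. The first probability is exponentially small in \<open>(k + 6)^2\<close>;
  the second is the shell volume times the density, hence wall width over scale up to the
  logarithmic factor.\<close>

lemma miss_bound:
  "miss TYPE('d::finite) (Suc j) \<le> Mc CARD('d) * real (j + 7) ^ 2 * (real (bn j) / real (bn (Suc j)))"
proof -
  define k where "k = Suc j"
  define d where "d = CARD('d)"
  define q where "q = dens d k"
  define n where "n = (k + 6)\<^sup>2"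
  define \<beta> where "\<beta> = real (bn k)"
  have d0: "d > 0" by (simp add: d_def)
  have q: "0 < q" "q \<le> 1" using dens_pos dens_le_1[OF d0] by (auto simp: q_def)
  have \<beta>: "\<beta> = 2 ^ n" "\<beta> > 0" by (simp_all add: \<beta>_def n_def bn_def)
  have qd: "q = real n / \<beta> ^ d" by (simp add: q_def dens_def n_def \<beta>_def)
  define inner where "inner = {c :: int ^ 'd. near (bs k - Ws k) c 0}"
  define outer where "outer = {c :: int ^ 'd. near (bs k + Ws k) c 0}"
  have io: "inner \<subseteq> outer" unfolding inner_def outer_def using near_mono Ws_le(3)[of k] by fastforce
  have fin: "finite outer" unfolding outer_def using finite_near[of "bs k + Ws k" 0] near_sym by (metis (no_types, lifting) Collect_cong)
  have W: "0 \<le> Ws k" "2 * Ws k \<le> bs k" "Ws k \<le> 26 * bs j" using Ws_le[of k] Ws_le(2)[of j] by (auto simp: k_def)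
  have ci: "card inner = nat (2 * (bs k - Ws k) + 1) ^ d" and co: "card outer = nat (2 * (bs k + Ws k) + 1) ^ d"
    unfolding inner_def outer_def d_def using W bs_large[of k] by (intro card_near; linarith)+
  let ?N = "{x \<in> space lab. \<forall>c\<in>inner. \<not> x (c + shv k) < q}"
  let ?S = "\<lambda>c. {x \<in> space lab. x (c + shv k) < q}"
  have "{x \<in> space lab. (0 :: int ^ 'd) \<notin> clus x k} \<subseteq> ?N \<union> (\<Union>c\<in>outer - inner. ?S c)"
    by (auto simp: clus_def base_def centres_def inner_def outer_def q_def d_def)
  then have "miss TYPE('d) k \<le> measure lab (?N \<union> (\<Union>c\<in>outer - inner. ?S c))"
    unfolding miss_def using fin by (intro L.finite_measure_mono) (auto intro!: sets.Un sets.finite_UN)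
  also have "\<dots> \<le> measure lab ?N + measure lab (\<Union>c\<in>outer - inner. ?S c)"
    using fin finite_subset[OF io fin] by (intro measure_Un_le) (auto intro!: sets.finite_UN)
  also have "measure lab (\<Union>c\<in>outer - inner. ?S c) \<le> (\<Sum>c\<in>outer - inner. measure lab (?S c))"
    using fin by (intro L.finite_measure_subadditive_finite) auto
  also have "\<dots> = real (card (outer - inner)) * q" using q by (simp add: label_prob)
  also have "measure lab ?N = (\<Prod>c\<in>inner. measure lab {x \<in> space lab. \<not> x (c + shv k) < q})"
    using finite_subset[OF io fin]
    by (intro indep_disjoint_family[where V = "\<lambda>c. {c + shv k}"]) (auto simp: depends_on_def disjoint_family_on_def)
  also have "\<dots> = (1 - q) ^ card inner"
  proof -
    have "measure lab {x \<in> space lab. \<not> x (c + shv k) < q} = 1 - q" for c :: "int ^ 'd"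
    proof -
      have "?S c \<in> sets lab" by measurable
      from L.prob_neg[OF this] show ?thesis using q by (simp add: label_prob)
    qed
    then show ?thesis by simp
  qed
  finally have main: "miss TYPE('d) k \<le> (1 - q) ^ card inner + real (card (outer - inner)) * q" by simp
  have exp_bound: "(1 - q) ^ card inner \<le> 1 / \<beta>"
  proof -
    have "bn k \<le> nat (2 * (bs k - Ws k) + 1)" using W by (simp add: bs_def)
    then have "bn k ^ d \<le> card inner" unfolding ci by (rule power_mono) simp
    then have c: "\<beta> ^ d \<le> real (card inner)" unfolding \<beta>_def by (metis of_nat_le_iff of_nat_power)
    have "(1 - q) ^ card inner \<le> exp (- q) ^ card inner"
      using q exp_ge_add_one_self[of "- q"] by (intro power_mono) auto
    also have "\<dots> = exp (- (real (card inner) * q))" by (simp add: exp_of_nat_mult[symmetric])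
    also have "\<dots> \<le> exp (- real n)"
    proof -
      have "real n = \<beta> ^ d * q" using \<beta> by (simp add: qd)
      also have "\<dots> \<le> real (card inner) * q" using c q by (intro mult_right_mono) auto
      finally show ?thesis by simp
    qed
    also have "\<dots> = inverse (exp 1 ^ n)" by (simp add: exp_minus exp_of_nat_mult[symmetric])
    also have "\<dots> \<le> inverse (2 ^ n)"
      using exp_ge_add_one_self[of 1] by (intro le_imp_inverse_le power_mono) auto
    finally show ?thesis by (simp add: \<beta>(1) inverse_eq_divide)
  qed
  have shell: "real (card (outer - inner)) * q \<le> 26 * real d * 4 ^ d * real n * (real (bn j) / \<beta>)"
  proof -
    define X where "X = real_of_int (2 * (bs k + Ws k) + 1)"
    define Z where "Z = real_of_int (2 * (bs k - Ws k) + 1)"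
    have cX: "real (card outer) = X ^ d" and cZ: "real (card inner) = Z ^ d"
      using W bs_large[of k] by (simp_all add: ci co X_def Z_def)
    have "real (card (outer - inner)) = X ^ d - Z ^ d"
      using card_Diff_subset[OF finite_subset[OF io fin] io] card_mono[OF fin io] cX cZ by (simp add: of_nat_diff)
    also have "\<dots> \<le> real d * (X - Z) * X ^ (d - 1)"
      using W bs_large[of k] by (intro power_diff_le) (auto simp: X_def Z_def)
    finally have le: "real (card (outer - inner)) \<le> real d * (X - Z) * X ^ (d - 1)" .
    have XZ: "Z \<le> X" "0 \<le> X" using W bs_large[of k] by (simp_all add: X_def Z_def)
    have "real d * (X - Z) * X ^ (d - 1) \<le> real d * (104 * real (bn j)) * (4 * \<beta>) ^ (d - 1)"
    proof (intro mult_mono power_mono mult_left_mono)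
      show "X - Z \<le> 104 * real (bn j)" using W(3) by (simp add: X_def Z_def bs_def)
      have "2 * (bs k + Ws k) + 1 \<le> 4 * bs k" using W bs_large[of k] by simp
      then have "X \<le> real_of_int (4 * bs k)" unfolding X_def by (simp only: of_int_le_iff)
      then show "X \<le> 4 * \<beta>" by (simp add: \<beta>_def bs_def)
    qed (use \<beta> XZ in auto)
    with le have "real (card (outer - inner)) \<le> real d * (104 * real (bn j)) * (4 * \<beta>) ^ (d - 1)" by linarith
    then have "real (card (outer - inner)) * q \<le> real d * (104 * real (bn j)) * (4 * \<beta>) ^ (d - 1) * q"
      using q by (intro mult_right_mono) auto
    also have "\<dots> = 26 * real d * 4 ^ d * real n * (real (bn j) / \<beta>)"
    proof -
      obtain e where e: "d = Suc e" using d0 by (cases d) auto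
      show ?thesis using \<beta>(2) by (simp add: qd e power_mult_distrib field_simps)
    qed
    finally show ?thesis .
  qed
  have "1 / \<beta> \<le> real n * (real (bn j) / \<beta>)"
  proof -
    have "1 \<le> n * bn j" by (simp add: n_def bn_def)
    then have "1 \<le> real n * real (bn j)" by (metis of_nat_1 of_nat_le_iff of_nat_mult)
    then show ?thesis using \<beta>(2) by (simp add: field_simps)
  qed
  then have "miss TYPE('d) k \<le> real n * (real (bn j) / \<beta>) + 26 * real d * 4 ^ d * real n * (real (bn j) / \<beta>)"
    using main exp_bound shell by linarith
  also have "\<dots> = Mc d * real n * (real (bn j) / \<beta>)" by (simp add: Mc_def algebra_simps)
  finally show ?thesis by (simp add: k_def d_def n_def \<beta>_def add.commute)
qed

section \<open>Moments of the island algorithm\<close>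

text \<open>Level 0 has no preceding scale, so the trivial bound 1 is used. Positivity of the
  majorant is what the ratio test needs.\<close>

definition miss_majorant :: "nat \<Rightarrow> nat \<Rightarrow> real" where
  "miss_majorant d j = (case j of 0 \<Rightarrow> 1 | Suc i \<Rightarrow> Mc d * real (i + 7) ^ 2 * (real (bn i) / real (bn j)))"

lemma miss_le_majorant: "0 \<le> miss TYPE('d::finite) j" "miss TYPE('d) j \<le> miss_majorant CARD('d) j"
proof -
  show "0 \<le> miss TYPE('d) j" by (simp add: miss_def)
  show "miss TYPE('d) j \<le> miss_majorant CARD('d) j"
    using miss_bound[where 'd = 'd] by (cases j) (simp_all add: miss_majorant_def, simp add: miss_def)
qed

lemma majorant_pos: "0 < miss_majorant d j"
proof -
  have "0 < Mc d" unfolding Mc_def by (rule add_pos_nonneg) auto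
  then show ?thesis by (cases j) (auto simp: miss_majorant_def bn_def)
qed

definition undecided :: "nat \<Rightarrow> nat \<Rightarrow> real" where
  "undecided d k = (\<Prod>j<k. miss_majorant d j)"

lemma undecided_bound:
  "measure lab {x \<in> space lab. \<forall>j<k. (0 :: int ^ 'd::finite) \<notin> clus x j} \<le> undecided CARD('d) k"
  unfolding miss_product undecided_def by (intro prod_mono conjI miss_le_majorant)

text \<open>Ratio test: the quotient of consecutive terms is a quadratic polynomial in
  \<open>j\<close> times a constant times \<open>2 powr (- 2 * (1 - \<alpha>) * j)\<close>, which
  tends to 0 exactly because \<open>\<alpha> < 1\<close>.\<close>

lemma summable_moment:
  assumes \<alpha>: "\<alpha> < 1"
  shows "summable (\<lambda>k. real (rho TYPE('d::finite) k) powr \<alpha> * undecided CARD('d) k)"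
proof -
  define f where "f = (\<lambda>k. real (rho TYPE('d) k) powr \<alpha> * undecided CARD('d) k)"
  define M where "M = Mc CARD('d)"
  define g where "g = (\<lambda>j::nat. 2 powr (\<alpha> * (2 * real j + 15)) * M * (real j + 7)\<^sup>2 * 2 powr (- (2 * real j + 13)))"
  have fpos: "f k > 0" for k
    unfolding f_def undecided_def
    by (intro mult_pos_pos prod_pos) (auto simp: rho_def rad_def bn_def majorant_pos)
  have step: "f (Suc (Suc j)) = g j * f (Suc j)" for j
  proof -
    \<comment> \<open>The radius is one level ahead of the last factor of \<open>undecided\<close>,
      hence 15 here against 13 below. This lag costs only a constant factor.\<close>
    have "real (rho TYPE('d) (Suc (Suc j))) = 2 ^ (2 * j + 15) * real (rho TYPE('d) (Suc j))"
    proof -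
      have "2 * Suc j + 13 = 2 * j + 15" by simp
      then show ?thesis unfolding rho_def rad_def bn_Suc[of "Suc j"] by (simp only: of_nat_mult of_nat_power of_nat_numeral mult_ac)
    qed
    then have r: "real (rho TYPE('d) (Suc (Suc j))) powr \<alpha>
        = 2 powr (\<alpha> * (2 * real j + 15)) * real (rho TYPE('d) (Suc j)) powr \<alpha>"
      by (simp add: powr_mult powr_realpow[symmetric] powr_powr mult.commute)
    have "real (bn j) / real (bn (Suc j)) = 2 powr (- (2 * real j + 13))"
    proof -
      have "real (bn j) / real (bn (Suc j)) = 1 / 2 ^ (2 * j + 13)"
        unfolding bn_Suc[of j] by (simp add: bn_def)
      also have "\<dots> = 2 powr (- real (2 * j + 13))"
        by (simp only: powr_minus powr_realpow zero_less_numeral inverse_eq_divide)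
      finally show ?thesis by simp
    qed
    then have "undecided CARD('d) (Suc (Suc j)) = undecided CARD('d) (Suc j) * (M * (real j + 7)\<^sup>2 * 2 powr (- (2 * real j + 13)))"
      by (simp add: undecided_def miss_majorant_def M_def add.commute)
    then show ?thesis unfolding f_def r g_def by (simp only: mult_ac)
  qed
  have "g \<longlonglongrightarrow> 0"
  proof -
    define \<delta> where "\<delta> = 2 * (1 - \<alpha>)"
    have \<delta>: "\<delta> > 0" using \<alpha> by (simp add: \<delta>_def)
    have "g j = (2 powr (15 * \<alpha> - 13) * M) * ((real j + 7)\<^sup>2 * 2 powr (- (\<delta> * real j)))" for j :: nat
    proof -
      have "2 powr (\<alpha> * (2 * real j + 15)) * 2 powr (- (2 * real j + 13))
          = 2 powr (15 * \<alpha> - 13) * 2 powr (- (\<delta> * real j))"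
        by (simp add: powr_add[symmetric] \<delta>_def algebra_simps)
      then show ?thesis unfolding g_def by (simp add: mult_ac)
    qed
    then have "g = (\<lambda>j. (2 powr (15 * \<alpha> - 13) * M) * ((real j + 7)\<^sup>2 * 2 powr (- (\<delta> * real j))))" ..
    moreover have "(\<lambda>j::nat. (real j + 7)\<^sup>2 * 2 powr (- (\<delta> * real j))) \<longlonglongrightarrow> 0"
      using \<delta> by real_asymp
    ultimately show ?thesis by (simp only: tendsto_mult_right_zero)
  qed
  then have "\<forall>\<^sub>F j in sequentially. g j < 1 / 2" by (rule order_tendstoD) simp
  then obtain N where N: "\<And>j. j \<ge> N \<Longrightarrow> g j < 1 / 2" by (auto simp: eventually_sequentially)
  have "summable f"
  proof (rule summable_ratio_test[of "1 / 2" "Suc N"])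
    fix n assume n: "Suc N \<le> n"
    then obtain j where j: "n = Suc j" "N \<le> j" by (cases n) auto
    have "f (Suc n) = g j * f n" using step[of j] j by simp
    also have "\<dots> \<le> 1 / 2 * f n" using N[OF j(2)] fpos[of n] by (intro mult_right_mono) auto
    finally show "norm (f (Suc n)) \<le> 1 / 2 * norm (f n)" using fpos[of n] fpos[of "Suc n"] by simp
  qed simp
  then show ?thesis by (simp add: f_def)
qed

lemma moment_island_alg:
  assumes "\<alpha> < 1"
  shows "moment (island_alg :: ('d::finite, nat) local_alg) \<alpha> < \<infinity>"
proof -
  let ?A = "island_alg :: ('d, nat) local_alg"
  define f where "f = (\<lambda>k. real (rho TYPE('d) k) powr \<alpha> * undecided CARD('d) k)"
  define a where "a = (\<lambda>r. ennreal (real r powr \<alpha>) * emeasure lab {x \<in> space lab. coding_radius ?A x 0 = enat r})"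
  have mis: "0 \<notin> clus x j" if "x \<in> space lab" "coding_radius ?A x 0 = enat (rho TYPE('d) k)" "j < k" for x j k
  proof -
    have "rho TYPE('d) j < rho TYPE('d) k" using that(3) rho_mono strict_monoD by blast
    then show ?thesis using that(2) view_island_alg[OF that(1), of 0 "rho TYPE('d) j"]
      unfolding coding_radius_eq_enat by blast
  qed
  have zero: "a r = 0" if r: "r \<notin> range (rho TYPE('d))" for r
  proof -
    have "{x \<in> space lab. coding_radius ?A x 0 = enat r} = {}"
      using r view_island_alg[where 'd = 'd, of _ 0 r] by (auto simp: coding_radius_eq_enat)
    then show ?thesis unfolding a_def by (simp only: emeasure_empty mult_zero_right)
  qed
  have "moment ?A \<alpha> = (\<Sum>r. a r)" unfolding moment_def random_labels_eq a_def ..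
  also have "\<dots> = (\<Sum>k. a (rho TYPE('d) k))"
    by (rule suminf_mono_reindex[symmetric, OF rho_mono zero])
  also have "\<dots> \<le> (\<Sum>k. ennreal (f k))"
  proof (intro suminf_le summableI)
    fix k
    have "emeasure lab {x \<in> space lab. coding_radius ?A x 0 = enat (rho TYPE('d) k)}
       \<le> emeasure lab {x \<in> space lab. \<forall>j<k. (0 :: int ^ 'd) \<notin> clus x j}"
      using mis by (intro emeasure_mono) (auto, measurable)
    also have "\<dots> \<le> ennreal (undecided CARD('d) k)"
      unfolding L.emeasure_eq_measure by (intro ennreal_leI undecided_bound)
    finally show "a (rho TYPE('d) k) \<le> ennreal (f k)"
      unfolding a_def f_def by (subst ennreal_mult) (auto simp: undecided_def intro!: mult_left_mono prod_nonneg less_imp_le[OF majorant_pos])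
  qed
  also have "\<dots> < \<infinity>"
  proof -
    have "(\<Sum>k. ennreal (f k)) = ennreal (\<Sum>k. f k)"
      using summable_moment[OF assms] unfolding f_def
      by (intro suminf_ennreal2) (auto simp: undecided_def intro!: mult_nonneg_nonneg prod_nonneg less_imp_le[OF majorant_pos])
    then show ?thesis by (simp add: less_top)
  qed
  finally show ?thesis .
qed

text \<open>Summability for \<open>\<alpha> = 0\<close> already makes the probability of being
  missed by the first \<open>k\<close> levels tend to 0.\<close>

lemma AE_covered: "AE x in lab. \<forall>v :: int ^ 'd::finite. \<exists>k. v \<in> clus x k"
proof (subst AE_all_countable, rule allI)
  fix v :: "int ^ 'd"
  have sh: "v \<in> clus x k \<longleftrightarrow> 0 \<in> clus (\<lambda>w. x (v + w)) k" for x k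
  proof -
    have "agree (- v) (12 * bs k) v (clus x k) (clus (\<lambda>w. x (v + w)) k)" by (rule clus_agree) auto
    moreover have "near (12 * bs k) v v" using bs_large[of k] by simp
    ultimately show ?thesis unfolding agree_def by force
  qed
  have "summable (\<lambda>k. real (rho TYPE('d) k) powr 0 * undecided CARD('d) k)" by (rule summable_moment) simp
  then have "summable (undecided CARD('d))" by (simp add: rho_def rad_def bn_def)
  then have lim: "undecided CARD('d) \<longlonglongrightarrow> 0" by (rule summable_LIMSEQ_zero)
  let ?N = "{x \<in> space lab. \<forall>k. v \<notin> clus x k}"
  have "measure lab ?N = measure lab {x \<in> space lab. \<forall>k. (0 :: int ^ 'd) \<notin> clus (\<lambda>w. x (v + w)) k}"
    by (simp add: sh)
  also have "\<dots> = measure lab {x \<in> space lab. \<forall>k. (0 :: int ^ 'd) \<notin> clus x k}"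
    by (rule reindex_law[where V = UNIV]) (auto simp: depends_on_def fun_eq_iff[symmetric] inj_on_def)
  finally have N: "measure lab ?N = measure lab {x \<in> space lab. \<forall>k. (0 :: int ^ 'd) \<notin> clus x k}" .
  have "measure lab ?N \<le> undecided CARD('d) k" for k
  proof -
    have "measure lab ?N \<le> measure lab {x \<in> space lab. \<forall>j<k. (0 :: int ^ 'd) \<notin> clus x j}"
      unfolding N by (rule L.finite_measure_mono) auto
    then show ?thesis using undecided_bound[where 'd = 'd, of k] by simp
  qed
  then have "measure lab ?N \<le> 0" using lim by (intro LIMSEQ_le_const) auto
  then have "measure lab ?N = 0" by (simp add: measure_le_0_iff)
  then have "AE x in lab. \<not> (\<forall>k. v \<notin> clus x k)" by (subst (asm) L.prob_eq_0) auto
  then show "AE x in lab. \<exists>k. v \<in> clus x k" by simp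
qed

lemma solves_island_alg: "solves (island_alg :: ('d::finite, nat) local_alg) (proper_coloring 3)"
proof -
  let ?A = "island_alg :: ('d, nat) local_alg"
  have "AE x in lab. (\<forall>v. halts ?A x v) \<and> (\<forall>(u, v)\<in>grid_adj. alg_output ?A x u \<noteq> alg_output ?A x v)"
    using AE_covered AE_space
  proof eventually_elim
    fix x :: "int ^ 'd \<Rightarrow> real"
    assume cov: "\<forall>v. \<exists>k. v \<in> clus x k" and x: "x \<in> space lab"
    have h: "halts ?A x v" "alg_output ?A x v = colour (clus x) v" for v
      using output_island_alg[OF x] cov by blast+
    have "colour (clus x) u \<noteq> colour (clus x) v" if "(u, v) \<in> grid_adj" for u v
      using colour_proper[of "clus x" u v] cov that by blast
    then show "(\<forall>v. halts ?A x v) \<and> (\<forall>(u, v)\<in>grid_adj. alg_output ?A x u \<noteq> alg_output ?A x v)"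
      by (auto simp: h)
  qed
  then show ?thesis
    unfolding solves_def proper_coloring_def random_labels_eq using uniform_island_alg by simp
qed

lemma moment_mono:
  assumes "0 \<le> \<alpha>" "\<alpha> \<le> \<beta>"
  shows "moment A \<alpha> \<le> moment A \<beta>"
  unfolding moment_def
proof (intro suminf_le summableI mult_right_mono ennreal_leI)
  fix r :: nat
  show "real r powr \<alpha> \<le> real r powr \<beta>"
    using assms by (cases "r = 0") (auto intro: powr_mono)
qed auto

theorem corollary5p2:
  fixes P :: "('d::finite, nat) grid_problem"
  assumes "CARD('d) > 1"
    and "P = proper_coloring 3"
  shows "(\<forall>A. solves A P \<longrightarrow> moment A 1 = \<infinity>)
    \<and> (\<exists>A. solves A P \<and> (\<forall>\<epsilon>::real. 0 < \<epsilon> \<and> \<epsilon> \<le> 1 \<longrightarrow> moment A (1 - \<epsilon>) < \<infinity>))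
    \<and> sup_moment P = 1"
proof (intro conjI)
  have "\<not> card (UNIV :: 'd set) \<le> Suc 0" using assms(1) by simp
  then obtain i1 i2 :: 'd where ne: "i1 \<noteq> i2" by (auto simp: card_le_Suc0_iff_eq)
  show lower: "\<forall>A. solves A P \<longrightarrow> moment A 1 = \<infinity>"
  proof (intro allI impI)
    fix A assume "solves A P"
    then interpret three_colouring A i1 i2 by unfold_locales (simp_all add: ne assms(2))
    show "moment A 1 = \<infinity>" by (rule moment_infinite)
  qed
  have upper: "solves island_alg P" "\<alpha> < 1 \<Longrightarrow> moment (island_alg :: ('d, nat) local_alg) \<alpha> < \<infinity>" for \<alpha>
    using solves_island_alg moment_island_alg by (simp_all add: assms(2))
  then show "\<exists>A. solves A P \<and> (\<forall>\<epsilon>::real. 0 < \<epsilon> \<and> \<epsilon> \<le> 1 \<longrightarrow> moment A (1 - \<epsilon>) < \<infinity>)"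
    by (intro exI[of _ island_alg]) auto
  show "sup_moment P = 1"
  proof (rule antisym)
    show "sup_moment P \<le> 1"
      unfolding sup_moment_def
    proof (rule Sup_least)
      fix m assume "m \<in> {ennreal \<alpha> | \<alpha>. 0 \<le> \<alpha> \<and> (\<exists>A. solves A P \<and> moment A \<alpha> < \<infinity>)}"
      then obtain \<alpha> A where m: "m = ennreal \<alpha>" and A: "solves A P" "moment A \<alpha> < \<infinity>" by blast
      have "\<alpha> < 1"
      proof (rule ccontr)
        assume "\<not> \<alpha> < 1"
        then have "moment A 1 \<le> moment A \<alpha>" by (intro moment_mono) auto
        then show False using lower A by (metis top.not_eq_extremum top.extremum_unique infinity_ennreal_def)
      qed
      then show "m \<le> 1" unfolding m by (simp add: ennreal_le_1)
    qed
    show "1 \<le> sup_moment P"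
    \<comment> \<open>The exponent 1 is not attained, so the supremum is approached from
      below.\<close>
    proof (rule dense_le_bounded[of 0])
      fix y :: ennreal assume y: "0 < y" "y < 1"
      then obtain \<alpha> where \<alpha>: "y = ennreal \<alpha>" "0 \<le> \<alpha>" by (cases y) auto
      then have "\<alpha> < 1" using y(2) by (simp add: ennreal_less_one_iff)
      then have "\<exists>A. solves A P \<and> moment A \<alpha> < \<infinity>" using upper by blast
      then show "y \<le> sup_moment P" unfolding sup_moment_def \<alpha>(1) using \<alpha>(2) by (intro Sup_upper) blast
    qed simp
  qed
qed

end
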